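(* Let $\kappa-4\tau^2\neq0$ and let $\Sigma$ be an $H$-surface in $\mathbb{E}(\kappa,\tau)$ with $H^2+\tau^2\neq 0$. Then the traceless Abresch-Rosenberg shape operator $S$ satisfies $$\frac12\Delta|S|^2=|\nabla S|^2+2K|S|^2,$$ or, equivalently, away from the zeroes of $|S|$, $$|S|\,\Delta|S|-2K|S|^2=\big|\nabla|S|\big|^2 ,$$ where $K$ is the Gaussian curvature of $\Sigma$ and $\Delta$, $\nabla$ are the Laplacian and Levi-Civita connection of the induced metric.
   Context: For $\kappa,\tau\in\mathbb{R}$ with $\kappa-4\tau^2\ne0$, $\mathbb{E}(\kappa,\tau)$ is the simply connected oriented homogeneous Riemannian 3-manifold with a Riemannian submersion $\pi:\mathbb{E}(\kappa,\tau)\to\mathbb{M}^2(\kappa)$ onto the complete simply connected surface of constant curvature $\kappa$, whose fibers are the trajectories of a unit Killing field $\xi$ satisfying $\overline\nabla_X\xi=\tau\,X\wedge\xi$ ($\overline\nabla$ the Levi-Civita connection, $\wedge$ the cross product). An $H$-surface is a connected oriented immersed surface $\Sigma$ of constant mean curvature $H=\frac12\mathrm{tr}A$, where $N$ is the unit normal and $AX=-\overline\nabla_XN$ is the shape operator. Let $JX=N\wedge X$ on $T\Sigma$, $\nu=\langle N,\xi\rangle$, $\mathbf{T}=\xi-\nu N$. When $H^2+\tau^2\ne0$, set $\alpha=\frac{\kappa-4\tau^2}{2\sqrt{H^2+\tau^2}}$, choose $\theta\in[0,2\pi)$ with $e^{2i\theta}=\frac{H-i\tau}{\sqrt{H^2+\tau^2}}$,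 and let $\mathbf{T}_\theta=\cos\theta\,\mathbf{T}-\sin\theta\,J\mathbf{T}$. The traceless Abresch-Rosenberg shape operator is $$SX=AX-\alpha\langle\mathbf{T}_\theta,X\rangle\mathbf{T}_\theta+\frac{\alpha|\mathbf{T}|^2}{2}X-HX,$$ and $|S|^2=\mathrm{tr}(S^2)$; $|\nabla S|$ is the tensor norm of the covariant derivative of $S$. *)

theory Defs
  imports "HOL-Analysis.Analysis"
begin

section \<open>Smooth functions on open subsets of Euclidean space\<close>

definition pderiv_at :: "'n::finite \<Rightarrow> (real^'n \<Rightarrow> 'b::real_normed_vector) \<Rightarrow> real^'n \<Rightarrow> 'b" where
  "pderiv_at i f x = frechet_derivative f (at x) (axis i 1)"

primrec Ck_on :: "nat \<Rightarrow> (real^'n::finite) set \<Rightarrow> (real^'n \<Rightarrow> 'b::real_normed_vector) \<Rightarrow> bool" where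
  "Ck_on 0 U f \<longleftrightarrow> continuous_on U f"
| "Ck_on (Suc k) U f \<longleftrightarrow>
     (\<forall>x\<in>U. f differentiable (at x)) \<and> (\<forall>i. Ck_on k U (pderiv_at i f))"

definition smooth_on :: "(real^'n::finite) set \<Rightarrow> (real^'n \<Rightarrow> 'b::real_normed_vector) \<Rightarrow> bool" where
  "smooth_on U f \<longleftrightarrow> (\<forall>k. Ck_on k U f)"


section \<open>Riemannian calculus in one chart\<close>

text \<open>
  A metric on an open set of coordinates is a field \<open>g\<close> of Gram matrices. Tangent vectors are
  coordinate vectors.
\<close>

definition ip :: "real^'n^'n \<Rightarrow> real^'n \<Rightarrow> real^'n \<Rightarrow> real" where
  "ip A X Y = X \<bullet> (A *v Y)"

text \<open>\<open>christoffel g x k i j\<close> is the symbol with upper index \<open>k\<close> and lower indices \<open>i\<close>, \<open>j\<close>.\<close>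

definition christoffel :: "(real^'n \<Rightarrow> real^'n^'n) \<Rightarrow> real^'n \<Rightarrow> 'n::finite \<Rightarrow> 'n \<Rightarrow> 'n \<Rightarrow> real" where
  "christoffel g x k i j =
     1/2 * (\<Sum>l\<in>UNIV. matrix_inv (g x) $ k $ l *
       (pderiv_at i g x $ j $ l + pderiv_at j g x $ i $ l - pderiv_at l g x $ i $ j))"

text \<open>
  Levi-Civita derivative, in the direction \<open>X\<close> of the parameter space, of a vector field \<open>W\<close>
  along a map \<open>F\<close>; with \<open>F\<close> the identity this is the derivative of a vector field.
\<close>

definition cov_along ::
  "(real^'n \<Rightarrow> real^'n^'n) \<Rightarrow> (real^'m::finite \<Rightarrow> real^'n::finite) \<Rightarrow> (real^'m \<Rightarrow> real^'n) \<Rightarrow>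
   real^'m \<Rightarrow> real^'m \<Rightarrow> real^'n" where
  "cov_along g F W u X = frechet_derivative W (at u) X +
     (\<chi> k. \<Sum>i\<in>UNIV. \<Sum>j\<in>UNIV.
        christoffel g (F u) k i j * frechet_derivative F (at u) X $ i * W u $ j)"

definition cov :: "(real^'n \<Rightarrow> real^'n^'n) \<Rightarrow> (real^'n::finite \<Rightarrow> real^'n) \<Rightarrow> real^'n \<Rightarrow> real^'n \<Rightarrow> real^'n" where
  "cov g V = cov_along g (\<lambda>x. x) V"

definition grad :: "(real^'n \<Rightarrow> real^'n^'n) \<Rightarrow> (real^'n::finite \<Rightarrow> real) \<Rightarrow> real^'n \<Rightarrow> real^'n" where
  "grad g \<phi> x = matrix_inv (g x) *v (\<chi> i. pderiv_at i \<phi> x)"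

definition laplacian :: "(real^'n \<Rightarrow> real^'n^'n) \<Rightarrow> (real^'n::finite \<Rightarrow> real) \<Rightarrow> real^'n \<Rightarrow> real" where
  "laplacian g \<phi> x = trace (matrix (cov g (grad g \<phi>) x))"

text \<open>
  \<open>curv g x X Y Z\<close> is \<open>R(X, Y) Z\<close>, computed with the constant-coefficient extensions of
  \<open>X\<close>, \<open>Y\<close>, \<open>Z\<close>, for which the bracket term vanishes. With this sign, round spheres have
  positive curvature below.
\<close>

definition curv ::
  "(real^'n \<Rightarrow> real^'n^'n) \<Rightarrow> real^'n::finite \<Rightarrow> real^'n \<Rightarrow> real^'n \<Rightarrow> real^'n \<Rightarrow> real^'n" where
  "curv g x X Y Z = cov g (\<lambda>y. cov g (\<lambda>_. Z) y Y) x X - cov g (\<lambda>y. cov g (\<lambda>_. Z) y X) x Y"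

definition gauss_curvature :: "(real^2 \<Rightarrow> real^2^2) \<Rightarrow> real^2 \<Rightarrow> real" where
  "gauss_curvature g x =
     ip (g x) (curv g x (axis 1 1) (axis 2 1) (axis 2 1)) (axis 1 1) / det (g x)"

text \<open>
  Covariant derivative of a field \<open>S\<close> of endomorphisms, \<open>(\<nabla>\<^sub>X S) Y = \<nabla>\<^sub>X (S Y) - S (\<nabla>\<^sub>X Y)\<close>,
  with \<open>Y\<close> extended by constant coefficients.
\<close>

definition cov_endo ::
  "(real^'n \<Rightarrow> real^'n^'n) \<Rightarrow> (real^'n::finite \<Rightarrow> real^'n \<Rightarrow> real^'n) \<Rightarrow>
   real^'n \<Rightarrow> real^'n \<Rightarrow> real^'n \<Rightarrow> real^'n" where
  "cov_endo g S x X Y = cov g (\<lambda>y. S y Y) x X - S x (cov g (\<lambda>_. Y) x X)"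

definition normsq_cov_endo ::
  "(real^'n \<Rightarrow> real^'n^'n) \<Rightarrow> (real^'n::finite \<Rightarrow> real^'n \<Rightarrow> real^'n) \<Rightarrow> real^'n \<Rightarrow> real" where
  "normsq_cov_endo g S x =
     (\<Sum>i\<in>UNIV. \<Sum>j\<in>UNIV. \<Sum>k\<in>UNIV. \<Sum>l\<in>UNIV.
        matrix_inv (g x) $ i $ k * matrix_inv (g x) $ j $ l *
        ip (g x) (cov_endo g S x (axis i 1) (axis j 1)) (cov_endo g S x (axis k 1) (axis l 1)))"

definition endo_normsq :: "(real^'n \<Rightarrow> real^'n) \<Rightarrow> real" where
  "endo_normsq L = trace (matrix L ** matrix L)"

text \<open>
  The cross product for the Gram matrix \<open>A\<close> in positively oriented coordinates, characterised
  by \<open>ip A (wedge A X Y) Z = sqrt (det A) * det [X, Y, Z]\<close>.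
\<close>

definition wedge :: "real^3^3 \<Rightarrow> real^3 \<Rightarrow> real^3 \<Rightarrow> real^3" where
  "wedge A X Y = sqrt (det A) *\<^sub>R (matrix_inv A *v cross3 X Y)"


section \<open>Manifolds\<close>

record ('a, 'n) chart =
  chart_dom :: "'a set"
  chart_map :: "'a \<Rightarrow> real^'n"

definition chart_img :: "('a, 'n::finite) chart \<Rightarrow> (real^'n) set" where
  "chart_img c = chart_map c ` chart_dom c"

definition chart_inv :: "('a, 'n::finite) chart \<Rightarrow> real^'n \<Rightarrow> 'a" where
  "chart_inv c = inv_into (chart_dom c) (chart_map c)"

definition points :: "('a, 'n::finite) chart set \<Rightarrow> 'a set" where
  "points \<A> = (\<Union>c\<in>\<A>. chart_dom c)"

definition local_rep ::
  "('a, 'm::finite) chart \<Rightarrow> ('b, 'n::finite) chart \<Rightarrow> ('a \<Rightarrow> 'b) \<Rightarrow> real^'m \<Rightarrow> real^'n" where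
  "local_rep c d f = chart_map d \<circ> f \<circ> chart_inv c"

definition local_dom ::
  "('a, 'm::finite) chart \<Rightarrow> ('b, 'n::finite) chart \<Rightarrow> ('a \<Rightarrow> 'b) \<Rightarrow> (real^'m) set" where
  "local_dom c d f = chart_map c ` {p \<in> chart_dom c. f p \<in> chart_dom d}"

locale smooth_manifold =
  fixes \<A> :: "('a::{t2_space, second_countable_topology}, 'n::finite) chart set"
  assumes chart_open: "c \<in> \<A> \<Longrightarrow> open (chart_dom c)" "c \<in> \<A> \<Longrightarrow> open (chart_img c)"
    and chart_homeomorphism:
      "c \<in> \<A> \<Longrightarrow> homeomorphism (chart_dom c) (chart_img c) (chart_map c) (chart_inv c)"
    and transition_smooth:
      "c \<in> \<A> \<Longrightarrow> d \<in> \<A> \<Longrightarrow> smooth_on (local_dom c d (\<lambda>p. p)) (local_rep c d (\<lambda>p. p))"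

locale oriented_manifold = smooth_manifold +
  assumes transition_pos:
      "c \<in> \<A> \<Longrightarrow> d \<in> \<A> \<Longrightarrow> x \<in> local_dom c d (\<lambda>p. p) \<Longrightarrow>
       det (jacobian (local_rep c d (\<lambda>p. p)) (at x)) > 0"

definition smooth_map ::
  "('a::topological_space, 'm::finite) chart set \<Rightarrow> ('b::topological_space, 'n::finite) chart set \<Rightarrow>
   ('a \<Rightarrow> 'b) \<Rightarrow> bool" where
  "smooth_map \<A> \<B> f \<longleftrightarrow>
     continuous_on (points \<A>) f \<and> f ` points \<A> \<subseteq> points \<B> \<and>
     (\<forall>c\<in>\<A>. \<forall>d\<in>\<B>. smooth_on (local_dom c d f) (local_rep c d f))"

text \<open>
  A tensor field is given by its components in every chart of the atlas, subject to the
  transformation law under changes of charts.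
\<close>

locale riemannian_manifold = smooth_manifold \<A>
  for \<A> :: "('a::{t2_space, second_countable_topology}, 'n::finite) chart set" +
  fixes g :: "('a, 'n) chart \<Rightarrow> real^'n \<Rightarrow> real^'n^'n"
  assumes metric_smooth: "c \<in> \<A> \<Longrightarrow> smooth_on (chart_img c) (g c)"
    and metric_sym: "c \<in> \<A> \<Longrightarrow> x \<in> chart_img c \<Longrightarrow> transpose (g c x) = g c x"
    and metric_pos: "c \<in> \<A> \<Longrightarrow> x \<in> chart_img c \<Longrightarrow> X \<noteq> 0 \<Longrightarrow> ip (g c x) X X > 0"
    and metric_transform:
      "c \<in> \<A> \<Longrightarrow> d \<in> \<A> \<Longrightarrow> x \<in> local_dom c d (\<lambda>p. p) \<Longrightarrow>
       ip (g c x) X Y =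
         ip (g d (local_rep c d (\<lambda>p. p) x))
           (frechet_derivative (local_rep c d (\<lambda>p. p)) (at x) X)
           (frechet_derivative (local_rep c d (\<lambda>p. p)) (at x) Y)"

definition vector_field ::
  "('a, 'n::finite) chart set \<Rightarrow> (('a, 'n) chart \<Rightarrow> real^'n \<Rightarrow> real^'n) \<Rightarrow> bool" where
  "vector_field \<A> V \<longleftrightarrow>
     (\<forall>c\<in>\<A>. smooth_on (chart_img c) (V c)) \<and>
     (\<forall>c\<in>\<A>. \<forall>d\<in>\<A>. \<forall>x\<in>local_dom c d (\<lambda>p. p).
        V d (local_rep c d (\<lambda>p. p) x) = frechet_derivative (local_rep c d (\<lambda>p. p)) (at x) (V c x))"

definition trajectory ::
  "('a::topological_space, 'n::finite) chart set \<Rightarrow> (('a, 'n) chart \<Rightarrow> real^'n \<Rightarrow> real^'n) \<Rightarrow>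
   (real \<Rightarrow> 'a) \<Rightarrow> bool" where
  "trajectory \<A> V \<gamma> \<longleftrightarrow>
     continuous_on UNIV \<gamma> \<and> range \<gamma> \<subseteq> points \<A> \<and>
     (\<forall>t. \<forall>c\<in>\<A>. \<gamma> t \<in> chart_dom c \<longrightarrow>
        ((\<lambda>s. chart_map c (\<gamma> s)) has_vector_derivative V c (chart_map c (\<gamma> t))) (at t))"

definition killing_field ::
  "('a, 'n::finite) chart set \<Rightarrow> (('a, 'n) chart \<Rightarrow> real^'n \<Rightarrow> real^'n^'n) \<Rightarrow>
   (('a, 'n) chart \<Rightarrow> real^'n \<Rightarrow> real^'n) \<Rightarrow> bool" where
  "killing_field \<A> g V \<longleftrightarrow> vector_field \<A> V \<and>
     (\<forall>c\<in>\<A>. \<forall>x\<in>chart_img c. \<forall>X Y.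
        ip (g c x) (cov (g c) (V c) x X) Y + ip (g c x) X (cov (g c) (V c) x Y) = 0)"

definition complete_geodesic ::
  "('a::topological_space, 'n::finite) chart set \<Rightarrow> (('a, 'n) chart \<Rightarrow> real^'n \<Rightarrow> real^'n^'n) \<Rightarrow>
   (real \<Rightarrow> 'a) \<Rightarrow> bool" where
  "complete_geodesic \<A> g \<gamma> \<longleftrightarrow>
     continuous_on UNIV \<gamma> \<and> range \<gamma> \<subseteq> points \<A> \<and>
     (\<forall>t. \<forall>c\<in>\<A>. \<gamma> t \<in> chart_dom c \<longrightarrow>
        (\<exists>v. (\<forall>\<^sub>F s in nhds t. ((\<lambda>r. chart_map c (\<gamma> r)) has_vector_derivative v s) (at s)) \<and>
             (v has_vector_derivative
               - (\<chi> k. \<Sum>i\<in>UNIV. \<Sum>j\<in>UNIV.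
                    christoffel (g c) (chart_map c (\<gamma> t)) k i j * v t $ i * v t $ j)) (at t)))"

definition geodesically_complete ::
  "('a::topological_space, 'n::finite) chart set \<Rightarrow> (('a, 'n) chart \<Rightarrow> real^'n \<Rightarrow> real^'n^'n) \<Rightarrow> bool" where
  "geodesically_complete \<A> g \<longleftrightarrow>
     (\<forall>c\<in>\<A>. \<forall>p\<in>chart_dom c. \<forall>v. \<exists>\<gamma>. complete_geodesic \<A> g \<gamma> \<and> \<gamma> 0 = p \<and>
        ((\<lambda>s. chart_map c (\<gamma> s)) has_vector_derivative v) (at 0))"

definition isometry_of ::
  "('a::topological_space, 'n::finite) chart set \<Rightarrow> (('a, 'n) chart \<Rightarrow> real^'n \<Rightarrow> real^'n^'n) \<Rightarrow>
   ('a \<Rightarrow> 'a) \<Rightarrow> bool" where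
  "isometry_of \<A> g \<phi> \<longleftrightarrow>
     bij_betw \<phi> (points \<A>) (points \<A>) \<and>
     smooth_map \<A> \<A> \<phi> \<and> smooth_map \<A> \<A> (inv_into (points \<A>) \<phi>) \<and>
     (\<forall>c\<in>\<A>. \<forall>d\<in>\<A>. \<forall>x\<in>local_dom c d \<phi>. \<forall>X Y.
        ip (g c x) X Y =
          ip (g d (local_rep c d \<phi> x))
            (frechet_derivative (local_rep c d \<phi>) (at x) X)
            (frechet_derivative (local_rep c d \<phi>) (at x) Y))"

definition homogeneous ::
  "('a::topological_space, 'n::finite) chart set \<Rightarrow> (('a, 'n) chart \<Rightarrow> real^'n \<Rightarrow> real^'n^'n) \<Rightarrow> bool" where
  "homogeneous \<A> g \<longleftrightarrow> (\<forall>p\<in>points \<A>. \<forall>q\<in>points \<A>. \<exists>\<phi>. isometry_of \<A> g \<phi> \<and> \<phi> p = q)"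

definition riemannian_submersion ::
  "('a::topological_space, 'm::finite) chart set \<Rightarrow> (('a, 'm) chart \<Rightarrow> real^'m \<Rightarrow> real^'m^'m) \<Rightarrow>
   ('b::topological_space, 'n::finite) chart set \<Rightarrow> (('b, 'n) chart \<Rightarrow> real^'n \<Rightarrow> real^'n^'n) \<Rightarrow>
   ('a \<Rightarrow> 'b) \<Rightarrow> bool" where
  "riemannian_submersion \<A> g \<B> h \<pi> \<longleftrightarrow>
     smooth_map \<A> \<B> \<pi> \<and> \<pi> ` points \<A> = points \<B> \<and>
     (\<forall>c\<in>\<A>. \<forall>d\<in>\<B>. \<forall>x\<in>local_dom c d \<pi>.
        let D = frechet_derivative (local_rep c d \<pi>) (at x) in
          surj D \<and>
          (\<forall>X. (\<forall>V. D V = 0 \<longrightarrow> ip (g c x) X V = 0) \<longrightarrow>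
             ip (h d (local_rep c d \<pi> x)) (D X) (D X) = ip (g c x) X X))"


section \<open>The homogeneous spaces and their surfaces\<close>

text \<open>\<open>\<M>\<close> with \<open>h\<close> is the base surface, \<open>\<E>\<close> with \<open>g\<close> the total space, \<open>\<xi>\<close> the vertical field.\<close>

locale E_kappa_tau =
  total: riemannian_manifold \<E> g + total: oriented_manifold \<E> + base: riemannian_manifold \<M> h
  for \<kappa> \<tau> :: real
    and \<E> :: "('e::{t2_space, second_countable_topology}, 3) chart set"
    and g :: "('e, 3) chart \<Rightarrow> real^3 \<Rightarrow> real^3^3"
    and \<M> :: "('b::{t2_space, second_countable_topology}, 2) chart set"
    and h :: "('b, 2) chart \<Rightarrow> real^2 \<Rightarrow> real^2^2"
    and \<pi> :: "'e \<Rightarrow> 'b"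
    and \<xi> :: "('e, 3) chart \<Rightarrow> real^3 \<Rightarrow> real^3" +
  assumes base_simply_connected: "simply_connected (points \<M>)"
    and base_complete: "geodesically_complete \<M> h"
    and base_curvature: "d \<in> \<M> \<Longrightarrow> y \<in> chart_img d \<Longrightarrow> gauss_curvature (h d) y = \<kappa>"
    and total_simply_connected: "simply_connected (points \<E>)"
    and total_homogeneous: "homogeneous \<E> g"
    and submersion: "riemannian_submersion \<E> g \<M> h \<pi>"
    and xi_killing: "killing_field \<E> g \<xi>"
    and xi_unit: "c \<in> \<E> \<Longrightarrow> x \<in> chart_img c \<Longrightarrow> ip (g c x) (\<xi> c x) (\<xi> c x) = 1"
    and xi_fibers:
      "p \<in> points \<E> \<Longrightarrow>
       \<exists>\<gamma>. trajectory \<E> \<xi> \<gamma> \<and> \<gamma> 0 = p \<and> {q \<in> points \<E>. \<pi> q = \<pi> p} = range \<gamma>"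
    and xi_cov:
      "c \<in> \<E> \<Longrightarrow> x \<in> chart_img c \<Longrightarrow> cov (g c) (\<xi> c) x X = \<tau> *\<^sub>R wedge (g c x) X (\<xi> c x)"

text \<open>
  Local geometry of an immersion \<open>F\<close> of a domain of the plane, with coordinates positive for
  the orientation of the surface, into oriented coordinates with metric \<open>g\<close>.
\<close>

definition induced_metric :: "(real^3 \<Rightarrow> real^3^3) \<Rightarrow> (real^2 \<Rightarrow> real^3) \<Rightarrow> real^2 \<Rightarrow> real^2^2" where
  "induced_metric g F u = (\<chi> i j. ip (g (F u)) (pderiv_at i F u) (pderiv_at j F u))"

definition unit_normal :: "(real^3 \<Rightarrow> real^3^3) \<Rightarrow> (real^2 \<Rightarrow> real^3) \<Rightarrow> real^2 \<Rightarrow> real^3" where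
  "unit_normal g F u =
     (let W = wedge (g (F u)) (pderiv_at 1 F u) (pderiv_at 2 F u)
      in (1 / sqrt (ip (g (F u)) W W)) *\<^sub>R W)"

text \<open>
  The coordinates of the tangential part of an ambient vector; for \<open>W\<close> tangent to the surface,
  the solution \<open>w\<close> of \<open>dF w = W\<close>.
\<close>

definition tangent_coords :: "(real^3 \<Rightarrow> real^3^3) \<Rightarrow> (real^2 \<Rightarrow> real^3) \<Rightarrow> real^2 \<Rightarrow> real^3 \<Rightarrow> real^2" where
  "tangent_coords g F u W =
     matrix_inv (induced_metric g F u) *v (\<chi> i. ip (g (F u)) W (pderiv_at i F u))"

definition shape_operator :: "(real^3 \<Rightarrow> real^3^3) \<Rightarrow> (real^2 \<Rightarrow> real^3) \<Rightarrow> real^2 \<Rightarrow> real^2 \<Rightarrow> real^2" where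
  "shape_operator g F u X = tangent_coords g F u (- cov_along g F (unit_normal g F) u X)"

definition mean_curvature :: "(real^3 \<Rightarrow> real^3^3) \<Rightarrow> (real^2 \<Rightarrow> real^3) \<Rightarrow> real^2 \<Rightarrow> real" where
  "mean_curvature g F u = 1/2 * trace (matrix (shape_operator g F u))"

definition rotation_J :: "(real^3 \<Rightarrow> real^3^3) \<Rightarrow> (real^2 \<Rightarrow> real^3) \<Rightarrow> real^2 \<Rightarrow> real^2 \<Rightarrow> real^2" where
  "rotation_J g F u X =
     tangent_coords g F u (wedge (g (F u)) (unit_normal g F u) (frechet_derivative F (at u) X))"

definition angle_function ::
  "(real^3 \<Rightarrow> real^3^3) \<Rightarrow> (real^3 \<Rightarrow> real^3) \<Rightarrow> (real^2 \<Rightarrow> real^3) \<Rightarrow> real^2 \<Rightarrow> real" where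
  "angle_function g \<xi> F u = ip (g (F u)) (unit_normal g F u) (\<xi> (F u))"

definition tangent_field ::
  "(real^3 \<Rightarrow> real^3^3) \<Rightarrow> (real^3 \<Rightarrow> real^3) \<Rightarrow> (real^2 \<Rightarrow> real^3) \<Rightarrow> real^2 \<Rightarrow> real^2" where
  "tangent_field g \<xi> F u =
     tangent_coords g F u (\<xi> (F u) - angle_function g \<xi> F u *\<^sub>R unit_normal g F u)"

definition rotated_tangent_field ::
  "real \<Rightarrow> (real^3 \<Rightarrow> real^3^3) \<Rightarrow> (real^3 \<Rightarrow> real^3) \<Rightarrow> (real^2 \<Rightarrow> real^3) \<Rightarrow> real^2 \<Rightarrow> real^2" where
  "rotated_tangent_field \<theta> g \<xi> F u =
     cos \<theta> *\<^sub>R tangent_field g \<xi> F u - sin \<theta> *\<^sub>R rotation_J g F u (tangent_field g \<xi> F u)"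

definition AR_alpha :: "real \<Rightarrow> real \<Rightarrow> real \<Rightarrow> real" where
  "AR_alpha \<kappa> \<tau> H = (\<kappa> - 4 * \<tau>\<^sup>2) / (2 * sqrt (H\<^sup>2 + \<tau>\<^sup>2))"

definition AR_operator ::
  "real \<Rightarrow> real \<Rightarrow> real \<Rightarrow> real \<Rightarrow> (real^3 \<Rightarrow> real^3^3) \<Rightarrow> (real^3 \<Rightarrow> real^3) \<Rightarrow> (real^2 \<Rightarrow> real^3) \<Rightarrow>
   real^2 \<Rightarrow> real^2 \<Rightarrow> real^2" where
  "AR_operator \<kappa> \<tau> H \<theta> g \<xi> F u X =
     (let \<gamma> = induced_metric g F u;
          \<alpha> = AR_alpha \<kappa> \<tau> H;
          T = tangent_field g \<xi> F u;
          T\<^sub>\<theta> = rotated_tangent_field \<theta> g \<xi> F u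
      in shape_operator g F u X - (\<alpha> * ip \<gamma> T\<^sub>\<theta> X) *\<^sub>R T\<^sub>\<theta>
         + (\<alpha> * ip \<gamma> T T / 2) *\<^sub>R X - H *\<^sub>R X)"

locale H_surface =
  surface: oriented_manifold \<S> + ambient: riemannian_manifold \<E> g + ambient: oriented_manifold \<E>
  for H :: real
    and \<S> :: "('s::{t2_space, second_countable_topology}, 2) chart set"
    and \<E> :: "('e::{t2_space, second_countable_topology}, 3) chart set"
    and g :: "('e, 3) chart \<Rightarrow> real^3 \<Rightarrow> real^3^3"
    and f :: "'s \<Rightarrow> 'e" +
  assumes surface_connected: "connected (points \<S>)"
    and immersion_smooth: "smooth_map \<S> \<E> f"
    and immersion_inj:
      "c \<in> \<S> \<Longrightarrow> e \<in> \<E> \<Longrightarrow> u \<in> local_dom c e f \<Longrightarrow>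
       inj (frechet_derivative (local_rep c e f) (at u))"
    and constant_mean_curvature:
      "c \<in> \<S> \<Longrightarrow> e \<in> \<E> \<Longrightarrow> u \<in> local_dom c e f \<Longrightarrow> mean_curvature (g e) (local_rep c e f) u = H"

end

theory Submission
  imports Defs
begin

text \<open>
  In an oriented orthonormal frame of the surface, write traceless symmetric operators as
  \<open>X \<mapsto> s \<cdot> cnj X\<close> with a complex function \<open>s\<close>, and put \<open>\<partial> = \<nabla>\<^sub>1 - i \<nabla>\<^sub>2\<close>; the operator is Codazzi iff
  \<open>\<partial>s = 0\<close>. If \<open>b\<close> is the traceless part of the shape operator and \<open>t\<close> the tangential part of \<open>\<xi>\<close>, the
  Codazzi equation of the ambient space is \<open>\<partial>b = (\<kappa> - 4\<tau>\<^sup>2) \<nu> t\<close>, and the equation for \<open>\<nabla>\<xi>\<close> gives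
  \<open>\<partial>t = 2\<nu> (H - i\<tau>)\<close>. Hence \<open>s = b - (\<alpha>/2) exp (-2i\<theta>) t\<^sup>2\<close>, the Abresch-Rosenberg operator, is
  Codazzi exactly because of the choice of \<open>\<theta>\<close> and \<open>\<alpha>\<close>.

  For a traceless Codazzi operator, \<open>\<nabla>\<^sub>J\<^sub>X s = - i \<nabla>\<^sub>X s\<close>, so the 1-form \<open>d|S|\<^sup>2 \<circ> J\<close> equals
  \<open>4 Im (cnj s \<nabla>s)\<close>; its exterior derivative is the Laplacian of \<open>|S|\<^sup>2\<close> on one side, and on the other
  side \<open>|\<nabla>S|\<^sup>2\<close> plus the curvature of the frame times \<open>|S|\<^sup>2\<close>.

  The ambient curvature is computed in the frame of \<open>\<xi>\<close> and the horizontal lifts of a base frame,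
  whose connection form is the pullback of the base connection form minus \<open>\<tau>\<close> times the form dual
  to \<open>\<xi>\<close> (O'Neill's formula).
\<close>

section \<open>Smooth functions\<close>

text \<open>Nothing is assumed about the ambient curvature: it has to be extracted from the
  submersion, the curvature of the base and the first-order equation for \<xi>. Isothermal
  parameters, in which the Abresch-Rosenberg form would be a holomorphic quadratic differential, are
  avoided because they would have to be constructed; a Gram-Schmidt frame exists in every chart and
  is smooth by its formula. This fixes the format of all computations: values are taken in
  orthonormal frames, directions of differentiation stay coordinate directions. Forms become pairs
  of coefficients, exterior derivatives become differences of partial derivatives, and brackets
  never appear. Covariant derivatives are taken along maps, so that the intrinsic geometry of a
  chart (identity map) and the pull-back connection of the immersion obey the same lemmas, and the
  ambient curvature is needed only on the two coordinate directions of the surface. The second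
  identity needs a smooth square root, hence |S| nonzero; there it is the first one rewritten, by
  the sharp Kato equality |\<nabla>|S||^2 = |\<nabla>S|^2 / 2.\<close>

lemma pderiv_at_eqI: "(f has_derivative f') (at x) \<Longrightarrow> pderiv_at i f x = f' (axis i 1)"
  unfolding pderiv_at_def by (metis frechet_derivative_at)

lemma has_derivative_frechet:
  "f differentiable (at x) \<Longrightarrow> (f has_derivative frechet_derivative f (at x)) (at x)"
  by (simp add: frechet_derivative_works)

lemma linear_axis_expansion:
  assumes "linear L"
  shows "L (X::real^'n::finite) = (\<Sum>i\<in>UNIV. X $ i *\<^sub>R L (axis i 1))"
proof -
  have "X = (\<Sum>i\<in>UNIV. X $ i *\<^sub>R axis i 1)"
    using basis_expansion[of X] by (simp add: scalar_mult_eq_scaleR)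
  then have "L X = L (\<Sum>i\<in>UNIV. X $ i *\<^sub>R axis i 1)" by (rule arg_cong)
  also have "\<dots> = (\<Sum>i\<in>UNIV. X $ i *\<^sub>R L (axis i 1))"
    using assms by (simp add: linear_sum linear_scale)
  finally show ?thesis .
qed

lemma frechet_derivative_pderiv:
  assumes "f differentiable (at x)"
  shows "frechet_derivative f (at x) X = (\<Sum>i\<in>UNIV. X $ i *\<^sub>R pderiv_at i f x)"
  unfolding pderiv_at_def using assms
  by (intro linear_axis_expansion) (simp add: linear_frechet_derivative)

lemma pderiv_at_cong:
  assumes "open U" "x \<in> U" "\<And>y. y \<in> U \<Longrightarrow> f y = g y"
  shows "pderiv_at i f x = pderiv_at i g x"
proof -
  have "(f has_derivative D) (at x) \<longleftrightarrow> (g has_derivative D) (at x)" for D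
    using has_derivative_transform_within_open[OF _ assms(1,2)] assms(3) by metis
  then show ?thesis by (simp add: pderiv_at_def frechet_derivative_def)
qed

lemma differentiable_cong:
  assumes "open U" "x \<in> U" "\<And>y. y \<in> U \<Longrightarrow> f y = g y" "f differentiable (at x)"
  shows "g differentiable (at x)"
  using assms has_derivative_transform_within_open unfolding differentiable_def by metis

lemma pderiv_at_const [simp]: "pderiv_at i (\<lambda>x. c) x = 0"
  by (simp add: pderiv_at_def)

lemma pderiv_const_fun: "pderiv_at i (\<lambda>x. c) = (\<lambda>x. 0)"
  by (rule ext) simp

lemma pderiv_at_ident [simp]: "pderiv_at i (\<lambda>x. x) x = axis i 1"
  by (simp add: pderiv_at_def)

lemma pderiv_at_bounded_linear:
  assumes "bounded_linear L" "f differentiable (at x)"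
  shows "pderiv_at i (\<lambda>x. L (f x)) x = L (pderiv_at i f x)"
  using pderiv_at_eqI[OF bounded_linear.has_derivative[OF assms(1) has_derivative_frechet[OF assms(2)]]]
  by (simp add: pderiv_at_def)

lemma pderiv_at_bounded_bilinear:
  assumes "bounded_bilinear B" "f differentiable (at x)" "g differentiable (at x)"
  shows "pderiv_at i (\<lambda>x. B (f x) (g x)) x = B (f x) (pderiv_at i g x) + B (pderiv_at i f x) (g x)"
  using pderiv_at_eqI[OF bounded_bilinear.FDERIV[OF assms(1) has_derivative_frechet[OF assms(2)]
        has_derivative_frechet[OF assms(3)]]]
  by (simp add: pderiv_at_def)

lemma differentiable_bounded_linear:
  assumes "bounded_linear L" "f differentiable (at x)"
  shows "(\<lambda>x. L (f x)) differentiable (at x)"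
  using bounded_linear.has_derivative[OF assms(1) has_derivative_frechet[OF assms(2)]]
  by (rule differentiableI)

lemma differentiable_bounded_bilinear:
  assumes "bounded_bilinear B" "f differentiable (at x)" "g differentiable (at x)"
  shows "(\<lambda>x. B (f x) (g x)) differentiable (at x)"
  using bounded_bilinear.FDERIV[OF assms(1) has_derivative_frechet[OF assms(2)]
        has_derivative_frechet[OF assms(3)]]
  by (rule differentiableI)

lemma pderiv_at_add:
  assumes "f differentiable (at x)" "g differentiable (at x)"
  shows "pderiv_at i (\<lambda>x. f x + g x) x = pderiv_at i f x + pderiv_at i g x"
  using pderiv_at_eqI[OF has_derivative_add[OF has_derivative_frechet[OF assms(1)]
        has_derivative_frechet[OF assms(2)]]]
  by (simp add: pderiv_at_def)

lemma pderiv_at_mult: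
  fixes f :: "_ \<Rightarrow> real"
  assumes "f differentiable (at x)" "g differentiable (at x)"
  shows "pderiv_at i (\<lambda>x. f x * g x) x = f x * pderiv_at i g x + pderiv_at i f x * g x"
  by (rule pderiv_at_bounded_bilinear[OF bounded_bilinear_mult assms])

lemma pderiv_at_minus:
  assumes "f differentiable (at x)"
  shows "pderiv_at i (\<lambda>x. - f x) x = - pderiv_at i f x"
  by (rule pderiv_at_bounded_linear[OF bounded_linear_minus[OF bounded_linear_ident] assms])

lemma pderiv_at_diff:
  assumes "f differentiable (at x)" "g differentiable (at x)"
  shows "pderiv_at i (\<lambda>x. f x - g x) x = pderiv_at i f x - pderiv_at i g x"
  using pderiv_at_eqI[OF has_derivative_diff[OF has_derivative_frechet[OF assms(1)]
        has_derivative_frechet[OF assms(2)]]]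
  by (simp add: pderiv_at_def)

lemma pderiv_at_compose:
  assumes "G differentiable (at x)" "f differentiable (at (G x))"
  shows "pderiv_at i (\<lambda>x. f (G x)) x = frechet_derivative f (at (G x)) (pderiv_at i G x)"
  using pderiv_at_eqI[OF has_derivative_compose[OF has_derivative_frechet[OF assms(1)]
        has_derivative_frechet[OF assms(2)]]]
  by (simp add: pderiv_at_def)

subsection \<open>Closure properties\<close>

lemma Ck_on_imp_continuous: "Ck_on k U f \<Longrightarrow> continuous_on U f"
  by (cases k)
     (auto intro!: differentiable_imp_continuous_on differentiable_at_imp_differentiable_on)

lemma Ck_on_Suc_imp: "Ck_on (Suc k) U f \<Longrightarrow> Ck_on k U f"
proof (induction k arbitrary: f)
  case 0
  then show ?case using Ck_on_imp_continuous Ck_on.simps(1) by blast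
next
  case (Suc k)
  then show ?case by (metis Ck_on.simps(2))
qed

lemma Ck_on_cong:
  assumes "open U" "\<And>x. x \<in> U \<Longrightarrow> f x = g x" "Ck_on k U f"
  shows "Ck_on k U g"
  using assms(2,3)
proof (induction k arbitrary: f g)
  case 0
  then show ?case using continuous_on_cong by force
next
  case (Suc k)
  have "g differentiable (at x)" if "x \<in> U" for x
    using differentiable_cong[OF assms(1) that Suc.prems(1)] Suc.prems(2) that by auto
  moreover have "Ck_on k U (pderiv_at i g)" for i
  proof (rule Suc.IH)
    show "Ck_on k U (pderiv_at i f)" using Suc.prems by simp
    show "pderiv_at i f x = pderiv_at i g x" if "x \<in> U" for x
      using pderiv_at_cong[OF assms(1) that Suc.prems(1)] by simp
  qed
  ultimately show ?case by simp
qed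

lemma Ck_on_const: "Ck_on k (U::(real^'n::finite) set) (\<lambda>x. c)"
proof (induction k arbitrary: c)
  case (Suc k)
  have "Ck_on k U (pderiv_at i (\<lambda>x. c))" for i
    using Suc[of 0] by (simp add: pderiv_const_fun)
  then show ?case by simp
qed simp

lemma Ck_on_ident: "Ck_on k (U::(real^'n::finite) set) (\<lambda>x. x)"
proof (cases k)
  case (Suc k)
  have "pderiv_at i (\<lambda>x. x) = (\<lambda>x. axis i 1)" for i :: 'n by (rule ext) simp
  then show ?thesis using Suc by (simp add: Ck_on_const)
qed simp

lemma Ck_on_add:
  assumes "open U" "Ck_on k U f" "Ck_on k U g"
  shows "Ck_on k U (\<lambda>x. f x + g x)"
  using assms(2,3)
proof (induction k arbitrary: f g)
  case (Suc k)
  then show ?case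
    using Ck_on_cong[OF assms(1), of "\<lambda>x. pderiv_at i f x + pderiv_at i g x" for i]
    by (auto simp: pderiv_at_add)
qed (simp add: continuous_on_add)

lemma Ck_on_bounded_linear:
  assumes "open U" "bounded_linear L" "Ck_on k U f"
  shows "Ck_on k U (\<lambda>x. L (f x))"
  using assms(3)
proof (induction k arbitrary: f)
  case 0
  then show ?case using bounded_linear.continuous_on[OF assms(2)] by simp
next
  case (Suc k)
  then show ?case
    using Ck_on_cong[OF assms(1), of "\<lambda>x. L (pderiv_at i f x)" for i]
    by (auto simp: pderiv_at_bounded_linear[OF assms(2)]
        intro: differentiable_bounded_linear[OF assms(2)])
qed

lemma Ck_on_bounded_bilinear:
  assumes "open U" "bounded_bilinear B" "Ck_on k U f" "Ck_on k U g"
  shows "Ck_on k U (\<lambda>x. B (f x) (g x))"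
  using assms(3,4)
proof (induction k arbitrary: f g)
  case 0
  then show ?case using bounded_bilinear.continuous_on[OF assms(2)] by simp
next
  case (Suc k)
  have "Ck_on k U (\<lambda>x. B (f x) (pderiv_at i g x) + B (pderiv_at i f x) (g x))" for i
    using Suc by (intro Ck_on_add[OF assms(1)] Suc.IH) (auto intro: Ck_on_Suc_imp)
  then show ?case
    using Suc.prems Ck_on_cong[OF assms(1),
        of "\<lambda>x. B (f x) (pderiv_at i g x) + B (pderiv_at i f x) (g x)" for i]
    by (auto simp: pderiv_at_bounded_bilinear[OF assms(2)]
        intro: differentiable_bounded_bilinear[OF assms(2)])
qed

lemma Ck_on_sum:
  assumes "open U" "\<And>a. a \<in> A \<Longrightarrow> Ck_on k U (f a)"
  shows "Ck_on k U (\<lambda>x. \<Sum>a\<in>A. f a x)"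
  using assms(2)
  by (induction A rule: infinite_finite_induct)
     (auto simp: Ck_on_const intro: Ck_on_add[OF assms(1)])

text \<open>The chain rule gives a finite sum of products whose second factors are partial
  derivatives of \<open>f\<close> composed with \<open>G\<close>; hence the induction generalises
  over \<open>f\<close> and keeps \<open>G\<close> fixed.\<close>

lemma Ck_on_compose:
  assumes "open U" "Ck_on k U G" "Ck_on k V f" "G ` U \<subseteq> V"
  shows "Ck_on k U (\<lambda>x. f (G x))"
  using assms(2,3)
proof (induction k arbitrary: f)
  case 0
  then show ?case using continuous_on_compose2[of V f U G] assms(4) by auto
next
  case (Suc k)
  have diff: "G differentiable (at x)" "f differentiable (at (G x))" if "x \<in> U" for x
    using Suc.prems assms(4) that by auto
  have comp: "bounded_linear (\<lambda>v::real^'b. v $ j)" for j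
    by (rule bounded_linear_vec_nth)
  have "Ck_on k U (\<lambda>x. pderiv_at i G x $ j *\<^sub>R pderiv_at j f (G x))" for i j
    using Suc by (intro Ck_on_bounded_bilinear[OF assms(1) bounded_bilinear_scaleR] Suc.IH
        Ck_on_bounded_linear[OF assms(1) comp]) (auto intro: Ck_on_Suc_imp)
  then have "Ck_on k U (\<lambda>x. \<Sum>j\<in>UNIV. pderiv_at i G x $ j *\<^sub>R pderiv_at j f (G x))" for i
    by (intro Ck_on_sum[OF assms(1)])
  then have "Ck_on k U (pderiv_at i (\<lambda>x. f (G x)))" for i
    by (rule Ck_on_cong[OF assms(1), rotated])
      (simp add: pderiv_at_compose diff frechet_derivative_pderiv)
  moreover have "(\<lambda>x. f (G x)) differentiable (at x)" if "x \<in> U" for x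
    using has_derivative_compose[OF has_derivative_frechet[OF diff(1)[OF that]]
        has_derivative_frechet[OF diff(2)[OF that]]] by (rule differentiableI)
  ultimately show ?case by simp
qed

text \<open>The derivative is a polynomial in the derivative of \<open>f\<close> and the inverse
  itself, so the induction hypothesis for the same function, one order lower, closes the
  argument.\<close>

lemma Ck_on_inverse:
  fixes f :: "real^'n::finite \<Rightarrow> real"
  assumes "open U" "\<And>x. x \<in> U \<Longrightarrow> f x \<noteq> 0" "Ck_on k U f"
  shows "Ck_on k U (\<lambda>x. inverse (f x))"
  using assms(3)
proof (induction k)
  case 0
  then show ?case using assms(2) by (auto intro: continuous_on_inverse)
next
  case (Suc k)
  have d: "((\<lambda>x. inverse (f x)) has_derivative
      (\<lambda>h. - (inverse (f x) * frechet_derivative f (at x) h * inverse (f x)))) (at x)"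
    if "x \<in> U" for x
    using Suc.prems that assms(2) by (intro Deriv.has_derivative_inverse has_derivative_frechet) auto
  have *: "Ck_on k U (\<lambda>x. - (inverse (f x) * pderiv_at i f x * inverse (f x)))" for i
    using Suc by (intro Ck_on_bounded_linear[OF assms(1) bounded_linear_minus[OF bounded_linear_ident]]
        Ck_on_bounded_bilinear[OF assms(1) bounded_bilinear_mult] Suc.IH Ck_on_Suc_imp[OF Suc.prems]) auto
  have "Ck_on k U (pderiv_at i (\<lambda>x. inverse (f x)))" for i
    by (rule Ck_on_cong[OF assms(1) _ *[of i]])
      (use pderiv_at_eqI[OF d] in \<open>simp add: pderiv_at_def\<close>)
  then show ?case using d by (auto intro: differentiableI)
qed

lemma Ck_on_sqrt:
  fixes f :: "real^'n::finite \<Rightarrow> real"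
  assumes "open U" "\<And>x. x \<in> U \<Longrightarrow> f x > 0" "Ck_on k U f"
  shows "Ck_on k U (\<lambda>x. sqrt (f x))"
  using assms(3)
proof (induction k)
  case 0
  then show ?case by (auto intro: continuous_on_real_sqrt)
next
  case (Suc k)
  have d: "((\<lambda>x. sqrt (f x)) has_derivative
      (\<lambda>h. frechet_derivative f (at x) h * (inverse (sqrt (f x)) / 2))) (at x)"
    if "x \<in> U" for x
    using has_derivative_real_sqrt[where g=f and x=x and s=UNIV, OF assms(2)[OF that]] Suc.prems that
    by (simp add: has_derivative_frechet)
  have *: "Ck_on k U (\<lambda>x. pderiv_at i f x * (inverse (sqrt (f x)) / 2))" for i
    using Suc.prems
    by (intro Ck_on_bounded_bilinear[OF assms(1) bounded_bilinear_mult]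
        Ck_on_bounded_linear[OF assms(1) bounded_linear_divide] Ck_on_inverse[OF assms(1)]
        Suc.IH Ck_on_Suc_imp[OF Suc.prems]) (auto dest: assms(2))
  have "Ck_on k U (pderiv_at i (\<lambda>x. sqrt (f x)))" for i
    by (rule Ck_on_cong[OF assms(1) _ *[of i]])
      (use pderiv_at_eqI[OF d] in \<open>simp add: pderiv_at_def\<close>)
  then show ?case using d by (auto intro: differentiableI)
qed

lemma smooth_on_differentiable: "smooth_on U f \<Longrightarrow> x \<in> U \<Longrightarrow> f differentiable (at x)"
  using Ck_on.simps(2) smooth_on_def by blast

lemma smooth_on_continuous: "smooth_on U f \<Longrightarrow> continuous_on U f"
  using Ck_on_imp_continuous smooth_on_def by blast

lemma Ck_on_subset: "V \<subseteq> U \<Longrightarrow> Ck_on k U f \<Longrightarrow> Ck_on k V f"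
  by (induction k arbitrary: f) (auto intro: continuous_on_subset)

lemma smooth_on_subset: "smooth_on U f \<Longrightarrow> V \<subseteq> U \<Longrightarrow> smooth_on V f"
  unfolding smooth_on_def using Ck_on_subset by blast

lemma smooth_on_cong:
  assumes "open U" "\<And>x. x \<in> U \<Longrightarrow> f x = g x" "smooth_on U f"
  shows "smooth_on U g"
  using assms Ck_on_cong unfolding smooth_on_def by metis

lemma smooth_on_pderiv: "smooth_on U f \<Longrightarrow> smooth_on U (pderiv_at i f)"
  unfolding smooth_on_def using Ck_on.simps(2) by blast

lemma smooth_on_const: "smooth_on U (\<lambda>x. c)"
  by (simp add: smooth_on_def Ck_on_const)

lemma smooth_on_ident: "smooth_on U (\<lambda>x. x)"
  by (simp add: smooth_on_def Ck_on_ident)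

lemma smooth_on_bounded_linear:
  "open U \<Longrightarrow> bounded_linear L \<Longrightarrow> smooth_on U f \<Longrightarrow> smooth_on U (\<lambda>x. L (f x))"
  by (simp add: smooth_on_def Ck_on_bounded_linear)

lemma smooth_on_bounded_bilinear:
  "open U \<Longrightarrow> bounded_bilinear B \<Longrightarrow> smooth_on U f \<Longrightarrow> smooth_on U g \<Longrightarrow>
   smooth_on U (\<lambda>x. B (f x) (g x))"
  by (simp add: smooth_on_def Ck_on_bounded_bilinear)

lemma smooth_on_add: "open U \<Longrightarrow> smooth_on U f \<Longrightarrow> smooth_on U g \<Longrightarrow> smooth_on U (\<lambda>x. f x + g x)"
  by (simp add: smooth_on_def Ck_on_add)

lemma smooth_on_sum:
  "open U \<Longrightarrow> (\<And>a. a \<in> A \<Longrightarrow> smooth_on U (f a)) \<Longrightarrow> smooth_on U (\<lambda>x. \<Sum>a\<in>A. f a x)"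
  by (simp add: smooth_on_def Ck_on_sum)

lemma smooth_on_minus: "open U \<Longrightarrow> smooth_on U f \<Longrightarrow> smooth_on U (\<lambda>x. - f x)"
  by (rule smooth_on_bounded_linear[OF _ bounded_linear_minus[OF bounded_linear_ident]])

lemma smooth_on_diff: "open U \<Longrightarrow> smooth_on U f \<Longrightarrow> smooth_on U g \<Longrightarrow> smooth_on U (\<lambda>x. f x - g x)"
  using smooth_on_add[of U f "\<lambda>x. - g x"] smooth_on_minus[of U g] by simp

lemma smooth_on_mult:
  fixes f :: "_ \<Rightarrow> real"
  shows "open U \<Longrightarrow> smooth_on U f \<Longrightarrow> smooth_on U g \<Longrightarrow> smooth_on U (\<lambda>x. f x * g x)"
  by (rule smooth_on_bounded_bilinear[OF _ bounded_bilinear_mult])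

lemma smooth_on_scaleR:
  "open U \<Longrightarrow> smooth_on U f \<Longrightarrow> smooth_on U g \<Longrightarrow> smooth_on U (\<lambda>x. f x *\<^sub>R g x)"
  by (rule smooth_on_bounded_bilinear[OF _ bounded_bilinear_scaleR])

lemma smooth_on_divide:
  fixes f :: "_ \<Rightarrow> real"
  shows "open U \<Longrightarrow> (\<And>x. x \<in> U \<Longrightarrow> g x \<noteq> 0) \<Longrightarrow> smooth_on U f \<Longrightarrow> smooth_on U g \<Longrightarrow>
    smooth_on U (\<lambda>x. f x / g x)"
  unfolding divide_inverse
  by (rule smooth_on_mult) (auto simp: smooth_on_def Ck_on_inverse)

lemma smooth_on_sqrt:
  "open U \<Longrightarrow> (\<And>x. x \<in> U \<Longrightarrow> f x > 0) \<Longrightarrow> smooth_on U f \<Longrightarrow> smooth_on U (\<lambda>x. sqrt (f x))"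
  by (simp add: smooth_on_def Ck_on_sqrt)

lemma smooth_on_power:
  fixes f :: "_ \<Rightarrow> real"
  shows "open U \<Longrightarrow> smooth_on U f \<Longrightarrow> smooth_on U (\<lambda>x. f x ^ n)"
  by (induction n) (auto intro: smooth_on_mult smooth_on_const)

lemma smooth_on_prod:
  fixes f :: "_ \<Rightarrow> _ \<Rightarrow> real"
  shows "open U \<Longrightarrow> (\<And>a. a \<in> A \<Longrightarrow> smooth_on U (f a)) \<Longrightarrow> smooth_on U (\<lambda>x. \<Prod>a\<in>A. f a x)"
  by (induction A rule: infinite_finite_induct) (auto intro: smooth_on_mult smooth_on_const)

lemma smooth_on_nth: "open U \<Longrightarrow> smooth_on U f \<Longrightarrow> smooth_on U (\<lambda>x. f x $ k)"
  by (rule smooth_on_bounded_linear[OF _ bounded_linear_vec_nth])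

lemma smooth_on_vec:
  fixes f :: "'k::finite \<Rightarrow> real^'n::finite \<Rightarrow> 'b::real_normed_vector"
  assumes "open U" "\<And>k. smooth_on U (f k)"
  shows "smooth_on U (\<lambda>x. \<chi> k. f k x)"
proof -
  have bl: "bounded_linear (\<lambda>y::'b. axis k y)" for k :: 'k
  proof (rule bounded_linear_intro[where K=1])
    show "norm (axis k x) \<le> norm x * 1" for x :: 'b
      by (simp add: norm_vec_def L2_set_def axis_def if_distrib[of norm] if_distrib[of "\<lambda>x. x\<^sup>2"]
          cong: if_cong)
  qed (auto simp: vec_eq_iff axis_def)
  have "(\<chi> k. f k x) = (\<Sum>k\<in>UNIV. axis k (f k x))" for x
    by (simp add: vec_eq_iff axis_def)
  then show ?thesis
    using assms by (simp add: smooth_on_sum smooth_on_bounded_linear[OF _ bl])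
qed

lemma smooth_on_compose:
  "open U \<Longrightarrow> smooth_on U G \<Longrightarrow> smooth_on V f \<Longrightarrow> G ` U \<subseteq> V \<Longrightarrow> smooth_on U (\<lambda>x. f (G x))"
  by (auto simp: smooth_on_def intro: Ck_on_compose)

lemma smooth_on_inner:
  "open U \<Longrightarrow> smooth_on U f \<Longrightarrow> smooth_on U g \<Longrightarrow> smooth_on U (\<lambda>x. f x \<bullet> g x)"
  by (rule smooth_on_bounded_bilinear[OF _ bounded_bilinear_inner])

lemma smooth_on_matrix_vector_mult:
  fixes f :: "real^'n::finite \<Rightarrow> real^'k::finite^'l::finite"
  assumes "open U" "smooth_on U f" "smooth_on U g"
  shows "smooth_on U (\<lambda>x. f x *v g x)"
  unfolding matrix_vector_mult_def
  by (intro smooth_on_vec smooth_on_sum smooth_on_mult smooth_on_nth assms)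

lemma smooth_on_det:
  fixes f :: "real^'n::finite \<Rightarrow> real^'k::finite^'k"
  assumes "open U" "smooth_on U f"
  shows "smooth_on U (\<lambda>x. det (f x))"
  unfolding det_def
  by (intro smooth_on_sum smooth_on_mult smooth_on_prod smooth_on_const smooth_on_nth assms)

lemmas smooth_intros =
  smooth_on_const smooth_on_ident smooth_on_add smooth_on_diff smooth_on_minus smooth_on_mult
  smooth_on_scaleR smooth_on_sum smooth_on_nth smooth_on_vec smooth_on_inner
  smooth_on_matrix_vector_mult smooth_on_det smooth_on_power smooth_on_pderiv

lemma smooth_on_ip:
  assumes "open U" "smooth_on U A" "smooth_on U X" "smooth_on U Y"
  shows "smooth_on U (\<lambda>x. ip (A x) (X x) (Y x))"
  unfolding ip_def by (intro smooth_intros assms)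

lemma smooth_on_cross3:
  assumes "open U" "smooth_on U X" "smooth_on U Y"
  shows "smooth_on U (\<lambda>x. cross3 (X x) (Y x))"
proof -
  have "smooth_on U (\<lambda>x. cross3 (X x) (Y x) $ k)" for k
    using exhaust_3[of k]
    by (elim disjE) (simp_all add: cross3_def, (intro smooth_intros assms)+)
  then have "smooth_on U (\<lambda>x. \<chi> k. cross3 (X x) (Y x) $ k)"
    by (intro smooth_on_vec assms)
  then show ?thesis by simp
qed

section \<open>Matrix inverses\<close>

lemma matrix_inv_mult:
  fixes A :: "real^'n::finite^'n"
  assumes "det A \<noteq> 0"
  shows "A ** matrix_inv A = mat 1" "matrix_inv A ** A = mat 1"
proof -
  have "invertible A" using assms by (simp add: invertible_det_nz)
  then have "\<exists>B. A ** B = mat 1 \<and> B ** A = mat 1" by (simp add: invertible_def)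
  then have "A ** matrix_inv A = mat 1 \<and> matrix_inv A ** A = mat 1"
    unfolding matrix_inv_def by (rule someI_ex)
  then show "A ** matrix_inv A = mat 1" "matrix_inv A ** A = mat 1" by auto
qed

lemma matrix_inv_vector_mult:
  fixes A :: "real^'n::finite^'n"
  assumes "det A \<noteq> 0"
  shows "A *v (matrix_inv A *v x) = x" "matrix_inv A *v (A *v x) = x"
  using matrix_inv_mult[OF assms] by (simp_all add: matrix_vector_mul_assoc)

lemma matrix_inv_unique:
  fixes A :: "real^'n::finite^'n"
  assumes "A ** B = mat 1"
  shows "matrix_inv A = B"
proof -
  have "det A * det B = 1" using assms by (metis det_I det_mul)
  then have "matrix_inv A ** A = mat 1" by (intro matrix_inv_mult) auto
  then show ?thesis by (metis assms matrix_mul_assoc matrix_mul_lid matrix_mul_rid)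
qed

lemma matrix_inv_vector_eqI:
  fixes A :: "real^'n::finite^'n"
  assumes "det A \<noteq> 0" "A *v X = Y"
  shows "matrix_inv A *v Y = X"
  using matrix_inv_vector_mult(2)[OF assms(1), of X] assms(2) by simp

text \<open>Cramer's rule makes the entries quotients of determinants in the entries of
  \<open>A\<close>; the definition of \<open>matrix_inv\<close> by choice shows no
  smoothness.\<close>

lemma smooth_on_matrix_inv:
  fixes A :: "real^'m::finite \<Rightarrow> real^'n::finite^'n"
  assumes "open U" "smooth_on U A" "\<And>x. x \<in> U \<Longrightarrow> det (A x) \<noteq> 0"
  shows "smooth_on U (\<lambda>x. matrix_inv (A x))"
proof -
  have inv: "matrix_inv (A x) $ k $ l =
      det (\<chi> i j. if j = k then axis l 1 $ i else A x $ i $ j) / det (A x)" if "x \<in> U" for x k l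
  proof -
    have "matrix_inv (A x) *v axis l 1 =
        (\<chi> k. det (\<chi> i j. if j = k then axis l 1 $ i else A x $ i $ j) / det (A x))"
      using cramer[OF assms(3)[OF that]] matrix_inv_vector_mult(1)[OF assms(3)[OF that]] by blast
    moreover have "matrix_inv (A x) $ k $ l = (matrix_inv (A x) *v axis l 1) $ k"
      by (simp add: matrix_vector_mul_component inner_axis)
    ultimately show ?thesis by simp
  qed
  have "smooth_on U (\<lambda>x. if j = k then axis l 1 $ i else A x $ i $ j)" for i j k l :: 'n
    by (cases "j = k") (auto intro!: smooth_intros assms)
  then have "smooth_on U (\<lambda>x. \<chi> k l. det (\<chi> i j. if j = k then axis l 1 $ i else A x $ i $ j) / det (A x))"
    by (intro smooth_on_divide smooth_intros assms)
  then show ?thesis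
    by (rule smooth_on_cong[OF assms(1), rotated]) (simp add: inv vec_eq_iff)
qed

subsection \<open>Symmetry of second derivatives\<close>

lemma pderiv_line:
  fixes f :: "real^'n::finite \<Rightarrow> real"
  assumes "f differentiable (at (x + t *\<^sub>R axis i 1))"
  shows "((\<lambda>t. f (x + t *\<^sub>R axis i 1)) has_real_derivative pderiv_at i f (x + t *\<^sub>R axis i 1)) (at t)"
proof -
  have "((\<lambda>t. x + t *\<^sub>R axis i 1) has_derivative (\<lambda>h. h *\<^sub>R axis i 1)) (at t)"
    by (auto intro!: derivative_eq_intros)
  from has_derivative_compose[OF this has_derivative_frechet[OF assms]]
  have "((\<lambda>t. f (x + t *\<^sub>R axis i 1)) has_derivative
      (\<lambda>h. frechet_derivative f (at (x + t *\<^sub>R axis i 1)) (h *\<^sub>R axis i 1))) (at t)" .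
  moreover have "frechet_derivative f (at (x + t *\<^sub>R axis i 1)) (h *\<^sub>R axis i 1) =
      pderiv_at i f (x + t *\<^sub>R axis i 1) * h" for h
    using linear_scale[OF linear_frechet_derivative[OF assms], of h "axis i 1"]
    by (simp add: pderiv_at_def)
  ultimately show ?thesis
    unfolding has_field_derivative_def by (simp add: ext)
qed

text \<open>The mean value theorem is applied twice: to the increment \<open>\<phi>\<close> of
  \<open>f\<close> in direction \<open>j\<close>, as a function of the displacement in direction
  \<open>i\<close>, and then to \<open>pderiv_at i f\<close> along direction \<open>j\<close>. The
  bound \<open>2 * h < d\<close> keeps the parallelogram in the ball.\<close>

lemma second_difference_mvt:
  fixes f :: "real^'n::finite \<Rightarrow> real"
  assumes "smooth_on U f" "ball x d \<subseteq> U" "0 < h" "2 * h < d"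
  obtains y where "y \<in> ball x d"
    "f (x + h *\<^sub>R axis i 1 + h *\<^sub>R axis j 1) - f (x + h *\<^sub>R axis i 1) - f (x + h *\<^sub>R axis j 1) + f x
      = h * h * pderiv_at j (pderiv_at i f) y"
proof -
  have in_ball: "x + s *\<^sub>R axis i 1 + t *\<^sub>R axis j 1 \<in> ball x d" if "0 \<le> s" "s \<le> h" "0 \<le> t" "t \<le> h" for s t
  proof -
    have "norm (s *\<^sub>R axis i (1::real) + t *\<^sub>R axis j 1) \<le> s + t"
      using norm_triangle_ineq[of "s *\<^sub>R axis i (1::real)" "t *\<^sub>R axis j 1"] that by simp
    then show ?thesis using that assms(4)
      by (simp add: dist_norm add.assoc norm_minus_commute) (simp add: add.commute)
  qed
  define \<phi> where "\<phi> s = f ((x + h *\<^sub>R axis j 1) + s *\<^sub>R axis i 1) - f (x + s *\<^sub>R axis i 1)" for s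
  have "(\<phi> has_real_derivative pderiv_at i f ((x + h *\<^sub>R axis j 1) + s *\<^sub>R axis i 1)
        - pderiv_at i f (x + s *\<^sub>R axis i 1)) (at s)" if "0 \<le> s" "s \<le> h" for s
    unfolding \<phi>_def
    using in_ball[OF that, of 0] in_ball[OF that, of h] assms(2,3)
    by (intro derivative_intros pderiv_line smooth_on_differentiable[OF assms(1)])
      (auto simp: add_ac)
  from MVT2[OF assms(3) this] obtain s where s: "0 < s" "s < h" "\<phi> h - \<phi> 0 = h *
      (pderiv_at i f ((x + h *\<^sub>R axis j 1) + s *\<^sub>R axis i 1) - pderiv_at i f (x + s *\<^sub>R axis i 1))"
    by auto
  have "((\<lambda>t. pderiv_at i f ((x + s *\<^sub>R axis i 1) + t *\<^sub>R axis j 1)) has_real_derivative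
      pderiv_at j (pderiv_at i f) ((x + s *\<^sub>R axis i 1) + t *\<^sub>R axis j 1)) (at t)"
    if "0 \<le> t" "t \<le> h" for t
    using in_ball[of s t] s that assms(2)
    by (intro pderiv_line smooth_on_differentiable[OF smooth_on_pderiv[OF assms(1)]]) auto
  from MVT2[OF assms(3) this] obtain t where t: "0 < t" "t < h"
    "pderiv_at i f ((x + s *\<^sub>R axis i 1) + h *\<^sub>R axis j 1) - pderiv_at i f (x + s *\<^sub>R axis i 1) =
      h * pderiv_at j (pderiv_at i f) ((x + s *\<^sub>R axis i 1) + t *\<^sub>R axis j 1)"
    by auto
  show ?thesis
  proof (rule that)
    show "(x + s *\<^sub>R axis i 1) + t *\<^sub>R axis j 1 \<in> ball x d" using in_ball s t by simp
    have "f (x + h *\<^sub>R axis i 1 + h *\<^sub>R axis j 1) - f (x + h *\<^sub>R axis i 1) - f (x + h *\<^sub>R axis j 1) + f x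
        = \<phi> h - \<phi> 0" by (simp add: \<phi>_def add_ac)
    also have "\<dots> = h * (h * pderiv_at j (pderiv_at i f) ((x + s *\<^sub>R axis i 1) + t *\<^sub>R axis j 1))"
      using s(3) t(3) by (simp add: add_ac)
    finally show "f (x + h *\<^sub>R axis i 1 + h *\<^sub>R axis j 1) - f (x + h *\<^sub>R axis i 1) - f (x + h *\<^sub>R axis j 1) + f x
        = h * h * pderiv_at j (pderiv_at i f) ((x + s *\<^sub>R axis i 1) + t *\<^sub>R axis j 1)" by simp
  qed
qed

text \<open>Schwarz's theorem. The second difference is symmetric in the two directions, so both
  orders of differentiation agree at suitable points near \<open>x\<close>, and by continuity at
  \<open>x\<close>.\<close>

lemma pderiv_commute_real:
  fixes f :: "real^'n::finite \<Rightarrow> real"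
  assumes "smooth_on U f" "open U" "x \<in> U"
  shows "pderiv_at i (pderiv_at j f) x = pderiv_at j (pderiv_at i f) x"
proof (rule ccontr)
  assume ne: "\<not> ?thesis"
  \<comment> \<open>Half the supposed gap: two values within this distance of their limits cannot
    coincide.\<close>
  define \<epsilon> where "\<epsilon> = \<bar>pderiv_at i (pderiv_at j f) x - pderiv_at j (pderiv_at i f) x\<bar> / 2"
  have \<epsilon>: "\<epsilon> > 0" using ne by (simp add: \<epsilon>_def)
  have ev: "\<exists>d>0. \<forall>y\<in>ball x d. \<bar>pderiv_at i (pderiv_at j f) y - pderiv_at i (pderiv_at j f) x\<bar> < \<epsilon>"
    for i j
  proof -
    have "isCont (pderiv_at i (pderiv_at j f)) x"
      using smooth_on_continuous[OF smooth_on_pderiv[OF smooth_on_pderiv[OF assms(1)]]] assms(2,3)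
      by (simp add: continuous_on_eq_continuous_at)
    then show ?thesis using \<epsilon>
      by (fastforce simp: continuous_at_eps_delta dist_real_def dist_commute)
  qed
  obtain d1 where d1: "d1 > 0"
      "\<forall>y\<in>ball x d1. \<bar>pderiv_at i (pderiv_at j f) y - pderiv_at i (pderiv_at j f) x\<bar> < \<epsilon>"
    using ev by blast
  obtain d2 where d2: "d2 > 0"
      "\<forall>y\<in>ball x d2. \<bar>pderiv_at j (pderiv_at i f) y - pderiv_at j (pderiv_at i f) x\<bar> < \<epsilon>"
    using ev by blast
  obtain d3 where d3: "d3 > 0" "ball x d3 \<subseteq> U" using assms(2,3) open_contains_ball by blast
  define d where "d = Min {d1, d2, d3}"
  have d: "d > 0" "d \<le> d1" "d \<le> d2" "d \<le> d3" using d1 d2 d3 by (auto simp: d_def)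
  have sub: "ball x d \<subseteq> U" using d3 d by (meson subset_ball order_trans)
  have h: "0 < d / 3" "2 * (d / 3) < d" using d by auto
  obtain y where y: "y \<in> ball x d" "f (x + (d/3) *\<^sub>R axis i 1 + (d/3) *\<^sub>R axis j 1)
      - f (x + (d/3) *\<^sub>R axis i 1) - f (x + (d/3) *\<^sub>R axis j 1) + f x
      = (d/3) * (d/3) * pderiv_at j (pderiv_at i f) y"
    using second_difference_mvt[OF assms(1) sub h] by metis
  obtain z where z: "z \<in> ball x d" "f (x + (d/3) *\<^sub>R axis j 1 + (d/3) *\<^sub>R axis i 1)
      - f (x + (d/3) *\<^sub>R axis j 1) - f (x + (d/3) *\<^sub>R axis i 1) + f x
      = (d/3) * (d/3) * pderiv_at i (pderiv_at j f) z"
    using second_difference_mvt[OF assms(1) sub h] by metis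
  have comm: "x + (d/3) *\<^sub>R axis j 1 + (d/3) *\<^sub>R axis i 1 = x + (d/3) *\<^sub>R axis i 1 + (d/3) *\<^sub>R axis j 1"
    by simp
  have "(d/3) * (d/3) * pderiv_at j (pderiv_at i f) y = (d/3) * (d/3) * pderiv_at i (pderiv_at j f) z"
    using y(2) z(2)[unfolded comm] by linarith
  then have "pderiv_at j (pderiv_at i f) y = pderiv_at i (pderiv_at j f) z" using d(1) by simp
  moreover have "\<bar>pderiv_at i (pderiv_at j f) z - pderiv_at i (pderiv_at j f) x\<bar> < \<epsilon>"
    using d1(2) z(1) d by auto
  moreover have "\<bar>pderiv_at j (pderiv_at i f) y - pderiv_at j (pderiv_at i f) x\<bar> < \<epsilon>"
    using d2(2) y(1) d by auto
  ultimately show False unfolding \<epsilon>_def by (simp add: abs_if split: if_splits)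
qed

lemma pderiv_at_nth:
  "f differentiable (at x) \<Longrightarrow> pderiv_at i (\<lambda>x. f x $ k) x = pderiv_at i f x $ k"
  by (rule pderiv_at_bounded_linear[OF bounded_linear_vec_nth])

lemma pderiv_commute:
  fixes f :: "real^'n::finite \<Rightarrow> real^'k::finite"
  assumes "smooth_on U f" "open U" "x \<in> U"
  shows "pderiv_at i (pderiv_at j f) x = pderiv_at j (pderiv_at i f) x"
proof (rule vec_eq_iff[THEN iffD2, rule_format])
  fix k
  have *: "pderiv_at i (pderiv_at j f) x $ k = pderiv_at i (pderiv_at j (\<lambda>x. f x $ k)) x" for i j
  proof -
    have "pderiv_at i (pderiv_at j f) x $ k = pderiv_at i (\<lambda>y. pderiv_at j f y $ k) x"
      using smooth_on_differentiable[OF smooth_on_pderiv[OF assms(1)] assms(3)]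
      by (simp add: pderiv_at_nth)
    also have "\<dots> = pderiv_at i (pderiv_at j (\<lambda>x. f x $ k)) x"
      using smooth_on_differentiable[OF assms(1)]
      by (intro pderiv_at_cong[OF assms(2,3)]) (simp add: pderiv_at_nth)
    finally show ?thesis .
  qed
  show "pderiv_at i (pderiv_at j f) x $ k = pderiv_at j (pderiv_at i f) x $ k"
    using pderiv_commute_real[OF smooth_on_nth[OF assms(2,1)] assms(2,3)] by (simp add: *)
qed

section \<open>The Levi-Civita connection along a map\<close>

lemma bounded_bilinear_matrix_vector_mult:
  "bounded_bilinear ((*v) :: real^'n::finite^'m::finite \<Rightarrow> real^'n \<Rightarrow> real^'m)"
proof -
  have "bilinear ((*v) :: real^'n^'m \<Rightarrow> real^'n \<Rightarrow> real^'m)"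
    unfolding bilinear_def
    by (auto intro!: linearI simp: matrix_vector_right_distrib matrix_vector_mult_add_rdistrib
        vec.scale scaleR_matrix_vector_assoc matrix_vector_mult_scaleR)
  then show ?thesis by (simp add: bilinear_conv_bounded_bilinear)
qed

section \<open>The bilinear form of a Gram matrix\<close>

lemma ip_add_left: "ip A (X + Y) Z = ip A X Z + ip A Y Z"
  by (simp add: ip_def inner_add_left)

lemma ip_add_right: "ip A X (Y + Z) = ip A X Y + ip A X Z"
  by (simp add: ip_def inner_add_right matrix_vector_right_distrib)

lemma ip_scale_left: "ip A (c *\<^sub>R X) Y = c * ip A X Y"
  by (simp add: ip_def)

lemma ip_scale_right: "ip A X (c *\<^sub>R Y) = c * ip A X Y"
  by (simp add: ip_def matrix_vector_mult_scaleR)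

lemma ip_minus_left: "ip A (- X) Y = - ip A X Y"
  by (simp add: ip_def)

lemma ip_minus_right: "ip A X (- Y) = - ip A X Y"
  using ip_scale_right[of A X "-1" Y] by simp

lemma ip_diff_left: "ip A (X - Y) Z = ip A X Z - ip A Y Z"
  by (simp add: ip_def inner_diff_left)

lemma ip_diff_right: "ip A X (Y - Z) = ip A X Y - ip A X Z"
  using ip_add_right[of A X Y "- Z"] by (simp add: ip_minus_right)

lemma ip_zero [simp]: "ip A 0 Y = 0" "ip A X 0 = 0"
  by (simp_all add: ip_def)

lemmas ip_linear = ip_add_left ip_add_right ip_scale_left ip_scale_right ip_minus_left
  ip_minus_right ip_diff_left ip_diff_right

lemma ip_sym: "transpose A = A \<Longrightarrow> ip A X Y = ip A Y X"
  unfolding ip_def by (metis dot_lmul_matrix inner_commute transpose_matrix_vector)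

lemma ip_axis_sum: "ip A X Y = (\<Sum>i\<in>UNIV. X $ i * (\<Sum>j\<in>UNIV. A $ i $ j * Y $ j))"
  by (simp add: ip_def inner_vec_def matrix_vector_mult_def)

lemma ip_axis: "ip A (axis i 1) (axis j 1) = A $ i $ j"
proof -
  have "A *v axis j 1 = (\<chi> k. A $ k $ j)"
    by (simp add: vec_eq_iff matrix_vector_mult_def axis_def if_distrib cong: if_cong)
  then show ?thesis by (simp add: ip_def inner_axis')
qed

lemma posdef_det_nz:
  assumes "\<And>X. X \<noteq> 0 \<Longrightarrow> ip A X X > 0"
  shows "det A \<noteq> 0"
proof -
  have "X = 0" if "A *v X = 0" for X
    using assms[of X] that by (auto simp: ip_def)
  then have "invertible A"
    using invertible_left_inverse matrix_left_invertible_ker by blast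
  then show ?thesis by (simp add: invertible_det_nz)
qed

section \<open>Christoffel symbols and the connection along a map\<close>

definition Gam :: "(real^'n \<Rightarrow> real^'n^'n) \<Rightarrow> real^'n::finite \<Rightarrow> real^'n \<Rightarrow> real^'n \<Rightarrow> real^'n" where
  "Gam g x X Y = (\<chi> k. \<Sum>i\<in>UNIV. \<Sum>j\<in>UNIV. christoffel g x k i j * X $ i * Y $ j)"

text \<open>Christoffel symbol of the first kind: the upper index is lowered to \<open>l\<close>,
  which removes the inverse metric.\<close>

definition christoffel1 :: "(real^'n \<Rightarrow> real^'n^'n) \<Rightarrow> real^'n \<Rightarrow> 'n::finite \<Rightarrow> 'n \<Rightarrow> 'n \<Rightarrow> real" where
  "christoffel1 g x i j l =
    1/2 * (pderiv_at i g x $ j $ l + pderiv_at j g x $ i $ l - pderiv_at l g x $ i $ j)"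

definition covd ::
  "(real^'n \<Rightarrow> real^'n^'n) \<Rightarrow> (real^'m::finite \<Rightarrow> real^'n::finite) \<Rightarrow> 'm \<Rightarrow> (real^'m \<Rightarrow> real^'n) \<Rightarrow> real^'m \<Rightarrow> real^'n" where
  "covd g F i W u = cov_along g F W u (axis i 1)"

lemma covd_eq: "covd g F i W u = pderiv_at i W u + Gam g (F u) (pderiv_at i F u) (W u)"
  by (simp add: covd_def cov_along_def pderiv_at_def Gam_def)

lemma Gam_alt:
  "Gam g x X Y = matrix_inv (g x) *v
     (\<chi> l. \<Sum>i\<in>UNIV. \<Sum>j\<in>UNIV. christoffel1 g x i j l * X $ i * Y $ j)"
proof -
  have "Gam g x X Y $ k = (matrix_inv (g x) *v
     (\<chi> l. \<Sum>i\<in>UNIV. \<Sum>j\<in>UNIV. christoffel1 g x i j l * X $ i * Y $ j)) $ k" for k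
  proof -
    have "Gam g x X Y $ k = (\<Sum>i\<in>UNIV. \<Sum>j\<in>UNIV. \<Sum>l\<in>UNIV.
        matrix_inv (g x) $ k $ l * (christoffel1 g x i j l * X $ i * Y $ j))"
      by (simp add: Gam_def christoffel_def christoffel1_def sum_distrib_left sum_distrib_right mult_ac)
    also have "\<dots> = (\<Sum>i\<in>UNIV. \<Sum>l\<in>UNIV. \<Sum>j\<in>UNIV.
        matrix_inv (g x) $ k $ l * (christoffel1 g x i j l * X $ i * Y $ j))"
      by (rule sum.cong[OF refl], rule sum.swap)
    also have "\<dots> = (\<Sum>l\<in>UNIV. \<Sum>i\<in>UNIV. \<Sum>j\<in>UNIV.
        matrix_inv (g x) $ k $ l * (christoffel1 g x i j l * X $ i * Y $ j))"
      by (rule sum.swap)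
    finally show ?thesis
      by (simp add: matrix_vector_mult_def sum_distrib_left)
  qed
  then show ?thesis by (simp add: vec_eq_iff)
qed

lemma Gam_add_left: "Gam g x (X + Y) Z = Gam g x X Z + Gam g x Y Z"
  by (simp add: Gam_def vec_eq_iff ring_distribs sum.distrib)

lemma Gam_scale_left: "Gam g x (c *\<^sub>R X) Z = c *\<^sub>R Gam g x X Z"
  by (simp add: Gam_def vec_eq_iff sum_distrib_left mult_ac)

lemma Gam_add_right: "Gam g x X (Y + Z) = Gam g x X Y + Gam g x X Z"
  by (simp add: Gam_def vec_eq_iff ring_distribs sum.distrib)

lemma Gam_scale_right: "Gam g x X (c *\<^sub>R Z) = c *\<^sub>R Gam g x X Z"
  by (simp add: Gam_def vec_eq_iff sum_distrib_left mult_ac)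

lemma cov_along_covd:
  assumes "F differentiable (at u)" "W differentiable (at u)"
  shows "cov_along g F W u X = (\<Sum>i\<in>UNIV. X $ i *\<^sub>R covd g F i W u)"
proof -
  have lF: "linear (frechet_derivative F (at u))" and lW: "linear (frechet_derivative W (at u))"
    by (rule linear_frechet_derivative[OF assms(1)] linear_frechet_derivative[OF assms(2)])+
  have eq: "cov_along g F W u = (\<lambda>X. frechet_derivative W (at u) X +
      Gam g (F u) (frechet_derivative F (at u) X) (W u))"
    by (simp add: fun_eq_iff cov_along_def Gam_def)
  have "linear (cov_along g F W u)"
    unfolding eq
    by (rule linearI) (simp_all add: linear_add[OF lF] linear_add[OF lW] linear_scale[OF lF]
        linear_scale[OF lW] Gam_add_left Gam_scale_left scaleR_add_right)
  then show ?thesis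
    unfolding covd_def by (rule linear_axis_expansion)
qed

text \<open>\<open>F\<close> stays arbitrary because three cases occur: the identity of an ambient
  chart, the identity of a surface domain, and an immersion with the pulled-back connection.\<close>

locale riem_along =
  fixes U :: "(real^'m::finite) set" and V :: "(real^'n::finite) set"
    and g :: "real^'n \<Rightarrow> real^'n^'n" and F :: "real^'m \<Rightarrow> real^'n"
  assumes open_U: "open U" and open_V: "open V"
    and F_maps: "u \<in> U \<Longrightarrow> F u \<in> V"
    and F_smooth: "smooth_on U F" and g_smooth: "smooth_on V g"
    and g_transpose: "x \<in> V \<Longrightarrow> transpose (g x) = g x"
    and g_pos: "x \<in> V \<Longrightarrow> X \<noteq> 0 \<Longrightarrow> ip (g x) X X > 0"
begin

abbreviation D :: "'m \<Rightarrow> (real^'m \<Rightarrow> real^'n) \<Rightarrow> real^'m \<Rightarrow> real^'n" where "D \<equiv> covd g F"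

abbreviation dip :: "real^'m \<Rightarrow> real^'n \<Rightarrow> real^'n \<Rightarrow> real" where "dip u \<equiv> ip (g (F u))"

lemma diffU: "smooth_on U f \<Longrightarrow> u \<in> U \<Longrightarrow> f differentiable (at u)"
  by (rule smooth_on_differentiable)

lemma g_sym: "x \<in> V \<Longrightarrow> ip (g x) X Y = ip (g x) Y X"
  by (rule ip_sym[OF g_transpose])

lemma g_comp_sym: "x \<in> V \<Longrightarrow> g x $ i $ j = g x $ j $ i"
  using arg_cong[OF g_transpose, of x "\<lambda>A. A $ j $ i"] by (simp add: transpose_def)

lemma g_det: "x \<in> V \<Longrightarrow> det (g x) \<noteq> 0"
  using posdef_det_nz g_pos by blast

lemma dg_comp_sym: "x \<in> V \<Longrightarrow> pderiv_at l g x $ i $ j = pderiv_at l g x $ j $ i"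
proof -
  assume x: "x \<in> V"
  have d: "g differentiable (at x)" by (rule smooth_on_differentiable[OF g_smooth x])
  have d2: "(\<lambda>x. g x $ i) differentiable (at x)" for i
    by (rule differentiable_bounded_linear[OF bounded_linear_vec_nth d])
  have *: "pderiv_at l g x $ i $ j = pderiv_at l (\<lambda>x. g x $ i $ j) x" for i j
    using pderiv_at_bounded_linear[OF bounded_linear_vec_nth d]
      pderiv_at_bounded_linear[OF bounded_linear_vec_nth d2] by metis
  show ?thesis
    unfolding * by (rule pderiv_at_cong[OF open_V x]) (rule g_comp_sym)
qed

lemma Gam_sym:
  assumes "x \<in> V"
  shows "Gam g x X Y = Gam g x Y X"
proof -
  have c: "christoffel1 g x i j l = christoffel1 g x j i l" for i j l
    using dg_comp_sym[OF assms] by (simp add: christoffel1_def)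
  have "(\<Sum>i\<in>UNIV. \<Sum>j\<in>UNIV. christoffel1 g x i j l * X $ i * Y $ j) =
      (\<Sum>i\<in>UNIV. \<Sum>j\<in>UNIV. christoffel1 g x i j l * Y $ i * X $ j)" for l
    by (subst sum.swap) (simp add: c mult_ac)
  then show ?thesis by (simp add: Gam_alt)
qed

lemma ip_Gam:
  assumes "x \<in> V"
  shows "ip (g x) (Gam g x X Y) Z =
    (\<Sum>l\<in>UNIV. \<Sum>i\<in>UNIV. \<Sum>j\<in>UNIV. christoffel1 g x i j l * X $ i * Y $ j * Z $ l)"
proof -
  have "ip (g x) (Gam g x X Y) Z = ip (g x) Z (Gam g x X Y)" by (rule g_sym[OF assms])
  also have "\<dots> = Z \<bullet> (\<chi> l. \<Sum>i\<in>UNIV. \<Sum>j\<in>UNIV. christoffel1 g x i j l * X $ i * Y $ j)"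
    by (simp add: ip_def Gam_alt matrix_inv_vector_mult(1)[OF g_det[OF assms]])
  finally show ?thesis
    by (simp add: inner_vec_def sum_distrib_left mult_ac)
qed

text \<open>In the sum of two first-kind symbols with the last indices exchanged, only the
  derivative in direction \<open>i\<close> survives.\<close>

lemma metric_derivative:
  assumes "x \<in> V"
  shows "(\<Sum>i\<in>UNIV. X $ i * ip (pderiv_at i g x) Y Z) =
    ip (g x) (Gam g x X Y) Z + ip (g x) Y (Gam g x X Z)"
proof -
  let ?c = "\<lambda>i j l. christoffel1 g x i j l * X $ i * Y $ j * Z $ l"
  let ?d = "\<lambda>i l j. christoffel1 g x i l j * X $ i * Z $ l * Y $ j"
  have "ip (g x) (Gam g x X Y) Z = (\<Sum>l\<in>UNIV. \<Sum>i\<in>UNIV. \<Sum>j\<in>UNIV. ?c i j l)"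
    by (rule ip_Gam[OF assms])
  also have "\<dots> = (\<Sum>i\<in>UNIV. \<Sum>l\<in>UNIV. \<Sum>j\<in>UNIV. ?c i j l)" by (rule sum.swap)
  also have "\<dots> = (\<Sum>i\<in>UNIV. \<Sum>j\<in>UNIV. \<Sum>l\<in>UNIV. ?c i j l)"
    by (rule sum.cong[OF refl], rule sum.swap)
  finally have 1: "ip (g x) (Gam g x X Y) Z = (\<Sum>i\<in>UNIV. \<Sum>j\<in>UNIV. \<Sum>l\<in>UNIV. ?c i j l)" .
  have "ip (g x) Y (Gam g x X Z) = ip (g x) (Gam g x X Z) Y" by (rule g_sym[OF assms])
  also have "\<dots> = (\<Sum>j\<in>UNIV. \<Sum>i\<in>UNIV. \<Sum>l\<in>UNIV. ?d i l j)"
    by (rule ip_Gam[OF assms])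
  also have "\<dots> = (\<Sum>i\<in>UNIV. \<Sum>j\<in>UNIV. \<Sum>l\<in>UNIV. ?d i l j)" by (rule sum.swap)
  finally have "ip (g x) (Gam g x X Y) Z + ip (g x) Y (Gam g x X Z) =
      (\<Sum>i\<in>UNIV. \<Sum>j\<in>UNIV. \<Sum>l\<in>UNIV. ?c i j l + ?d i l j)"
    unfolding 1 by (simp add: sum.distrib)
  also have "\<dots> = (\<Sum>i\<in>UNIV. \<Sum>j\<in>UNIV. \<Sum>l\<in>UNIV. X $ i * (Y $ j * (pderiv_at i g x $ j $ l * Z $ l)))"
    using dg_comp_sym[OF assms]
    by (intro sum.cong refl) (simp add: christoffel1_def algebra_simps)
  finally show ?thesis
    by (simp add: ip_axis_sum sum_distrib_left)
qed

lemma pderiv_metric: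
  assumes "u \<in> U"
  shows "pderiv_at i (\<lambda>u. g (F u)) u = (\<Sum>l\<in>UNIV. pderiv_at i F u $ l *\<^sub>R pderiv_at l g (F u))"
  using pderiv_at_compose[OF diffU[OF F_smooth assms] smooth_on_differentiable[OF g_smooth F_maps[OF assms]]]
  by (simp add: frechet_derivative_pderiv[OF smooth_on_differentiable[OF g_smooth F_maps[OF assms]]])

lemma gF_smooth: "smooth_on U (\<lambda>u. g (F u))"
  using smooth_on_compose[OF open_U F_smooth g_smooth] F_maps by blast

lemma metric_compat:
  assumes "smooth_on U W" "smooth_on U Z" "u \<in> U"
  shows "pderiv_at i (\<lambda>u. dip u (W u) (Z u)) u = dip u (D i W u) (Z u) + dip u (W u) (D i Z u)"
proof -
  note dW = diffU[OF assms(1,3)] and dZ = diffU[OF assms(2,3)] and dG = diffU[OF gF_smooth assms(3)]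
  have ml: "sum f UNIV *v z = (\<Sum>l\<in>UNIV. f l *v z)" for f :: "'n \<Rightarrow> real^'n^'n" and z
    by (rule bounded_bilinear.sum_left[OF bounded_bilinear_matrix_vector_mult])
  have "pderiv_at i (\<lambda>u. g (F u)) u *v Z u = (\<Sum>l\<in>UNIV. pderiv_at i F u $ l *\<^sub>R (pderiv_at l g (F u) *v Z u))"
    by (simp add: pderiv_metric[OF assms(3)] ml scaleR_matrix_vector_assoc)
  then have 1: "W u \<bullet> (pderiv_at i (\<lambda>u. g (F u)) u *v Z u) =
      (\<Sum>l\<in>UNIV. pderiv_at i F u $ l * ip (pderiv_at l g (F u)) (W u) (Z u))"
    by (simp add: inner_sum_right ip_def)
  have e1: "pderiv_at i (\<lambda>u. g (F u) *v Z u) u =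
      g (F u) *v pderiv_at i Z u + pderiv_at i (\<lambda>u. g (F u)) u *v Z u"
    by (rule pderiv_at_bounded_bilinear[OF bounded_bilinear_matrix_vector_mult dG dZ])
  have e2: "pderiv_at i (\<lambda>u. W u \<bullet> (g (F u) *v Z u)) u =
      W u \<bullet> pderiv_at i (\<lambda>u. g (F u) *v Z u) u + pderiv_at i W u \<bullet> (g (F u) *v Z u)"
    by (rule pderiv_at_bounded_bilinear[OF bounded_bilinear_inner dW
        differentiable_bounded_bilinear[OF bounded_bilinear_matrix_vector_mult dG dZ]])
  have "pderiv_at i (\<lambda>u. dip u (W u) (Z u)) u =
      W u \<bullet> (g (F u) *v pderiv_at i Z u + pderiv_at i (\<lambda>u. g (F u)) u *v Z u)
      + pderiv_at i W u \<bullet> (g (F u) *v Z u)"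
    unfolding ip_def using e2 unfolding e1 .
  also have "\<dots> = dip u (W u) (pderiv_at i Z u) + dip u (pderiv_at i W u) (Z u)
      + (\<Sum>l\<in>UNIV. pderiv_at i F u $ l * ip (pderiv_at l g (F u)) (W u) (Z u))"
    by (simp add: inner_add_right 1 ip_def)
  also have "\<dots> = dip u (D i W u) (Z u) + dip u (W u) (D i Z u)"
    unfolding metric_derivative[OF F_maps[OF assms(3)]]
    by (simp add: covd_eq ip_linear)
  finally show ?thesis .
qed

text \<open>Second derivatives of \<open>F\<close> commute, and the Christoffel term is symmetric in
  its lower indices. In terms of forms, the exterior covariant derivative of dF vanishes.\<close>

lemma torsion_free:
  assumes "u \<in> U"
  shows "D i (pderiv_at j F) u = D j (pderiv_at i F) u"
  using pderiv_commute[OF F_smooth open_U assms] Gam_sym[OF F_maps[OF assms]]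
  by (simp add: covd_eq)

text \<open>Connection matrix of the pulled-back bundle, which turns covariant differentiation into
  d plus a matrix.\<close>

definition conn :: "'m \<Rightarrow> real^'m \<Rightarrow> real^'n^'n" where
  "conn i u = (\<chi> k j. \<Sum>l\<in>UNIV. christoffel g (F u) k l j * pderiv_at i F u $ l)"

lemma D_conn: "D i W u = pderiv_at i W u + conn i u *v W u"
proof -
  have "(\<Sum>i'\<in>UNIV. \<Sum>j\<in>UNIV. christoffel g (F u) k i' j * pderiv_at i F u $ i' * W u $ j) =
      (\<Sum>j\<in>UNIV. \<Sum>l\<in>UNIV. christoffel g (F u) k l j * pderiv_at i F u $ l * W u $ j)" for k
    by (rule sum.swap)
  then show ?thesis
    by (simp add: covd_eq Gam_def conn_def matrix_vector_mult_def sum_distrib_right vec_eq_iff)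
qed

lemma conn_smooth: "smooth_on U (conn i)"
proof -
  have "smooth_on V (\<lambda>x. christoffel g x k l j)" for k l j
    unfolding christoffel_def
    by (intro smooth_intros smooth_on_matrix_inv open_V g_smooth g_det)
  then have "smooth_on U (\<lambda>u. christoffel g (F u) k l j)" for k l j
    using smooth_on_compose[OF open_U F_smooth] F_maps by blast
  then have "smooth_on U (\<lambda>u. \<chi> k j. \<Sum>l\<in>UNIV. christoffel g (F u) k l j * pderiv_at i F u $ l)"
    by (intro smooth_intros open_U F_smooth)
  then show ?thesis unfolding conn_def[abs_def] .
qed

lemma D_smooth: "smooth_on U W \<Longrightarrow> smooth_on U (D i W)"
  unfolding D_conn[abs_def] by (intro smooth_intros open_U conn_smooth)

lemma D_cong:
  assumes "u \<in> U" "\<And>v. v \<in> U \<Longrightarrow> W v = Z v"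
  shows "D i W u = D i Z u"
  using pderiv_at_cong[OF open_U assms] assms by (simp add: covd_eq)

lemma D_add:
  assumes "smooth_on U W" "smooth_on U Z" "u \<in> U"
  shows "D i (\<lambda>u. W u + Z u) u = D i W u + D i Z u"
  using assms by (simp add: covd_eq pderiv_at_add diffU Gam_add_right)

lemma D_scale:
  assumes "smooth_on U \<phi>" "smooth_on U W" "u \<in> U"
  shows "D i (\<lambda>u. \<phi> u *\<^sub>R W u) u = pderiv_at i \<phi> u *\<^sub>R W u + \<phi> u *\<^sub>R D i W u"
  using assms
  by (simp add: covd_eq pderiv_at_bounded_bilinear[OF bounded_bilinear_scaleR] diffU
      Gam_scale_right scaleR_add_right)

text \<open>The curvature matrix d\<omega> + \<omega> \<and> \<omega> of the connection matrix
  \<omega>. As a matrix applied to \<open>Z\<close> it sees only the value of a field at the point,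
  so tensoriality is built in.\<close>

definition Rm :: "'m \<Rightarrow> 'm \<Rightarrow> real^'m \<Rightarrow> real^'n \<Rightarrow> real^'n" where
  "Rm i j u Z = (pderiv_at i (conn j) u - pderiv_at j (conn i) u
     + conn i u ** conn j u - conn j u ** conn i u) *v Z"

lemma curvature_Rm:
  assumes "smooth_on U W" "u \<in> U"
  shows "D i (D j W) u - D j (D i W) u = Rm i j u (W u)"
proof -
  have *: "pderiv_at i (D j W) u = pderiv_at i (pderiv_at j W) u
      + (conn j u *v pderiv_at i W u + pderiv_at i (conn j) u *v W u)" for i j
  proof -
    have "pderiv_at i (D j W) u = pderiv_at i (\<lambda>u. pderiv_at j W u + conn j u *v W u) u"
      by (simp add: D_conn[abs_def])
    also have "\<dots> = pderiv_at i (pderiv_at j W) u + pderiv_at i (\<lambda>u. conn j u *v W u) u"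
      by (intro pderiv_at_add diffU[OF _ assms(2)] smooth_intros open_U conn_smooth assms)
    finally show ?thesis
      using pderiv_at_bounded_bilinear[OF bounded_bilinear_matrix_vector_mult
          diffU[OF conn_smooth assms(2)] diffU[OF assms]] by simp
  qed
  have comm: "pderiv_at i (pderiv_at j W) u = pderiv_at j (pderiv_at i W) u"
    by (rule pderiv_commute[OF assms(1) open_U assms(2)])
  have "D i (D j W) u - D j (D i W) u =
      pderiv_at i (D j W) u + conn i u *v D j W u - (pderiv_at j (D i W) u + conn j u *v D i W u)"
    by (simp add: D_conn[of _ "D _ W"])
  then show ?thesis
    unfolding * D_conn[of _ W] comm Rm_def
    by (simp add: matrix_vector_right_distrib matrix_vector_mult_add_rdistrib
        matrix_vector_mult_diff_rdistrib matrix_vector_mul_assoc)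
qed

lemma Rm_linear: "Rm i j u (X + Y) = Rm i j u X + Rm i j u Y" "Rm i j u (c *\<^sub>R X) = c *\<^sub>R Rm i j u X"
  by (simp_all add: Rm_def matrix_vector_right_distrib matrix_vector_mult_scaleR)

text \<open>Second derivatives of the inner product of two constant-coefficient fields commute; the
  terms with one derivative on each field are symmetric in \<open>i\<close> and \<open>j\<close> and
  cancel.\<close>

lemma Rm_skew:
  assumes "u \<in> U"
  shows "dip u (Rm i j u X) Y = - dip u X (Rm i j u Y)"
proof -
  let ?X = "\<lambda>u::real^'m. X" and ?Y = "\<lambda>u::real^'m. Y"
  have sX: "smooth_on U ?X" and sY: "smooth_on U ?Y" by (rule smooth_on_const)+
  let ?\<phi> = "\<lambda>u. dip u X Y"
  have s\<phi>: "smooth_on U ?\<phi>" by (intro smooth_on_ip gF_smooth smooth_on_const open_U)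
  have *: "pderiv_at i (pderiv_at j ?\<phi>) u =
      dip u (D i (D j ?X) u) Y + dip u (D j ?X u) (D i ?Y u)
      + (dip u (D i ?X u) (D j ?Y u) + dip u X (D i (D j ?Y) u))" for i j
  proof -
    have "pderiv_at i (pderiv_at j ?\<phi>) u =
        pderiv_at i (\<lambda>u. dip u (D j ?X u) Y + dip u X (D j ?Y u)) u"
      by (rule pderiv_at_cong[OF open_U assms]) (rule metric_compat[OF sX sY])
    also have "\<dots> = pderiv_at i (\<lambda>u. dip u (D j ?X u) Y) u + pderiv_at i (\<lambda>u. dip u X (D j ?Y u)) u"
      by (intro pderiv_at_add diffU[OF _ assms] smooth_on_ip gF_smooth D_smooth smooth_on_const open_U)
    finally show ?thesis
      using metric_compat[OF D_smooth[OF sX] sY assms] metric_compat[OF sX D_smooth[OF sY] assms] by simp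
  qed
  have "pderiv_at i (pderiv_at j ?\<phi>) u = pderiv_at j (pderiv_at i ?\<phi>) u"
    by (rule pderiv_commute_real[OF s\<phi> open_U assms])
  then have "dip u (D i (D j ?X) u - D j (D i ?X) u) Y + dip u X (D i (D j ?Y) u - D j (D i ?Y) u) = 0"
    unfolding * by (simp add: ip_linear)
  then show ?thesis
    by (simp add: curvature_Rm[OF sX assms] curvature_Rm[OF sY assms])
qed

end

section \<open>Orthonormal frames of surfaces\<close>

lemma axis_components_2 [simp]:
  "axis (1::2) (x::real) $ 1 = x" "axis (1::2) x $ 2 = 0"
  "axis (2::2) x $ 1 = 0" "axis (2::2) x $ 2 = x"
  by (simp_all add: axis_def)

lemma ip_2:
  "ip (A::real^2^2) X Y = A$1$1 * X$1 * Y$1 + A$1$2 * X$1 * Y$2 + A$2$1 * X$2 * Y$1 + A$2$2 * X$2 * Y$2"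
  by (simp add: ip_axis_sum sum_2 algebra_simps)

locale riem_surface =
  fixes U :: "(real^2) set" and \<gamma> :: "real^2 \<Rightarrow> real^2^2"
  assumes open_dom: "open U" and metric_smooth: "smooth_on U \<gamma>"
    and metric_transpose: "x \<in> U \<Longrightarrow> transpose (\<gamma> x) = \<gamma> x"
    and metric_posdef: "x \<in> U \<Longrightarrow> X \<noteq> 0 \<Longrightarrow> ip (\<gamma> x) X X > 0"

sublocale riem_surface \<subseteq> riem_along U U \<gamma> "\<lambda>x. x"
  using open_dom metric_smooth metric_transpose metric_posdef
  by unfold_locales (auto intro: smooth_on_ident)

context riem_surface
begin

text \<open>
  \<open>(p q; 0 r)\<close> is the Cholesky factor of the metric, so that \<open>e1\<close>, \<open>e2\<close> is the Gram-Schmidt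
  frame of the coordinate fields and \<open>th1\<close>, \<open>th2\<close> its dual coframe.
\<close>

definition p where "p u = sqrt (\<gamma> u $ 1 $ 1)"
definition q where "q u = \<gamma> u $ 1 $ 2 / p u"
definition r where "r u = sqrt (det (\<gamma> u)) / p u"
definition e1 where "e1 u = (1 / p u) *\<^sub>R axis (1::2) (1::real)"
definition e2 where "e2 u = (1 / r u) *\<^sub>R (axis (2::2) (1::real) - (q u / p u) *\<^sub>R axis 1 1)"
definition th1 where "th1 u (X::real^2) = p u * X $ 1 + q u * X $ 2"
definition th2 where "th2 u (X::real^2) = r u * X $ 2"
definition om where "om i u = ip (\<gamma> u) (D i e1 u) (e2 u)"

lemma metric_11_pos: "u \<in> U \<Longrightarrow> \<gamma> u $ 1 $ 1 > 0"
  using metric_posdef[of u "axis 1 1"] by (simp add: ip_axis axis_eq_0_iff)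

lemma metric_21: "u \<in> U \<Longrightarrow> \<gamma> u $ 2 $ 1 = \<gamma> u $ 1 $ 2"
  by (rule g_comp_sym)

lemma metric_det_pos:
  assumes "u \<in> U"
  shows "det (\<gamma> u) > 0"
proof -
  \<comment> \<open>A combination orthogonal to the first coordinate field; its squared length is
    the first metric coefficient times the determinant.\<close>
  define X :: "real^2" where "X = (\<gamma> u $ 1 $ 1) *\<^sub>R axis 2 1 - (\<gamma> u $ 1 $ 2) *\<^sub>R axis 1 1"
  have "X $ 2 \<noteq> 0" using metric_11_pos[OF assms] by (simp add: X_def)
  then have "ip (\<gamma> u) X X > 0" using metric_posdef[OF assms, of X] by fastforce
  also have "ip (\<gamma> u) X X = \<gamma> u $ 1 $ 1 * det (\<gamma> u)"
    by (simp add: ip_2 X_def det_2 metric_21[OF assms] algebra_simps)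
  finally show ?thesis using metric_11_pos[OF assms] by (simp add: zero_less_mult_iff)
qed

lemma p_pos: "u \<in> U \<Longrightarrow> p u > 0"
  using metric_11_pos by (simp add: p_def)

lemma r_pos: "u \<in> U \<Longrightarrow> r u > 0"
  using metric_det_pos p_pos by (simp add: r_def)

lemma det_pr: "u \<in> U \<Longrightarrow> det (\<gamma> u) = (p u * r u)\<^sup>2"
  using metric_det_pos[of u] p_pos[of u] by (simp add: r_def)

lemma metric_pqr:
  assumes "u \<in> U"
  shows "\<gamma> u $ 1 $ 1 = (p u)\<^sup>2" "\<gamma> u $ 1 $ 2 = p u * q u" "\<gamma> u $ 2 $ 1 = p u * q u"
    "\<gamma> u $ 2 $ 2 = (q u)\<^sup>2 + (r u)\<^sup>2"
proof -
  show 1: "\<gamma> u $ 1 $ 1 = (p u)\<^sup>2" using metric_11_pos[OF assms] by (simp add: p_def)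
  show 2: "\<gamma> u $ 1 $ 2 = p u * q u" using p_pos[OF assms] by (simp add: q_def)
  then show 3: "\<gamma> u $ 2 $ 1 = p u * q u" by (simp add: metric_21[OF assms])
  have "(p u)\<^sup>2 * (\<gamma> u $ 2 $ 2 - (q u)\<^sup>2) = (p u)\<^sup>2 * (r u)\<^sup>2"
    using det_pr[OF assms] unfolding det_2 1 2 3 by (simp add: power2_eq_square algebra_simps)
  then show "\<gamma> u $ 2 $ 2 = (q u)\<^sup>2 + (r u)\<^sup>2" using p_pos[OF assms] by simp
qed

lemma ip_th: "u \<in> U \<Longrightarrow> ip (\<gamma> u) X Y = th1 u X * th1 u Y + th2 u X * th2 u Y"
  by (simp add: ip_2 metric_pqr th1_def th2_def power2_eq_square algebra_simps)

lemma th_frame: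
  assumes "u \<in> U"
  shows "th1 u (e1 u) = 1" "th2 u (e1 u) = 0" "th1 u (e2 u) = 0" "th2 u (e2 u) = 1"
  using p_pos[OF assms] r_pos[OF assms] by (simp_all add: th1_def th2_def e1_def e2_def)

lemma th_axis: "th1 u (axis 1 1) = p u" "th1 u (axis 2 1) = q u" "th2 u (axis 1 1) = 0" "th2 u (axis 2 1) = r u"
  by (simp_all add: th1_def th2_def)

lemma th_linear:
  "th1 u (X + Y) = th1 u X + th1 u Y" "th2 u (X + Y) = th2 u X + th2 u Y"
  "th1 u (c *\<^sub>R X) = c * th1 u X" "th2 u (c *\<^sub>R X) = c * th2 u X"
  "th1 u (- X) = - th1 u X" "th2 u (- X) = - th2 u X"
  "th1 u (X - Y) = th1 u X - th1 u Y" "th2 u (X - Y) = th2 u X - th2 u Y"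
  by (simp_all add: th1_def th2_def algebra_simps)

lemma frame_expansion:
  assumes "u \<in> U"
  shows "X = th1 u X *\<^sub>R e1 u + th2 u X *\<^sub>R e2 u"
  using p_pos[OF assms] r_pos[OF assms]
  by (auto simp: vec_eq_iff forall_2 th1_def th2_def e1_def e2_def field_simps)

lemma axis_frame:
  assumes "u \<in> U"
  shows "axis 1 1 = p u *\<^sub>R e1 u" "axis 2 1 = q u *\<^sub>R e1 u + r u *\<^sub>R e2 u"
  using frame_expansion[OF assms, of "axis 1 1"] frame_expansion[OF assms, of "axis 2 1"]
  by (simp_all add: th_axis)

lemma ip_frame:
  assumes "u \<in> U"
  shows "ip (\<gamma> u) (e1 u) X = th1 u X" "ip (\<gamma> u) (e2 u) X = th2 u X"
    "ip (\<gamma> u) X (e1 u) = th1 u X" "ip (\<gamma> u) X (e2 u) = th2 u X"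
  by (simp_all add: ip_th[OF assms] th_frame[OF assms])

lemma frame_ext:
  assumes "u \<in> U" "th1 u X = th1 u Y" "th2 u X = th2 u Y"
  shows "X = Y"
  using frame_expansion[OF assms(1)] assms(2,3) by metis

lemma p_smooth: "smooth_on U p"
  unfolding p_def[abs_def]
  by (intro smooth_on_sqrt smooth_intros open_dom metric_smooth metric_11_pos)

lemma q_smooth: "smooth_on U q"
  unfolding q_def[abs_def]
  by (intro smooth_on_divide smooth_intros p_smooth open_dom metric_smooth) (use p_pos in force)

lemma r_smooth: "smooth_on U r"
  unfolding r_def[abs_def]
  by (intro smooth_on_divide smooth_on_sqrt smooth_intros p_smooth open_dom metric_smooth metric_det_pos)
    (use p_pos in force)

lemma e1_smooth: "smooth_on U e1"
  unfolding e1_def[abs_def]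
  by (intro smooth_on_divide smooth_intros p_smooth open_dom) (use p_pos in force)

lemma e2_smooth: "smooth_on U e2"
  unfolding e2_def[abs_def]
  by (intro smooth_on_divide smooth_intros p_smooth q_smooth r_smooth open_dom)
    (use p_pos r_pos in force)+

lemma om_smooth: "smooth_on U (om i)"
  unfolding om_def[abs_def]
  by (intro smooth_on_ip metric_smooth D_smooth e1_smooth e2_smooth open_dom)

lemma D_frame:
  assumes "u \<in> U"
  shows "D i e1 u = om i u *\<^sub>R e2 u" "D i e2 u = - om i u *\<^sub>R e1 u"
proof -
  have *: "ip (\<gamma> u) (D i W u) (Z u) + ip (\<gamma> u) (W u) (D i Z u) = 0"
    if "smooth_on U W" "smooth_on U Z" "\<And>v. v \<in> U \<Longrightarrow> ip (\<gamma> v) (W v) (Z v) = c" for W Z c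
  proof -
    have "pderiv_at i (\<lambda>v. ip (\<gamma> v) (W v) (Z v)) u = pderiv_at i (\<lambda>v. c) u"
      using that(3) by (intro pderiv_at_cong[OF open_dom assms])
    then show ?thesis using metric_compat[OF that(1,2) assms] by simp
  qed
  have 11: "th1 u (D i e1 u) = 0"
    using *[OF e1_smooth e1_smooth, of 1] by (simp add: ip_frame th_frame assms)
  have 22: "th2 u (D i e2 u) = 0"
    using *[OF e2_smooth e2_smooth, of 1] by (simp add: ip_frame th_frame assms)
  have 12: "th2 u (D i e1 u) + th1 u (D i e2 u) = 0"
    using *[OF e1_smooth e2_smooth, of 0] by (simp add: ip_frame th_frame assms)
  have o: "om i u = th2 u (D i e1 u)" by (simp add: om_def ip_frame assms)
  show "D i e1 u = om i u *\<^sub>R e2 u"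
    by (rule frame_ext[OF assms]) (simp_all add: th_linear th_frame assms 11 o)
  show "D i e2 u = - om i u *\<^sub>R e1 u"
    using 12 by (intro frame_ext[OF assms]) (simp_all add: th_linear th_frame assms 22 o)
qed

lemma pderiv_ident_fun: "pderiv_at i (\<lambda>x. x) = (\<lambda>x. axis i 1)"
  by (rule ext) simp

lemma D_axis_sym: "u \<in> U \<Longrightarrow> D i (\<lambda>x. axis j 1) u = D j (\<lambda>x. axis i 1) u"
  using torsion_free[of u i j] by (simp add: pderiv_ident_fun)

lemma pderiv_th1:
  assumes "u \<in> U"
  shows "pderiv_at i (\<lambda>v. th1 v X) u = om i u * th2 u X + th1 u (D i (\<lambda>x. X) u)"
proof -
  have "pderiv_at i (\<lambda>v. th1 v X) u = pderiv_at i (\<lambda>v. ip (\<gamma> v) (e1 v) X) u"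
    by (rule pderiv_at_cong[OF open_dom assms]) (simp add: ip_frame)
  then show ?thesis
    using metric_compat[OF e1_smooth smooth_on_const assms, of i X]
    by (simp add: D_frame ip_linear ip_frame assms)
qed

lemma pderiv_th2:
  assumes "u \<in> U"
  shows "pderiv_at i (\<lambda>v. th2 v X) u = - om i u * th1 u X + th2 u (D i (\<lambda>x. X) u)"
proof -
  have "pderiv_at i (\<lambda>v. th2 v X) u = pderiv_at i (\<lambda>v. ip (\<gamma> v) (e2 v) X) u"
    by (rule pderiv_at_cong[OF open_dom assms]) (simp add: ip_frame)
  then show ?thesis
    using metric_compat[OF e2_smooth smooth_on_const assms, of i X]
    by (simp add: D_frame ip_linear ip_frame assms)
qed

text \<open>Cartan's first structure equations, d th1 = om \<and> th2 and d th2 = - om \<and> th1,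
  on the two coordinate fields. Only one derivative of \<open>r\<close> occurs because
  \<open>th2\<close> vanishes on the first coordinate field.\<close>

lemma structure_equations:
  assumes "u \<in> U"
  shows "pderiv_at 1 q u - pderiv_at 2 p u = om 1 u * r u"
    "pderiv_at 1 r u = om 2 u * p u - om 1 u * q u"
proof -
  have s: "D 1 (\<lambda>x. axis 2 1) u = D 2 (\<lambda>x. axis 1 1) u" by (rule D_axis_sym[OF assms])
  show "pderiv_at 1 q u - pderiv_at 2 p u = om 1 u * r u"
    using pderiv_th1[OF assms, of 1 "axis 2 1"] pderiv_th1[OF assms, of 2 "axis 1 1"]
    by (simp add: th_axis s)
  show "pderiv_at 1 r u = om 2 u * p u - om 1 u * q u"
    using pderiv_th2[OF assms, of 1 "axis 2 1"] pderiv_th2[OF assms, of 2 "axis 1 1"]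
    by (simp add: th_axis s)
qed

text \<open>Cartan's second structure equation d om = - K th1 \<and> th2, with
  \<open>p u * r u\<close> as coefficient of the area form. In the second derivatives of
  \<open>e1\<close> the \<open>e1\<close> components are symmetric in the indices and drop out of
  the commutator.\<close>

lemma pderiv_om:
  assumes "u \<in> U"
  shows "pderiv_at 1 (om 2) u - pderiv_at 2 (om 1) u = - gauss_curvature \<gamma> u * p u * r u"
proof -
  have D2: "D i (D j e1) u = pderiv_at i (om j) u *\<^sub>R e2 u - (om j u * om i u) *\<^sub>R e1 u" for i j
  proof -
    have "D i (D j e1) u = D i (\<lambda>v. om j v *\<^sub>R e2 v) u"
      by (rule D_cong[OF assms]) (rule D_frame)
    then show ?thesis by (simp add: D_scale[OF om_smooth e2_smooth assms] D_frame assms)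
  qed
  have 1: "Rm 1 2 u (e1 u) = (pderiv_at 1 (om 2) u - pderiv_at 2 (om 1) u) *\<^sub>R e2 u"
    using curvature_Rm[OF e1_smooth assms, of 1 2] by (simp add: D2 scaleR_diff_left mult.commute)
  have c: "curv \<gamma> u (axis 1 1) (axis 2 1) Z = Rm 1 2 u Z" for Z
    using curvature_Rm[OF smooth_on_const assms, of 1 2 Z]
    by (simp add: curv_def cov_def covd_def[abs_def])
  \<comment> \<open>The Gauss curvature is defined by the curvature of the second coordinate field,
    the frame formula concerns \<open>e1\<close>; skew-symmetry exchanges them.\<close>
  have "ip (\<gamma> u) (Rm 1 2 u (axis 2 1)) (axis 1 1) = - ip (\<gamma> u) (axis 2 1) (Rm 1 2 u (axis 1 1))"
    by (rule Rm_skew[OF assms])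
  also have "Rm 1 2 u (axis 1 1) = (p u * (pderiv_at 1 (om 2) u - pderiv_at 2 (om 1) u)) *\<^sub>R e2 u"
    by (subst axis_frame(1)[OF assms]) (simp add: Rm_linear 1)
  also have "ip (\<gamma> u) (axis 2 1) \<dots> = p u * r u * (pderiv_at 1 (om 2) u - pderiv_at 2 (om 1) u)"
    by (simp add: ip_linear ip_frame assms th_axis)
  finally have "gauss_curvature \<gamma> u * (p u * r u)\<^sup>2 =
      - (p u * r u * (pderiv_at 1 (om 2) u - pderiv_at 2 (om 1) u))"
    using p_pos[OF assms] r_pos[OF assms] by (simp add: gauss_curvature_def c det_pr assms)
  then have "(p u * r u) * (gauss_curvature \<gamma> u * (p u * r u) + (pderiv_at 1 (om 2) u - pderiv_at 2 (om 1) u)) = 0"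
    by (simp add: power2_eq_square algebra_simps)
  then have "gauss_curvature \<gamma> u * (p u * r u) + (pderiv_at 1 (om 2) u - pderiv_at 2 (om 1) u) = 0"
    using p_pos[OF assms] r_pos[OF assms] unfolding mult_eq_0_iff by auto
  then show ?thesis by (simp add: algebra_simps)
qed

end

section \<open>The Simons formula for traceless Codazzi operators\<close>

context riem_surface
begin

lemma frame_components:
  "e1 u $ 1 = 1 / p u" "e1 u $ 2 = 0" "e2 u $ 1 = - q u / (p u * r u)" "e2 u $ 2 = 1 / r u"
  by (simp_all add: e1_def e2_def)

lemma D_frame_field:
  assumes "smooth_on U a" "smooth_on U b" "u \<in> U"
  shows "D i (\<lambda>u. a u *\<^sub>R e1 u + b u *\<^sub>R e2 u) u =
    (pderiv_at i a u - om i u * b u) *\<^sub>R e1 u + (pderiv_at i b u + om i u * a u) *\<^sub>R e2 u"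
proof -
  have "D i (\<lambda>u. a u *\<^sub>R e1 u + b u *\<^sub>R e2 u) u =
      D i (\<lambda>u. a u *\<^sub>R e1 u) u + D i (\<lambda>u. b u *\<^sub>R e2 u) u"
    by (intro D_add smooth_on_scaleR assms e1_smooth e2_smooth open_dom)
  then show ?thesis
    by (simp add: D_scale assms e1_smooth e2_smooth D_frame algebra_simps)
qed

section \<open>Gradient and Laplacian through the derivatives along the frame\<close>

definition v1 where "v1 \<phi> u = pderiv_at 1 \<phi> u / p u"
definition v2 where "v2 \<phi> u = (pderiv_at 2 \<phi> u - q u / p u * pderiv_at 1 \<phi> u) / r u"

lemma v_smooth:
  assumes "smooth_on U \<phi>"
  shows "smooth_on U (v1 \<phi>)" "smooth_on U (v2 \<phi>)"
  unfolding v1_def[abs_def] v2_def[abs_def]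
  by (intro smooth_on_divide smooth_intros assms p_smooth q_smooth r_smooth open_dom;
      use p_pos r_pos in force)+

lemma grad_frame:
  assumes "u \<in> U"
  shows "grad \<gamma> \<phi> u = v1 \<phi> u *\<^sub>R e1 u + v2 \<phi> u *\<^sub>R e2 u"
  unfolding grad_def
proof (rule matrix_inv_vector_eqI[OF g_det[OF assms]])
  show "\<gamma> u *v (v1 \<phi> u *\<^sub>R e1 u + v2 \<phi> u *\<^sub>R e2 u) = (\<chi> i. pderiv_at i \<phi> u)"
    using p_pos[OF assms] r_pos[OF assms]
    by (simp add: vec_eq_iff forall_2 matrix_vector_mult_def sum_2 metric_pqr assms v1_def v2_def
        frame_components power2_eq_square) (simp add: field_simps)
qed

lemma grad_cong:
  assumes "u \<in> U" "\<And>v. v \<in> U \<Longrightarrow> \<phi> v = \<psi> v"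
  shows "grad \<gamma> \<phi> u = grad \<gamma> \<psi> u"
  using pderiv_at_cong[OF open_dom assms] by (simp add: grad_def)

lemma laplacian_cong:
  assumes "u \<in> U" "\<And>v. v \<in> U \<Longrightarrow> \<phi> v = \<psi> v"
  shows "laplacian \<gamma> \<phi> u = laplacian \<gamma> \<psi> u"
proof -
  have "D i (grad \<gamma> \<phi>) u = D i (grad \<gamma> \<psi>) u" for i
    by (rule D_cong[OF assms(1)]) (rule grad_cong[OF _ assms(2)])
  then show ?thesis
    by (simp add: laplacian_def trace_def sum_2 matrix_def cov_def covd_def)
qed

text \<open>The divergence form: \<open>p u * r u\<close> is the area density, and the two
  differentiated functions are this density times the coordinate components of the gradient. By the
  structure equations, the connection terms of the trace are those that the product rule
  produces.\<close>

lemma laplacian_frame: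
  assumes "smooth_on U \<phi>" "u \<in> U"
  shows "p u * r u * laplacian \<gamma> \<phi> u =
    pderiv_at 1 (\<lambda>u. r u * v1 \<phi> u - q u * v2 \<phi> u) u + pderiv_at 2 (\<lambda>u. p u * v2 \<phi> u) u"
proof -
  note pos = p_pos[OF assms(2)] r_pos[OF assms(2)]
  note sm = v_smooth[OF assms(1)] p_smooth q_smooth r_smooth
  note df = sm[THEN diffU, OF assms(2)]
  have D: "D i (grad \<gamma> \<phi>) u = (pderiv_at i (v1 \<phi>) u - om i u * v2 \<phi> u) *\<^sub>R e1 u
      + (pderiv_at i (v2 \<phi>) u + om i u * v1 \<phi> u) *\<^sub>R e2 u" for i
  proof -
    have "D i (grad \<gamma> \<phi>) u = D i (\<lambda>u. v1 \<phi> u *\<^sub>R e1 u + v2 \<phi> u *\<^sub>R e2 u) u"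
      by (rule D_cong[OF assms(2)]) (rule grad_frame)
    then show ?thesis by (simp add: D_frame_field v_smooth assms)
  qed
  have L: "laplacian \<gamma> \<phi> u = D 1 (grad \<gamma> \<phi>) u $ 1 + D 2 (grad \<gamma> \<phi>) u $ 2"
    by (simp add: laplacian_def trace_def sum_2 matrix_def cov_def covd_def)
  have "p u * r u * laplacian \<gamma> \<phi> u = r u * pderiv_at 1 (v1 \<phi>) u + (om 2 u * p u - om 1 u * q u) * v1 \<phi> u
      - q u * pderiv_at 1 (v2 \<phi>) u - om 1 u * r u * v2 \<phi> u + p u * pderiv_at 2 (v2 \<phi>) u"
    using pos by (simp add: L D frame_components field_simps)
  also have "\<dots> = pderiv_at 1 (\<lambda>u. r u * v1 \<phi> u - q u * v2 \<phi> u) u + pderiv_at 2 (\<lambda>u. p u * v2 \<phi> u) u"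
  proof -
    have "pderiv_at 1 (\<lambda>u. r u * v1 \<phi> u - q u * v2 \<phi> u) u =
        pderiv_at 1 (\<lambda>u. r u * v1 \<phi> u) u - pderiv_at 1 (\<lambda>u. q u * v2 \<phi> u) u"
      by (intro pderiv_at_diff diffU[OF _ assms(2)] smooth_intros sm open_dom)
    also have "\<dots> = r u * pderiv_at 1 (v1 \<phi>) u + pderiv_at 1 r u * v1 \<phi> u
        - (q u * pderiv_at 1 (v2 \<phi>) u + pderiv_at 1 q u * v2 \<phi> u)"
      by (simp add: pderiv_at_mult df)
    finally have 1: "pderiv_at 1 (\<lambda>u. r u * v1 \<phi> u - q u * v2 \<phi> u) u = \<dots>" .
    have 2: "pderiv_at 2 (\<lambda>u. p u * v2 \<phi> u) u = p u * pderiv_at 2 (v2 \<phi>) u + pderiv_at 2 p u * v2 \<phi> u"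
      by (simp add: pderiv_at_mult df)
    have 3: "pderiv_at 1 q u = pderiv_at 2 p u + om 1 u * r u"
      using structure_equations(1)[OF assms(2)] by simp
    show ?thesis
      unfolding 1 2 3 structure_equations(2)[OF assms(2)] by (simp add: algebra_simps)
  qed
  finally show ?thesis .
qed

text \<open>In divergence form both coefficients pick up the factor 2\<psi>, and the product rule
  does the rest. It carries the formula for |S|^2 over to |S|.\<close>

lemma laplacian_square:
  assumes "smooth_on U \<phi>" "smooth_on U \<psi>" "\<And>v. v \<in> U \<Longrightarrow> \<phi> v = \<psi> v * \<psi> v" "u \<in> U"
  shows "1/2 * laplacian \<gamma> \<phi> u = \<psi> u * laplacian \<gamma> \<psi> u + ip (\<gamma> u) (grad \<gamma> \<psi> u) (grad \<gamma> \<psi> u)"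
proof -
  note pos = p_pos[OF assms(4)] r_pos[OF assms(4)]
  note sm = v_smooth[OF assms(2)] p_smooth q_smooth r_smooth assms(2)
  note df = sm[THEN diffU, OF assms(4)]
  have pd: "pderiv_at i \<phi> v = 2 * \<psi> v * pderiv_at i \<psi> v" if "v \<in> U" for i v
  proof -
    have "pderiv_at i \<phi> v = pderiv_at i (\<lambda>v. \<psi> v * \<psi> v) v"
      by (rule pderiv_at_cong[OF open_dom that]) (rule assms(3))
    then show ?thesis by (simp add: pderiv_at_mult diffU[OF assms(2) that])
  qed
  have v: "v1 \<phi> v = 2 * \<psi> v * v1 \<psi> v" "v2 \<phi> v = 2 * \<psi> v * v2 \<psi> v" if "v \<in> U" for v
    by (simp_all add: v1_def v2_def pd that algebra_simps diff_divide_distrib)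
  let ?a = "\<lambda>u. r u * v1 \<psi> u - q u * v2 \<psi> u" and ?b = "\<lambda>u. p u * v2 \<psi> u"
  have sa: "smooth_on U ?a" and sb: "smooth_on U ?b" by (intro smooth_intros sm open_dom)+
  note dab = sa[THEN diffU, OF assms(4)] sb[THEN diffU, OF assms(4)]
  have 1: "pderiv_at 1 (\<lambda>u. r u * v1 \<phi> u - q u * v2 \<phi> u) u = pderiv_at 1 (\<lambda>u. (\<psi> u + \<psi> u) * ?a u) u"
    by (rule pderiv_at_cong[OF open_dom assms(4)]) (simp add: v algebra_simps)
  have 2: "pderiv_at 2 (\<lambda>u. p u * v2 \<phi> u) u = pderiv_at 2 (\<lambda>u. (\<psi> u + \<psi> u) * ?b u) u"
    by (rule pderiv_at_cong[OF open_dom assms(4)]) (simp add: v algebra_simps)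
  have d2: "(\<lambda>u. \<psi> u + \<psi> u) differentiable (at u)"
    by (intro diffU[OF _ assms(4)] smooth_intros sm open_dom)
  have "p u * r u * laplacian \<gamma> \<phi> u = 2 * \<psi> u * (pderiv_at 1 ?a u + pderiv_at 2 ?b u)
      + 2 * (pderiv_at 1 \<psi> u * ?a u + pderiv_at 2 \<psi> u * ?b u)"
    unfolding laplacian_frame[OF assms(1,4)] 1 2 pderiv_at_mult[OF d2 dab(1)] pderiv_at_mult[OF d2 dab(2)]
      pderiv_at_add[OF df(6) df(6)]
    by (simp only: algebra_simps mult_2)
  also have "pderiv_at 1 \<psi> u * ?a u + pderiv_at 2 \<psi> u * ?b u = p u * r u * (v1 \<psi> u * v1 \<psi> u + v2 \<psi> u * v2 \<psi> u)"
    using pos by (simp add: v1_def v2_def field_simps)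
  also have "pderiv_at 1 ?a u + pderiv_at 2 ?b u = p u * r u * laplacian \<gamma> \<psi> u"
    by (rule laplacian_frame[OF assms(2,4), symmetric])
  also have "v1 \<psi> u * v1 \<psi> u + v2 \<psi> u * v2 \<psi> u = ip (\<gamma> u) (grad \<gamma> \<psi> u) (grad \<gamma> \<psi> u)"
    by (simp add: grad_frame ip_th th_linear th_frame assms)
  finally have "(p u * r u) * (laplacian \<gamma> \<phi> u - 2 * (\<psi> u * laplacian \<gamma> \<psi> u
      + ip (\<gamma> u) (grad \<gamma> \<psi> u) (grad \<gamma> \<psi> u))) = 0"
    by (simp add: algebra_simps)
  then show ?thesis using pos by simp
qed

lemma matrix_inv_metric:
  assumes "u \<in> U"
  shows "matrix_inv (\<gamma> u) $ 1 $ 1 = ((q u)\<^sup>2 + (r u)\<^sup>2) / (p u * r u)\<^sup>2"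
    "matrix_inv (\<gamma> u) $ 1 $ 2 = - q u / (p u * (r u)\<^sup>2)"
    "matrix_inv (\<gamma> u) $ 2 $ 1 = - q u / (p u * (r u)\<^sup>2)"
    "matrix_inv (\<gamma> u) $ 2 $ 2 = 1 / (r u)\<^sup>2"
proof -
  define B :: "real^2^2" where "B = vector [vector [((q u)\<^sup>2 + (r u)\<^sup>2) / (p u * r u)\<^sup>2, - q u / (p u * (r u)\<^sup>2)],
     vector [- q u / (p u * (r u)\<^sup>2), 1 / (r u)\<^sup>2]]"
  have "\<gamma> u ** B = mat 1"
    using p_pos[OF assms] r_pos[OF assms]
    by (simp add: vec_eq_iff forall_2 matrix_matrix_mult_def sum_2 metric_pqr assms mat_def B_def)
      (simp add: field_simps power2_eq_square)
  then have "matrix_inv (\<gamma> u) = B" by (rule matrix_inv_unique)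
  then show "matrix_inv (\<gamma> u) $ 1 $ 1 = ((q u)\<^sup>2 + (r u)\<^sup>2) / (p u * r u)\<^sup>2"
    "matrix_inv (\<gamma> u) $ 1 $ 2 = - q u / (p u * (r u)\<^sup>2)"
    "matrix_inv (\<gamma> u) $ 2 $ 1 = - q u / (p u * (r u)\<^sup>2)"
    "matrix_inv (\<gamma> u) $ 2 $ 2 = 1 / (r u)\<^sup>2" by (simp_all add: B_def)
qed

end

text \<open>
  With \<open>s = s1 + i s2\<close>, the operator is \<open>X \<mapsto> s \<cdot> cnj X\<close> in the frame, \<open>P i + i Q i\<close> is the
  covariant derivative of \<open>s\<close>, and the Codazzi equation is \<open>\<nabla>\<^sub>J\<^sub>X s = - i \<nabla>\<^sub>X s\<close>.
\<close>

locale codazzi_operator = riem_surface +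
  fixes s1 s2 :: "real^2 \<Rightarrow> real" and S :: "real^2 \<Rightarrow> real^2 \<Rightarrow> real^2"
  assumes s1_smooth: "smooth_on U s1" and s2_smooth: "smooth_on U s2"
    and codazzi: "u \<in> U \<Longrightarrow> p u * (pderiv_at 2 s1 u - 2 * om 2 u * s2 u) =
        q u * (pderiv_at 1 s1 u - 2 * om 1 u * s2 u) + r u * (pderiv_at 1 s2 u + 2 * om 1 u * s1 u)"
      "u \<in> U \<Longrightarrow> p u * (pderiv_at 2 s2 u + 2 * om 2 u * s1 u) =
        q u * (pderiv_at 1 s2 u + 2 * om 1 u * s1 u) - r u * (pderiv_at 1 s1 u - 2 * om 1 u * s2 u)"
    and operator_frame: "u \<in> U \<Longrightarrow> S u X = (s1 u * th1 u X + s2 u * th2 u X) *\<^sub>R e1 u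
        + (s2 u * th1 u X - s1 u * th2 u X) *\<^sub>R e2 u"
begin

definition P where "P i u = pderiv_at i s1 u - 2 * om i u * s2 u"
definition Q where "Q i u = pderiv_at i s2 u + 2 * om i u * s1 u"
definition n where "n u = 2 * (s1 u * s1 u + s2 u * s2 u)"

abbreviation "PQsq u \<equiv> (P 1 u)\<^sup>2 + (Q 1 u)\<^sup>2"

lemma codazzi_PQ: "u \<in> U \<Longrightarrow> p u * P 2 u = q u * P 1 u + r u * Q 1 u"
  "u \<in> U \<Longrightarrow> p u * Q 2 u = q u * Q 1 u - r u * P 1 u"
  using codazzi by (simp_all add: P_def Q_def)

lemma n_smooth: "smooth_on U n"
  unfolding n_def[abs_def] by (intro smooth_intros s1_smooth s2_smooth open_dom)

lemma endo_normsq_frame: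
  assumes "u \<in> U"
  shows "endo_normsq (S u) = n u"
proof -
  have "endo_normsq (S u) = S u (axis 1 1) $ 1 * S u (axis 1 1) $ 1
      + 2 * (S u (axis 1 1) $ 2 * S u (axis 2 1) $ 1) + S u (axis 2 1) $ 2 * S u (axis 2 1) $ 2"
    by (simp add: endo_normsq_def trace_def matrix_matrix_mult_def matrix_def sum_2)
  also have "\<dots> = n u"
    using p_pos[OF assms] r_pos[OF assms]
    by (simp add: operator_frame assms th_axis frame_components n_def) (simp add: field_simps)
  finally show ?thesis .
qed

text \<open>The factor 2 in \<open>P\<close> and \<open>Q\<close> arises because turning the frame
  by an angle changes the argument of s by twice that angle; so the covariant derivative of s is ds
  + 2 i om s.\<close>

lemma cov_endo_frame:
  assumes "u \<in> U"
  shows "cov_endo \<gamma> S u (axis i 1) Y = (P i u * th1 u Y + Q i u * th2 u Y) *\<^sub>R e1 u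
    + (Q i u * th1 u Y - P i u * th2 u Y) *\<^sub>R e2 u"
proof -
  have sth: "smooth_on U (\<lambda>v. th1 v Y)" "smooth_on U (\<lambda>v. th2 v Y)"
    unfolding th1_def th2_def by (intro smooth_intros p_smooth q_smooth r_smooth open_dom)+
  note sm = s1_smooth s2_smooth sth
  note df = sm[THEN diffU, OF assms]
  let ?a = "\<lambda>v. s1 v * th1 v Y + s2 v * th2 v Y" and ?b = "\<lambda>v. s2 v * th1 v Y - s1 v * th2 v Y"
  have sa: "smooth_on U ?a" and sb: "smooth_on U ?b" by (intro smooth_intros sm open_dom)+
  have "D i (\<lambda>v. S v Y) u = D i (\<lambda>v. ?a v *\<^sub>R e1 v + ?b v *\<^sub>R e2 v) u"
    by (rule D_cong[OF assms]) (rule operator_frame)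
  also have "\<dots> = (pderiv_at i ?a u - om i u * ?b u) *\<^sub>R e1 u + (pderiv_at i ?b u + om i u * ?a u) *\<^sub>R e2 u"
    by (rule D_frame_field[OF sa sb assms])
  finally have 1: "D i (\<lambda>v. S v Y) u = \<dots>" .
  have pa: "pderiv_at i ?a u = pderiv_at i (\<lambda>v. s1 v * th1 v Y) u + pderiv_at i (\<lambda>v. s2 v * th2 v Y) u"
    by (intro pderiv_at_add diffU[OF _ assms] smooth_intros sm open_dom)
  have pb: "pderiv_at i ?b u = pderiv_at i (\<lambda>v. s2 v * th1 v Y) u - pderiv_at i (\<lambda>v. s1 v * th2 v Y) u"
    by (intro pderiv_at_diff diffU[OF _ assms] smooth_intros sm open_dom)
  have "cov_endo \<gamma> S u (axis i 1) Y = D i (\<lambda>v. S v Y) u - S u (D i (\<lambda>_. Y) u)"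
    by (simp add: cov_endo_def cov_def covd_def)
  also have "\<dots> = (P i u * th1 u Y + Q i u * th2 u Y) *\<^sub>R e1 u
    + (Q i u * th1 u Y - P i u * th2 u Y) *\<^sub>R e2 u"
    unfolding 1 pa pb operator_frame[OF assms]
    by (rule frame_ext[OF assms])
      (simp_all add: pderiv_at_mult df pderiv_th1 pderiv_th2 assms P_def Q_def th_linear th_frame
        algebra_simps)
  finally show ?thesis .
qed

text \<open>A traceless symmetric operator with coefficient s has squared norm 2 |s|^2, and by
  Codazzi the derivatives along \<open>e1\<close> and \<open>e2\<close> have equal length; hence the
  factor 4. Division by \<open>(p u)\<^sup>2\<close> normalises the first coordinate field.\<close>

lemma normsq_cov_endo_frame:
  assumes "u \<in> U"
  shows "normsq_cov_endo \<gamma> S u = 4 * PQsq u / (p u)\<^sup>2"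
proof -
  note pos = p_pos[OF assms] r_pos[OF assms]
  let ?G = "matrix_inv (\<gamma> u)"
  let ?L = "\<lambda>i j. cov_endo \<gamma> S u (axis i 1) (axis j 1)"
  have T: "(\<Sum>j\<in>UNIV. \<Sum>l\<in>UNIV. ?G $ j $ l * ip (\<gamma> u) (?L i j) (?L k l)) =
      2 * (P i u * P k u + Q i u * Q k u)" for i k
  proof -
    \<comment> \<open>\<open>w\<close> and \<open>z\<close> are the real and imaginary part of cnj
      (P i + i Q i) (P k + i Q k); the \<open>z\<close> terms cancel since the inverse metric is
      symmetric.\<close>
    define w where "w = P i u * P k u + Q i u * Q k u"
    define z where "z = P i u * Q k u - Q i u * P k u"
    have ip: "ip (\<gamma> u) (?L i 1) (?L k 1) = (p u)\<^sup>2 * w"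
      "ip (\<gamma> u) (?L i 1) (?L k 2) = p u * q u * w + p u * r u * z"
      "ip (\<gamma> u) (?L i 2) (?L k 1) = p u * q u * w - p u * r u * z"
      "ip (\<gamma> u) (?L i 2) (?L k 2) = ((q u)\<^sup>2 + (r u)\<^sup>2) * w"
      by (simp_all add: ip_th cov_endo_frame th_linear th_frame th_axis assms w_def z_def
          power2_eq_square algebra_simps)
    show ?thesis
      unfolding sum_2 ip matrix_inv_metric[OF assms] w_def[symmetric]
      using pos by (simp add: field_simps power2_eq_square)
  qed
  have "normsq_cov_endo \<gamma> S u = (\<Sum>i\<in>UNIV. \<Sum>k\<in>UNIV. ?G $ i $ k *
      (\<Sum>j\<in>UNIV. \<Sum>l\<in>UNIV. ?G $ j $ l * ip (\<gamma> u) (?L i j) (?L k l)))"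
    unfolding normsq_cov_endo_def by (simp add: sum_2 algebra_simps)
  also have "\<dots> = 2 * (?G $ 1 $ 1 * (P 1 u * P 1 u + Q 1 u * Q 1 u)
      + 2 * ?G $ 1 $ 2 * (P 1 u * P 2 u + Q 1 u * Q 2 u) + ?G $ 2 $ 2 * (P 2 u * P 2 u + Q 2 u * Q 2 u))"
    unfolding T by (simp add: sum_2 matrix_inv_metric assms algebra_simps add_divide_distrib)
  also have "\<dots> = 4 * PQsq u / (p u)\<^sup>2"
  proof -
    have "P 2 u = (q u * P 1 u + r u * Q 1 u) / p u" "Q 2 u = (q u * Q 1 u - r u * P 1 u) / p u"
      using codazzi_PQ[OF assms] pos by (simp_all add: field_simps)
    then show ?thesis
      using pos by (simp add: matrix_inv_metric assms) (simp add: field_simps power2_eq_square)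
  qed
  finally show ?thesis .
qed

lemma pderiv_n:
  assumes "u \<in> U"
  shows "pderiv_at i n u = 4 * (s1 u * P i u + s2 u * Q i u)"
proof -
  note sm = s1_smooth s2_smooth
  note df = sm[THEN diffU, OF assms]
  have "pderiv_at i n u = pderiv_at i (\<lambda>u. 2 * (s1 u * s1 u + s2 u * s2 u)) u"
    by (simp add: n_def[abs_def])
  also have "\<dots> = 2 * pderiv_at i (\<lambda>u. s1 u * s1 u + s2 u * s2 u) u"
    by (rule pderiv_at_bounded_linear[OF bounded_linear_mult_right])
      (intro diffU[OF _ assms] smooth_intros sm open_dom)
  also have "pderiv_at i (\<lambda>u. s1 u * s1 u + s2 u * s2 u) u =
      pderiv_at i (\<lambda>u. s1 u * s1 u) u + pderiv_at i (\<lambda>u. s2 u * s2 u) u"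
    by (intro pderiv_at_add diffU[OF _ assms] smooth_intros sm open_dom)
  finally show ?thesis by (simp add: pderiv_at_mult df P_def Q_def algebra_simps)
qed

text \<open>On the left are the coefficients that \<open>laplacian_frame\<close> differentiates, on
  the right, up to sign, those of 4 Im (cnj s \<nabla>s); Codazzi trades derivatives along one frame
  vector for those along the other.\<close>

lemma v_n:
  assumes "u \<in> U"
  shows "p u * v2 n u = 4 * (s1 u * Q 1 u - s2 u * P 1 u)"
    "r u * v1 n u - q u * v2 n u = - 4 * (s1 u * Q 2 u - s2 u * P 2 u)"
proof -
  note pos = p_pos[OF assms] r_pos[OF assms]
  have PQ: "P 2 u = (q u * P 1 u + r u * Q 1 u) / p u" "Q 2 u = (q u * Q 1 u - r u * P 1 u) / p u"
    using codazzi_PQ[OF assms] pos by (simp_all add: field_simps)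
  show "p u * v2 n u = 4 * (s1 u * Q 1 u - s2 u * P 1 u)"
    using pos by (simp add: v2_def pderiv_n assms PQ) (simp add: field_simps)
  show "r u * v1 n u - q u * v2 n u = - 4 * (s1 u * Q 2 u - s2 u * P 2 u)"
    using pos by (simp add: v1_def v2_def pderiv_n assms PQ) (simp add: field_simps)
qed

text \<open>Im (cnj s \<nabla>s) is Im (cnj s ds) plus |S|^2 times the connection form. The second
  derivatives are isolated, ready to cancel on antisymmetrising in \<open>i\<close> and
  \<open>j\<close>.\<close>

lemma pderiv_wedge:
  assumes "u \<in> U"
  shows "pderiv_at j (\<lambda>u. s1 u * Q i u - s2 u * P i u) u =
    pderiv_at j s1 u * pderiv_at i s2 u - pderiv_at j s2 u * pderiv_at i s1 u
    + s1 u * pderiv_at j (pderiv_at i s2) u - s2 u * pderiv_at j (pderiv_at i s1) u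
    + pderiv_at j (om i) u * n u + om i u * pderiv_at j n u"
proof -
  note sm = s1_smooth s2_smooth s1_smooth[THEN smooth_on_pderiv, of i]
    s2_smooth[THEN smooth_on_pderiv, of i] om_smooth[of i] n_smooth
  note df = sm[THEN diffU, OF assms]
  have "(\<lambda>u. s1 u * Q i u - s2 u * P i u) =
      (\<lambda>u. (s1 u * pderiv_at i s2 u - s2 u * pderiv_at i s1 u) + om i u * n u)"
    by (simp add: P_def Q_def n_def fun_eq_iff algebra_simps)
  moreover have "pderiv_at j (\<lambda>u. (s1 u * pderiv_at i s2 u - s2 u * pderiv_at i s1 u) + om i u * n u) u =
      pderiv_at j (\<lambda>u. s1 u * pderiv_at i s2 u - s2 u * pderiv_at i s1 u) u + pderiv_at j (\<lambda>u. om i u * n u) u"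
    by (intro pderiv_at_add diffU[OF _ assms] smooth_intros sm open_dom)
  moreover have "pderiv_at j (\<lambda>u. s1 u * pderiv_at i s2 u - s2 u * pderiv_at i s1 u) u =
      pderiv_at j (\<lambda>u. s1 u * pderiv_at i s2 u) u - pderiv_at j (\<lambda>u. s2 u * pderiv_at i s1 u) u"
    by (intro pderiv_at_diff diffU[OF _ assms] smooth_intros sm open_dom)
  ultimately show ?thesis by (simp add: pderiv_at_mult df)
qed

lemma simons:
  assumes "u \<in> U"
  shows "1/2 * laplacian \<gamma> n u = 4 * PQsq u / (p u)\<^sup>2 + 2 * gauss_curvature \<gamma> u * n u"
proof -
  note pos = p_pos[OF assms] r_pos[OF assms]
  let ?B = "\<lambda>i u. s1 u * Q i u - s2 u * P i u"
  have sB: "smooth_on U (?B i)" for i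
    unfolding P_def[abs_def] Q_def[abs_def]
    by (intro smooth_intros s1_smooth s2_smooth om_smooth open_dom)
  have 1: "pderiv_at 1 (\<lambda>u. r u * v1 n u - q u * v2 n u) u = - 4 * pderiv_at 1 (?B 2) u"
  proof -
    have "pderiv_at 1 (\<lambda>u. r u * v1 n u - q u * v2 n u) u = pderiv_at 1 (\<lambda>u. - 4 * ?B 2 u) u"
      by (rule pderiv_at_cong[OF open_dom assms]) (rule v_n(2))
    also have "\<dots> = - 4 * pderiv_at 1 (?B 2) u"
      by (rule pderiv_at_bounded_linear[OF bounded_linear_mult_right diffU[OF sB assms]])
    finally show ?thesis .
  qed
  have 2: "pderiv_at 2 (\<lambda>u. p u * v2 n u) u = 4 * pderiv_at 2 (?B 1) u"
  proof -
    have "pderiv_at 2 (\<lambda>u. p u * v2 n u) u = pderiv_at 2 (\<lambda>u. 4 * ?B 1 u) u"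
      by (rule pderiv_at_cong[OF open_dom assms]) (rule v_n(1))
    also have "\<dots> = 4 * pderiv_at 2 (?B 1) u"
      by (rule pderiv_at_bounded_linear[OF bounded_linear_mult_right diffU[OF sB assms]])
    finally show ?thesis .
  qed
  have c: "pderiv_at 1 (pderiv_at 2 s1) u = pderiv_at 2 (pderiv_at 1 s1) u"
    "pderiv_at 1 (pderiv_at 2 s2) u = pderiv_at 2 (pderiv_at 1 s2) u"
    by (rule pderiv_commute_real[OF _ open_dom assms], rule s1_smooth s2_smooth)+
  \<comment> \<open>The Gauss curvature enters here, as the exterior derivative of the connection
    form.\<close>
  have om: "pderiv_at 2 (om 1) u = pderiv_at 1 (om 2) u + gauss_curvature \<gamma> u * p u * r u"
    using pderiv_om[OF assms] by simp
  have "p u * r u * laplacian \<gamma> n u = 4 * (pderiv_at 2 (?B 1) u - pderiv_at 1 (?B 2) u)"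
    unfolding laplacian_frame[OF n_smooth assms] 1 2 by simp
  also have "pderiv_at 2 (?B 1) u - pderiv_at 1 (?B 2) u =
      2 * (P 2 u * Q 1 u - P 1 u * Q 2 u) + gauss_curvature \<gamma> u * p u * r u * n u"
    unfolding pderiv_wedge[OF assms] om c pderiv_n[OF assms]
    by (simp add: P_def Q_def n_def algebra_simps)
  \<comment> \<open>By Codazzi the derivatives of s along the two frame vectors differ by a quarter
    turn, so their cross product is the squared length of one of them.\<close>
  also have "P 2 u * Q 1 u - P 1 u * Q 2 u = r u * PQsq u / p u"
  proof -
    have PQ: "P 2 u = (q u * P 1 u + r u * Q 1 u) / p u" "Q 2 u = (q u * Q 1 u - r u * P 1 u) / p u"
      using codazzi_PQ[OF assms] pos by (simp_all add: field_simps)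
    show ?thesis unfolding PQ using pos by (simp add: field_simps power2_eq_square)
  qed
  finally have "laplacian \<gamma> n u = 4 * (2 * (r u * PQsq u / p u)
      + gauss_curvature \<gamma> u * p u * r u * n u) / (p u * r u)"
    using pos by (simp add: field_simps)
  note L = this
  show ?thesis unfolding L using pos by (simp add: field_simps power2_eq_square)
qed

text \<open>The sharp Kato equality: both right sides are half of |\<nabla>S|^2, compare
  \<open>normsq_cov_endo_frame\<close>. Up to common factors, the derivatives of |S|^2 along the two
  frame vectors are the real and imaginary part of cnj s (P 1 + i Q 1).\<close>

lemma grad_norm:
  assumes "\<And>v. v \<in> U \<Longrightarrow> n v > 0" "u \<in> U"
  shows "ip (\<gamma> u) (grad \<gamma> (\<lambda>v. sqrt (n v)) u) (grad \<gamma> (\<lambda>v. sqrt (n v)) u) =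
      2 * PQsq u / (p u)\<^sup>2"
    "sqrt (n u) * laplacian \<gamma> (\<lambda>v. sqrt (n v)) u - 2 * gauss_curvature \<gamma> u * n u =
      2 * PQsq u / (p u)\<^sup>2"
proof -
  note pos = p_pos[OF assms(2)] r_pos[OF assms(2)]
  let ?\<psi> = "\<lambda>v. sqrt (n v)"
  have s\<psi>: "smooth_on U ?\<psi>" by (intro smooth_on_sqrt n_smooth assms open_dom)
  have sq: "n v = ?\<psi> v * ?\<psi> v" if "v \<in> U" for v using assms(1)[OF that] by simp
  have pd: "pderiv_at i n u = 2 * ?\<psi> u * pderiv_at i ?\<psi> u" for i
  proof -
    have "pderiv_at i n u = pderiv_at i (\<lambda>v. ?\<psi> v * ?\<psi> v) u"
      by (rule pderiv_at_cong[OF open_dom assms(2)]) (rule sq)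
    also have "\<dots> = ?\<psi> u * pderiv_at i ?\<psi> u + pderiv_at i ?\<psi> u * ?\<psi> u"
      by (rule pderiv_at_mult[OF diffU[OF s\<psi> assms(2)] diffU[OF s\<psi> assms(2)]])
    finally show ?thesis by simp
  qed
  have v: "v1 n u = 2 * ?\<psi> u * v1 ?\<psi> u" "v2 n u = 2 * ?\<psi> u * v2 ?\<psi> u"
    by (simp_all add: v1_def v2_def pd algebra_simps diff_divide_distrib)
  let ?G = "ip (\<gamma> u) (grad \<gamma> ?\<psi> u) (grad \<gamma> ?\<psi> u)"
  have "?G = v1 ?\<psi> u * v1 ?\<psi> u + v2 ?\<psi> u * v2 ?\<psi> u"
    by (simp add: grad_frame ip_th th_linear th_frame assms)
  then have "4 * n u * ?G = v1 n u * v1 n u + v2 n u * v2 n u"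
    unfolding v by (subst sq[OF assms(2)]) (simp only: algebra_simps)
  also have "\<dots> = 16 * ((s1 u * P 1 u + s2 u * Q 1 u)\<^sup>2 + (s1 u * Q 1 u - s2 u * P 1 u)\<^sup>2) / (p u)\<^sup>2"
  proof -
    have v: "v2 n u = 4 * (s1 u * Q 1 u - s2 u * P 1 u) / p u"
      using v_n(1)[OF assms(2)] pos by (simp add: field_simps)
    have v': "v1 n u = 4 * (s1 u * P 1 u + s2 u * Q 1 u) / p u"
      by (simp add: v1_def pderiv_n assms)
    show ?thesis unfolding v v' using pos by (simp add: field_simps power2_eq_square)
  qed
  \<comment> \<open>Multiplicativity of the modulus for the product of cnj s and P 1 + i Q 1;
    \<open>n\<close> is twice |s|^2.\<close>
  also have "(s1 u * P 1 u + s2 u * Q 1 u)\<^sup>2 + (s1 u * Q 1 u - s2 u * P 1 u)\<^sup>2 =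
      n u / 2 * PQsq u"
    by (simp add: n_def power2_eq_square field_simps)
  also have "16 * (n u / 2 * x) / y = n u * (8 * x / y)" for x y
    by simp
  finally have "n u * (4 * ?G) = n u * (8 * PQsq u / (p u)\<^sup>2)"
    by (simp only: mult_ac)
  then have "4 * ?G = 8 * PQsq u / (p u)\<^sup>2"
    using assms(1)[OF assms(2)] unfolding mult_cancel_left by simp
  then show G: "?G = 2 * PQsq u / (p u)\<^sup>2"
    using pos by (simp add: field_simps)
  show "?\<psi> u * laplacian \<gamma> ?\<psi> u - 2 * gauss_curvature \<gamma> u * n u = 2 * PQsq u / (p u)\<^sup>2"
  proof -
    have "1/2 * laplacian \<gamma> n u = ?\<psi> u * laplacian \<gamma> ?\<psi> u + ?G"
      by (rule laplacian_square[OF n_smooth s\<psi> _ assms(2)]) (rule sq)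
    then show ?thesis
      using simons[OF assms(2)] unfolding G by (simp add: add_divide_distrib)
  qed
qed

lemma restrict_domain:
  assumes "open W" "W \<subseteq> U"
  shows "codazzi_operator W \<gamma> s1 s2 S"
  using assms metric_smooth metric_transpose metric_posdef s1_smooth s2_smooth codazzi operator_frame
  by unfold_locales (auto intro: smooth_on_subset)

lemma simons_identities:
  assumes u: "u \<in> U"
  shows "1/2 * laplacian \<gamma> (\<lambda>v. endo_normsq (S v)) u =
      normsq_cov_endo \<gamma> S u + 2 * gauss_curvature \<gamma> u * endo_normsq (S u)"
    "sqrt (endo_normsq (S u)) \<noteq> 0 \<Longrightarrow>
      sqrt (endo_normsq (S u)) * laplacian \<gamma> (\<lambda>v. sqrt (endo_normsq (S v))) u
        - 2 * gauss_curvature \<gamma> u * endo_normsq (S u) =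
      ip (\<gamma> u) (grad \<gamma> (\<lambda>v. sqrt (endo_normsq (S v))) u) (grad \<gamma> (\<lambda>v. sqrt (endo_normsq (S v))) u)"
proof -
  have "laplacian \<gamma> (\<lambda>v. endo_normsq (S v)) u = laplacian \<gamma> n u"
    by (rule laplacian_cong[OF u]) (rule endo_normsq_frame)
  then show "1/2 * laplacian \<gamma> (\<lambda>v. endo_normsq (S v)) u =
      normsq_cov_endo \<gamma> S u + 2 * gauss_curvature \<gamma> u * endo_normsq (S u)"
    using simons[OF u] by (simp add: endo_normsq_frame[OF u] normsq_cov_endo_frame[OF u])
  assume "sqrt (endo_normsq (S u)) \<noteq> 0"
  moreover have "n v \<ge> 0" for v by (simp add: n_def)
  ultimately have nu: "n u > 0" by (simp add: endo_normsq_frame[OF u] less_le)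
  \<comment> \<open>The Laplacian of |S| needs positivity near \<open>u\<close>, not only at
    \<open>u\<close>; continuity of \<open>n\<close> makes this set open.\<close>
  define W where "W = {v \<in> U. n v > 0}"
  have oW: "open W"
  proof -
    have "W = U \<inter> n -` {0<..}" by (auto simp: W_def)
    then show ?thesis
      using continuous_open_preimage[OF smooth_on_continuous[OF n_smooth] open_dom] by simp
  qed
  interpret W: codazzi_operator W \<gamma> s1 s2 S
    by (rule restrict_domain[OF oW]) (auto simp: W_def)
  have uW: "u \<in> W" using u nu by (simp add: W_def)
  have eq: "sqrt (endo_normsq (S v)) = sqrt (n v)" if "v \<in> W" for v
    using that by (simp add: endo_normsq_frame W_def)
  have "laplacian \<gamma> (\<lambda>v. sqrt (endo_normsq (S v))) u = laplacian \<gamma> (\<lambda>v. sqrt (n v)) u"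
    by (rule W.laplacian_cong[OF uW eq])
  moreover have "grad \<gamma> (\<lambda>v. sqrt (endo_normsq (S v))) u = grad \<gamma> (\<lambda>v. sqrt (n v)) u"
    by (rule W.grad_cong[OF uW eq])
  ultimately show "sqrt (endo_normsq (S u)) * laplacian \<gamma> (\<lambda>v. sqrt (endo_normsq (S v))) u
        - 2 * gauss_curvature \<gamma> u * endo_normsq (S u) =
      ip (\<gamma> u) (grad \<gamma> (\<lambda>v. sqrt (endo_normsq (S v))) u) (grad \<gamma> (\<lambda>v. sqrt (endo_normsq (S v))) u)"
    using W.grad_norm[OF _ uW] by (simp add: endo_normsq_frame[OF u] W_def)
qed

end

section \<open>Orthonormal frames in oriented three-dimensional inner product spaces\<close>

text \<open>Orientation is left out on purpose and carried by the sign
  \<open>ip A (wedge A a b) c\<close>. Symmetry of \<open>A\<close> is included because a frame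
  gives it only through \<open>ip\<close>.\<close>

definition orthonormal3 :: "real^3^3 \<Rightarrow> real^3 \<Rightarrow> real^3 \<Rightarrow> real^3 \<Rightarrow> bool" where
  "orthonormal3 A a b c \<longleftrightarrow> transpose A = A \<and> ip A a a = 1 \<and> ip A b b = 1 \<and> ip A c c = 1 \<and>
     ip A a b = 0 \<and> ip A a c = 0 \<and> ip A b c = 0"

lemma orthonormal3_simps:
  assumes "orthonormal3 A a b c"
  shows "ip A a a = 1" "ip A b b = 1" "ip A c c = 1" "ip A a b = 0" "ip A a c = 0" "ip A b c = 0"
    "ip A b a = 0" "ip A c a = 0" "ip A c b = 0"
  using assms ip_sym[of A] unfolding orthonormal3_def by metis+

lemma orthonormal3_gram:
  assumes "orthonormal3 A a b c"
  shows "(vector [a, b, c] :: real^3^3) ** A ** transpose (vector [a, b, c]) = mat 1"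
proof -
  let ?M = "vector [a, b, c] :: real^3^3"
  have "(?M ** A ** transpose ?M) $ i $ j = ip A (?M $ i) (?M $ j)" for i j
  proof -
    have "(?M ** A ** transpose ?M) $ i $ j = (?M ** (A ** transpose ?M)) $ i $ j"
      by (simp add: matrix_mul_assoc)
    also have "\<dots> = ip A (?M $ i) (?M $ j)"
      by (simp add: ip_axis_sum matrix_matrix_mult_def transpose_def)
    finally show ?thesis .
  qed
  then have "?M ** A ** transpose ?M = (\<chi> i j. ip A (?M $ i) (?M $ j))"
    by (simp add: vec_eq_iff)
  also have "\<dots> = mat 1"
    by (simp add: vec_eq_iff forall_3 mat_def orthonormal3_simps[OF assms])
  finally show ?thesis .
qed

lemma orthonormal3_det:
  assumes "orthonormal3 A a b c"
  shows "det (vector [a, b, c] :: real^3^3) * det (vector [a, b, c] :: real^3^3) * det A = 1"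
  using arg_cong[OF orthonormal3_gram[OF assms], of det]
  by (simp add: det_mul mult_ac)

text \<open>By the Gram identity the determinant is the reciprocal of a square.\<close>

lemma orthonormal3_det_pos:
  assumes "orthonormal3 A a b c"
  shows "det A > 0"
  using orthonormal3_det[OF assms]
  by (metis not_square_less_zero zero_less_mult_iff zero_less_one)

text \<open>The defect \<open>Y\<close> is orthogonal to the three vectors, and the matrix
  expressing this is invertible by \<open>orthonormal3_det\<close>.\<close>

lemma orthonormal3_expansion:
  assumes "orthonormal3 A a b c"
  shows "X = ip A a X *\<^sub>R a + ip A b X *\<^sub>R b + ip A c X *\<^sub>R c"
proof -
  let ?M = "vector [a, b, c] :: real^3^3"
  define Y where "Y = X - (ip A a X *\<^sub>R a + ip A b X *\<^sub>R b + ip A c X *\<^sub>R c)"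
  have "ip A a Y = 0" "ip A b Y = 0" "ip A c Y = 0"
    by (simp_all add: Y_def ip_linear orthonormal3_simps[OF assms])
  then have "?M *v (A *v Y) = 0"
    by (simp add: vec_eq_iff forall_3 matrix_vector_mul_component ip_def)
  then have "(?M ** A) *v Y = 0" by (simp add: matrix_vector_mul_assoc)
  moreover have "det (?M ** A) \<noteq> 0"
    using orthonormal3_det[OF assms] by (auto simp: det_mul)
  ultimately have "Y = 0" using matrix_inv_vector_mult(2)[of "?M ** A" Y] by simp
  then show ?thesis by (simp add: Y_def)
qed

lemma ip_wedge:
  assumes "transpose A = A" "det A \<noteq> 0"
  shows "ip A (wedge A X Y) Z = sqrt (det A) * det (vector [X, Y, Z] :: real^3^3)"
proof -
  have "ip A (wedge A X Y) Z = ip A Z (wedge A X Y)" by (rule ip_sym[OF assms(1)])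
  also have "\<dots> = sqrt (det A) * (Z \<bullet> cross3 X Y)"
    by (simp add: wedge_def ip_scale_right) (simp add: ip_def matrix_inv_vector_mult[OF assms(2)])
  also have "Z \<bullet> cross3 X Y = det (vector [X, Y, Z] :: real^3^3)"
    by (metis cross_triple dot_cross_det inner_commute)
  finally show ?thesis .
qed

lemma orthonormal3_sign:
  assumes "orthonormal3 A a b c"
  shows "ip A (wedge A a b) c * ip A (wedge A a b) c = 1"
proof -
  have "(sqrt (det A) * d) * (sqrt (det A) * d) = d * d * det A" for d
    using orthonormal3_det_pos[OF assms] by (simp add: algebra_simps)
  moreover have "ip A (wedge A a b) c = sqrt (det A) * det (vector [a, b, c] :: real^3^3)"
    using assms orthonormal3_det_pos[OF assms] by (intro ip_wedge) (auto simp: orthonormal3_def)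
  ultimately show ?thesis using orthonormal3_det[OF assms] by (simp only:)
qed

text \<open>Multiplicativity of the determinant: the matrix of components \<open>?C\<close> splits
  off the triple product of the frame itself, which is a sign.\<close>

lemma orthonormal3_triple:
  assumes "orthonormal3 A a b c"
  shows "ip A (wedge A X Y) Z = ip A (wedge A a b) c *
    (ip A a X * (ip A b Y * ip A c Z - ip A c Y * ip A b Z)
     - ip A b X * (ip A a Y * ip A c Z - ip A c Y * ip A a Z)
     + ip A c X * (ip A a Y * ip A b Z - ip A b Y * ip A a Z))"
proof -
  let ?M = "vector [a, b, c] :: real^3^3"
  let ?C = "vector [vector [ip A a X, ip A b X, ip A c X], vector [ip A a Y, ip A b Y, ip A c Y],
    vector [ip A a Z, ip A b Z, ip A c Z]] :: real^3^3"
  have comp: "ip A a W * a $ j + ip A b W * b $ j + ip A c W * c $ j = W $ j" for W j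
    using arg_cong[OF orthonormal3_expansion[OF assms, of W], of "\<lambda>v. v $ j"] by simp
  have "vector [X, Y, Z] = ?C ** ?M"
    by (simp add: vec_eq_iff[of "vector [X, Y, Z]"] forall_3 vec_eq_iff[of "vector [X, Y, Z] $ _"]
        matrix_matrix_mult_def sum_3 comp)
  then have d: "det (vector [X, Y, Z] :: real^3^3) = det ?C * det ?M" by (simp add: det_mul)
  moreover have "transpose A = A" "det A \<noteq> 0"
    using assms orthonormal3_det_pos[OF assms] by (auto simp: orthonormal3_def)
  ultimately show ?thesis
    unfolding ip_wedge[OF \<open>transpose A = A\<close> \<open>det A \<noteq> 0\<close>] d by (simp add: det_3[of ?C] algebra_simps)
qed

section \<open>Charts of the ambient space adapted to the submersion\<close>

lemma covd_chain:
  assumes "F differentiable (at u)" "W differentiable (at (F u))"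
  shows "covd g F i (\<lambda>u. W (F u)) u =
    (\<Sum>l\<in>UNIV. pderiv_at i F u $ l *\<^sub>R covd g (\<lambda>x. x) l W (F u))"
proof -
  have "(\<Sum>l\<in>UNIV. pderiv_at i F u $ l *\<^sub>R covd g (\<lambda>x. x) l W (F u)) =
      cov_along g (\<lambda>x. x) W (F u) (pderiv_at i F u)"
    by (rule cov_along_covd[symmetric]) (simp_all add: assms)
  also have "\<dots> = covd g F i (\<lambda>u. W (F u)) u"
    by (simp add: covd_eq cov_along_def pderiv_at_compose assms Gam_def)
  finally show ?thesis ..
qed

text \<open>The submersion in one chart of each space, with \<open>pr\<close> as its coordinate
  expression and \<open>V\<close> lying over \<open>B\<close>. Verticality of \<open>xi\<close> is
  assumed here; \<open>projection_vertical\<close> supplies it from the fibres.\<close>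

locale submersion_chart =
  total: riem_along V V g "\<lambda>x. x" + base: riem_surface B h
  for V :: "(real^3) set" and g :: "real^3 \<Rightarrow> real^3^3"
    and B :: "(real^2) set" and h :: "real^2 \<Rightarrow> real^2^2" +
  fixes pr :: "real^3 \<Rightarrow> real^2" and xi :: "real^3 \<Rightarrow> real^3" and \<kappa> \<tau> :: real
  assumes pr_smooth: "smooth_on V pr" and pr_maps: "x \<in> V \<Longrightarrow> pr x \<in> B"
    and xi_smooth: "smooth_on V xi"
    and xi_unit: "x \<in> V \<Longrightarrow> ip (g x) (xi x) (xi x) = 1"
    and xi_cov: "x \<in> V \<Longrightarrow> cov g xi x X = \<tau> *\<^sub>R wedge (g x) X (xi x)"
    and pr_xi: "x \<in> V \<Longrightarrow> frechet_derivative pr (at x) (xi x) = 0"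
    and pr_surj: "x \<in> V \<Longrightarrow> surj (frechet_derivative pr (at x))"
    and pr_horizontal: "x \<in> V \<Longrightarrow>
      (\<And>W. frechet_derivative pr (at x) W = 0 \<Longrightarrow> ip (g x) X W = 0) \<Longrightarrow>
      ip (h (pr x)) (frechet_derivative pr (at x) X) (frechet_derivative pr (at x) X) = ip (g x) X X"
    and base_curvature: "y \<in> B \<Longrightarrow> gauss_curvature h y = \<kappa>"
begin

abbreviation dpr where "dpr x \<equiv> frechet_derivative pr (at x)"

text \<open>The pulled back base coframe \<open>t1\<close>, \<open>t2\<close> together with \<open>eta\<close> is orthonormal.\<close>

definition t1 where "t1 x X = base.th1 (pr x) (dpr x X)"
definition t2 where "t2 x X = base.th2 (pr x) (dpr x X)"
definition eta where "eta x X = ip (g x) (xi x) X"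

lemma pr_diff: "x \<in> V \<Longrightarrow> pr differentiable (at x)"
  by (rule smooth_on_differentiable[OF pr_smooth])

lemma dpr_linear: "x \<in> V \<Longrightarrow> linear (dpr x)"
  by (rule linear_frechet_derivative[OF pr_diff])

lemma t_linear:
  assumes "x \<in> V"
  shows "t1 x (X + Y) = t1 x X + t1 x Y" "t2 x (X + Y) = t2 x X + t2 x Y"
    "t1 x (c *\<^sub>R X) = c * t1 x X" "t2 x (c *\<^sub>R X) = c * t2 x X"
  by (simp_all add: t1_def t2_def linear_add[OF dpr_linear[OF assms]]
      linear_scale[OF dpr_linear[OF assms]] base.th_linear)

lemma t_xi: "x \<in> V \<Longrightarrow> t1 x (xi x) = 0" "x \<in> V \<Longrightarrow> t2 x (xi x) = 0"
  by (simp_all add: t1_def t2_def pr_xi base.th1_def base.th2_def)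

lemma eta_linear: "eta x (X + Y) = eta x X + eta x Y" "eta x (c *\<^sub>R X) = c * eta x X"
  by (simp_all add: eta_def ip_linear)

lemma dpr_kernel:
  assumes "x \<in> V" "dpr x W = 0"
  shows "\<exists>c. W = c *\<^sub>R xi x"
proof -
  note lin = dpr_linear[OF assms(1)]
  obtain a b where ab: "dpr x a = axis 1 1" "dpr x b = axis 2 1"
    using surjD[OF pr_surj[OF assms(1)], of "axis 1 1"] surjD[OF pr_surj[OF assms(1)], of "axis 2 1"]
    by auto
  \<comment> \<open>Preimages of the two axes together with \<open>xi x\<close> span the space:
    \<open>L\<close> is injective, hence surjective, and a kernel vector has no component along
    \<open>a\<close> or \<open>b\<close>.\<close>
  define L where "L v = v $ 1 *\<^sub>R a + v $ 2 *\<^sub>R b + v $ 3 *\<^sub>R xi x" for v :: "real^3"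
  have dL: "dpr x (L v) = v $ 1 *\<^sub>R axis 1 1 + v $ 2 *\<^sub>R axis 2 1" for v
    by (simp add: L_def linear_add[OF lin] linear_scale[OF lin] ab pr_xi assms(1))
  have lL: "linear L" by (rule linearI) (simp_all add: L_def algebra_simps)
  have xi0: "xi x \<noteq> 0" using xi_unit[OF assms(1)] by auto
  have "v = 0" if "L v = 0" for v
  proof -
    have "v $ 1 *\<^sub>R axis 1 1 + v $ 2 *\<^sub>R axis 2 1 = (0::real^2)"
      using dL[of v] that linear_0[OF lin] by simp
    then have "v $ 1 = 0" "v $ 2 = 0" by (simp_all add: vec_eq_iff forall_2)
    with that xi0 show ?thesis by (simp add: L_def vec_eq_iff[of v] forall_3)
  qed
  then have "inj L" using lL by (simp add: linear_injective_0)
  then have "surj L" using lL linear_injective_imp_surjective by blast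
  then obtain v where v: "W = L v" by (metis surj_def)
  then have "v $ 1 *\<^sub>R axis 1 1 + v $ 2 *\<^sub>R axis 2 1 = (0::real^2)" using dL[of v] assms(2) by simp
  then have "v $ 1 = 0" "v $ 2 = 0" by (simp_all add: vec_eq_iff forall_2)
  then show ?thesis using v by (auto simp: L_def)
qed

text \<open>Removing the \<open>xi\<close> component leaves a vector orthogonal to the kernel, which
  is spanned by \<open>xi\<close> according to \<open>dpr_kernel\<close>; on such vectors the
  submersion is isometric.\<close>

lemma metric_split_quadratic:
  assumes "x \<in> V"
  shows "ip (g x) X X = t1 x X * t1 x X + t2 x X * t2 x X + eta x X * eta x X"
proof -
  define Y where "Y = X + (- eta x X) *\<^sub>R xi x"
  have "ip (g x) Y W = 0" if W: "dpr x W = 0" for W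
  proof -
    obtain c where "W = c *\<^sub>R xi x" using dpr_kernel[OF assms W] by blast
    then show ?thesis
      using total.g_sym[OF assms, of X "xi x"]
      by (simp add: Y_def ip_linear eta_def xi_unit assms)
  qed
  then have "ip (h (pr x)) (dpr x Y) (dpr x Y) = ip (g x) Y Y" by (rule pr_horizontal[OF assms])
  moreover have "dpr x Y = dpr x X"
    using linear_diff[OF dpr_linear[OF assms], of X "eta x X *\<^sub>R xi x"]
    by (simp add: Y_def linear_scale[OF dpr_linear[OF assms]] pr_xi assms)
  ultimately have "ip (g x) Y Y = t1 x X * t1 x X + t2 x X * t2 x X"
    by (simp add: t1_def t2_def base.ip_th[OF pr_maps[OF assms]])
  moreover have "ip (g x) Y Y = ip (g x) X X - eta x X * eta x X"
    using total.g_sym[OF assms, of X "xi x"]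
    by (simp add: Y_def ip_linear eta_def xi_unit assms)
  ultimately show ?thesis by simp
qed

lemma metric_split:
  assumes "x \<in> V"
  shows "ip (g x) X Y = t1 x X * t1 x Y + t2 x X * t2 x Y + eta x X * eta x Y"
  using metric_split_quadratic[OF assms, of "X + Y"] metric_split_quadratic[OF assms, of X]
    metric_split_quadratic[OF assms, of Y] total.g_sym[OF assms, of X Y]
  by (simp add: t_linear[OF assms] eta_linear ip_linear algebra_simps)

text \<open>Horizontal lifts of the base frame, obtained by raising the index of the pulled-back
  coframe. This formula shows smoothness; lifting by surjectivity of \<open>dpr\<close> would
  not.\<close>

definition E1 where "E1 x = matrix_inv (g x) *v (\<chi> j. base.th1 (pr x) (pderiv_at j pr x))"
definition E2 where "E2 x = matrix_inv (g x) *v (\<chi> j. base.th2 (pr x) (pderiv_at j pr x))"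

lemma pr_comp_smooth: "smooth_on B f \<Longrightarrow> smooth_on V (\<lambda>x. f (pr x))"
  using smooth_on_compose[OF total.open_U pr_smooth] pr_maps by blast

lemma E_smooth: "smooth_on V E1" "smooth_on V E2"
proof -
  note sm = smooth_on_matrix_inv pr_comp_smooth[OF base.p_smooth] pr_comp_smooth[OF base.q_smooth]
    pr_comp_smooth[OF base.r_smooth] pr_smooth total.open_U total.g_smooth total.g_det
  show "smooth_on V E1" unfolding E1_def[abs_def] base.th1_def by (intro smooth_intros sm)
  show "smooth_on V E2" unfolding E2_def[abs_def] base.th2_def by (intro smooth_intros sm)
qed

lemma t_axis: "t1 x (axis j 1) = base.th1 (pr x) (pderiv_at j pr x)"
  "t2 x (axis j 1) = base.th2 (pr x) (pderiv_at j pr x)"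
  by (simp_all add: t1_def t2_def pderiv_at_def)

lemma t_linear_functional:
  assumes "x \<in> V"
  shows "linear (t1 x)" "linear (t2 x)"
  by (rule linearI; simp add: t_linear[OF assms])+

lemma ip_E:
  assumes "x \<in> V"
  shows "ip (g x) X (E1 x) = t1 x X" "ip (g x) X (E2 x) = t2 x X"
    "ip (g x) (E1 x) X = t1 x X" "ip (g x) (E2 x) X = t2 x X"
proof -
  show 1: "ip (g x) X (E1 x) = t1 x X" for X
    using linear_axis_expansion[OF t_linear_functional(1)[OF assms], of X]
    by (simp add: ip_def E1_def matrix_inv_vector_mult(1)[OF total.g_det[OF assms]] inner_vec_def t_axis)
  show 2: "ip (g x) X (E2 x) = t2 x X" for X
    using linear_axis_expansion[OF t_linear_functional(2)[OF assms], of X]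
    by (simp add: ip_def E2_def matrix_inv_vector_mult(1)[OF total.g_det[OF assms]] inner_vec_def t_axis)
  show "ip (g x) (E1 x) X = t1 x X" "ip (g x) (E2 x) X = t2 x X"
    using 1 2 total.g_sym[OF assms] by metis+
qed

lemma ip_xi: "ip (g x) (xi x) X = eta x X"
  by (simp add: eta_def)

lemma ip_xi': "x \<in> V \<Longrightarrow> ip (g x) X (xi x) = eta x X"
  using total.g_sym by (simp add: eta_def)

lemma t_surj:
  assumes "x \<in> V"
  shows "\<exists>X. t1 x X = a \<and> t2 x X = b"
proof -
  obtain X where "dpr x X = a *\<^sub>R base.e1 (pr x) + b *\<^sub>R base.e2 (pr x)"
    using surjD[OF pr_surj[OF assms], of "a *\<^sub>R base.e1 (pr x) + b *\<^sub>R base.e2 (pr x)"] by auto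
  then show ?thesis
    by (auto intro!: exI[of _ X] simp: t1_def t2_def base.th_linear base.th_frame[OF pr_maps[OF assms]])
qed

lemma t_E:
  assumes "x \<in> V"
  shows "t1 x (E1 x) = 1" "t2 x (E1 x) = 0" "t1 x (E2 x) = 0" "t2 x (E2 x) = 1"
    "eta x (E1 x) = 0" "eta x (E2 x) = 0"
proof -
  show e: "eta x (E1 x) = 0" "eta x (E2 x) = 0"
    by (simp_all add: eta_def ip_E[OF assms] t_xi[OF assms])
  \<comment> \<open>Test vectors with prescribed base components turn \<open>ip_E\<close> and
    \<open>metric_split\<close> into equations for the components of \<open>E1\<close> and
    \<open>E2\<close>.\<close>
  obtain X Y where X: "t1 x X = 1" "t2 x X = 0" and Y: "t1 x Y = 0" "t2 x Y = 1"
    using t_surj[OF assms] by metis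
  show "t1 x (E1 x) = 1" "t2 x (E1 x) = 0"
    using metric_split[OF assms, of "E1 x" X] metric_split[OF assms, of "E1 x" Y]
    by (simp_all add: e X Y ip_E[OF assms])
  show "t1 x (E2 x) = 0" "t2 x (E2 x) = 1"
    using metric_split[OF assms, of "E2 x" X] metric_split[OF assms, of "E2 x" Y]
    by (simp_all add: e X Y ip_E[OF assms])
qed

lemma frame3: "x \<in> V \<Longrightarrow> orthonormal3 (g x) (E1 x) (E2 x) (xi x)"
  by (simp add: orthonormal3_def total.g_transpose ip_E t_E xi_unit t_xi)

lemma g_det_pos: "x \<in> V \<Longrightarrow> det (g x) > 0"
  by (rule orthonormal3_det_pos[OF frame3])

text \<open>
  The base chart need not be compatible with the orientation of the total space: the sign \<open>sg\<close>
  of the frame can be \<open>-1\<close>.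
\<close>

definition sg where "sg x = ip (g x) (wedge (g x) (E1 x) (E2 x)) (xi x)"

lemma sg_sq: "x \<in> V \<Longrightarrow> sg x * sg x = 1"
  unfolding sg_def by (rule orthonormal3_sign[OF frame3])

lemma sg_smooth: "smooth_on V sg"
  unfolding sg_def[abs_def] wedge_def
  by (intro smooth_on_ip smooth_on_scaleR smooth_on_sqrt smooth_on_matrix_vector_mult
      smooth_on_matrix_inv smooth_on_cross3 smooth_on_det E_smooth xi_smooth total.open_U
      total.g_smooth total.g_det g_det_pos)

lemma triple:
  assumes "x \<in> V"
  shows "ip (g x) (wedge (g x) X Y) Z = sg x * (t1 x X * (t2 x Y * eta x Z - eta x Y * t2 x Z)
     - t2 x X * (t1 x Y * eta x Z - eta x Y * t1 x Z) + eta x X * (t1 x Y * t2 x Z - t2 x Y * t1 x Z))"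
  using orthonormal3_triple[OF frame3[OF assms], of X Y Z] by (simp add: ip_E assms ip_xi sg_def)

lemma frame_expansion3: "x \<in> V \<Longrightarrow> X = t1 x X *\<^sub>R E1 x + t2 x X *\<^sub>R E2 x + eta x X *\<^sub>R xi x"
  using orthonormal3_expansion[OF frame3, of x X] by (simp add: ip_E ip_xi)

section \<open>The connection in the adapted frame\<close>

abbreviation "cv \<equiv> covd g (\<lambda>x::real^3. x)"

lemma cv_xi:
  assumes "x \<in> V"
  shows "ip (g x) (cv i xi x) Z = \<tau> * sg x *
    (t2 x (axis i 1) * t1 x Z - t1 x (axis i 1) * t2 x Z)"
proof -
  have "cv i xi x = \<tau> *\<^sub>R wedge (g x) (axis i 1) (xi x)"
    using xi_cov[OF assms] by (simp add: covd_def cov_def)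
  then show ?thesis
    by (simp add: ip_linear triple assms t_xi ip_xi[symmetric] xi_unit)
qed

lemma cv_orthonormal:
  assumes "x \<in> V" "smooth_on V W" "smooth_on V Z" "\<And>y. y \<in> V \<Longrightarrow> ip (g y) (W y) (Z y) = c"
  shows "ip (g x) (cv i W x) (Z x) + ip (g x) (W x) (cv i Z x) = 0"
proof -
  have "pderiv_at i (\<lambda>v. ip (g v) (W v) (Z v)) x = pderiv_at i (\<lambda>v. c) x"
    using assms(4) by (intro pderiv_at_cong[OF total.open_U assms(1)])
  then show ?thesis using total.metric_compat[OF assms(2,3,1)] by simp
qed

text \<open>The horizontal connection form, the only coefficient of the frame that the equation for
  \<open>xi\<close> does not determine.\<close>

definition w where "w i x = t2 x (cv i E1 x)"

lemma cv_E_components: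
  assumes "x \<in> V"
  shows "t1 x (cv i E1 x) = 0" "t2 x (cv i E1 x) = w i x"
    "eta x (cv i E1 x) = - \<tau> * sg x * t2 x (axis i 1)"
    "t1 x (cv i E2 x) = - w i x" "t2 x (cv i E2 x) = 0"
    "eta x (cv i E2 x) = \<tau> * sg x * t1 x (axis i 1)"
  using cv_orthonormal[OF assms E_smooth(1) E_smooth(1), of 1 i]
    cv_orthonormal[OF assms E_smooth(2) E_smooth(2), of 1 i]
    cv_orthonormal[OF assms E_smooth(1) E_smooth(2), of 0 i]
    cv_orthonormal[OF assms E_smooth(1) xi_smooth, of 0 i]
    cv_orthonormal[OF assms E_smooth(2) xi_smooth, of 0 i]
    cv_xi[OF assms, of i "E1 x"] cv_xi[OF assms, of i "E2 x"]
    total.g_sym[OF assms, of "E1 x" "cv i xi x"] total.g_sym[OF assms, of "E2 x" "cv i xi x"]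
  by (simp_all add: ip_E t_E t_xi ip_xi' assms w_def)

lemma axis_torsion: "x \<in> V \<Longrightarrow> cv i (\<lambda>x. axis j 1) x = cv j (\<lambda>x. axis i 1) x"
  using total.torsion_free[of x i j] by (simp add: base.pderiv_ident_fun)

end

context submersion_chart
begin

lemma pderiv_pr_comp:
  assumes "x \<in> V" "smooth_on B f"
  shows "pderiv_at i (\<lambda>x. f (pr x)) x =
    pderiv_at i pr x $ 1 *\<^sub>R pderiv_at 1 f (pr x) + pderiv_at i pr x $ 2 *\<^sub>R pderiv_at 2 f (pr x)"
  using pderiv_at_compose[OF pr_diff[OF assms(1)] smooth_on_differentiable[OF assms(2) pr_maps[OF assms(1)]]]
  by (simp add: frechet_derivative_pderiv[OF smooth_on_differentiable[OF assms(2) pr_maps[OF assms(1)]]] sum_2)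

text \<open>Pull-back commutes with d, here for the base form a dy1 + b dy2: the second derivatives
  of \<open>pr\<close> are symmetric and cancel.\<close>

lemma exterior_derivative_pullback:
  assumes "x \<in> V" "smooth_on B a" "smooth_on B b"
  shows "pderiv_at i (\<lambda>x. a (pr x) * pderiv_at j pr x $ 1 + b (pr x) * pderiv_at j pr x $ 2) x
      - pderiv_at j (\<lambda>x. a (pr x) * pderiv_at i pr x $ 1 + b (pr x) * pderiv_at i pr x $ 2) x =
    (pderiv_at 1 b (pr x) - pderiv_at 2 a (pr x))
      * (pderiv_at i pr x $ 1 * pderiv_at j pr x $ 2 - pderiv_at i pr x $ 2 * pderiv_at j pr x $ 1)"
proof -
  note sm = pr_comp_smooth[OF assms(2)] pr_comp_smooth[OF assms(3)]
  have *: "pderiv_at i (\<lambda>x. a (pr x) * pderiv_at j pr x $ 1 + b (pr x) * pderiv_at j pr x $ 2) x =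
      a (pr x) * pderiv_at i (pderiv_at j pr) x $ 1
      + (pderiv_at i pr x $ 1 * pderiv_at 1 a (pr x) + pderiv_at i pr x $ 2 * pderiv_at 2 a (pr x)) * pderiv_at j pr x $ 1
      + (b (pr x) * pderiv_at i (pderiv_at j pr) x $ 2
      + (pderiv_at i pr x $ 1 * pderiv_at 1 b (pr x) + pderiv_at i pr x $ 2 * pderiv_at 2 b (pr x)) * pderiv_at j pr x $ 2)"
    for i j
  proof -
    have d: "pderiv_at j pr differentiable (at x)"
      by (rule smooth_on_differentiable[OF smooth_on_pderiv[OF pr_smooth] assms(1)])
    have dn: "(\<lambda>x. pderiv_at j pr x $ k) differentiable (at x)" for k
      by (rule differentiable_bounded_linear[OF bounded_linear_vec_nth d])
    note dsm = sm[THEN smooth_on_differentiable, OF assms(1)]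
    have "pderiv_at i (\<lambda>x. a (pr x) * pderiv_at j pr x $ 1 + b (pr x) * pderiv_at j pr x $ 2) x =
      pderiv_at i (\<lambda>x. a (pr x) * pderiv_at j pr x $ 1) x + pderiv_at i (\<lambda>x. b (pr x) * pderiv_at j pr x $ 2) x"
      by (intro pderiv_at_add differentiable_bounded_bilinear[OF bounded_bilinear_mult] dsm dn)
    then show ?thesis
      by (simp add: pderiv_at_mult[OF dsm(1) dn] pderiv_at_mult[OF dsm(2) dn] pderiv_at_nth[OF d]
          pderiv_pr_comp assms)
  qed
  have c: "pderiv_at i (pderiv_at j pr) x = pderiv_at j (pderiv_at i pr) x"
    by (rule pderiv_commute[OF pr_smooth total.open_U assms(1)])
  show ?thesis unfolding * c by (simp add: algebra_simps)
qed

lemma exterior_derivative_frame: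
  assumes "x \<in> V" "smooth_on V W"
  shows "pderiv_at i (\<lambda>x. ip (g x) (W x) (axis j 1)) x - pderiv_at j (\<lambda>x. ip (g x) (W x) (axis i 1)) x =
    ip (g x) (cv i W x) (axis j 1) - ip (g x) (cv j W x) (axis i 1)"
  using total.metric_compat[OF assms(2) smooth_on_const assms(1), of i "axis j 1"]
    total.metric_compat[OF assms(2) smooth_on_const assms(1), of j "axis i 1"]
    axis_torsion[OF assms(1), of i j] by simp

text \<open>
  O'Neill's formula in frames: both sides give the same torsion, and a form \<open>l\<close> with
  \<open>l \<and> t1 = l \<and> t2 = 0\<close> vanishes because \<open>t1\<close> and \<open>t2\<close> are independent.
\<close>

lemma connection_form_pullback:
  assumes x: "x \<in> V"
  shows "w i x = base.om 1 (pr x) * pderiv_at i pr x $ 1 + base.om 2 (pr x) * pderiv_at i pr x $ 2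
    - \<tau> * sg x * eta x (axis i 1)"
proof -
  define b where "b i = base.om 1 (pr x) * pderiv_at i pr x $ 1 + base.om 2 (pr x) * pderiv_at i pr x $ 2" for i
  define l where "l i = w i x + \<tau> * sg x * eta x (axis i 1) - b i" for i
  \<comment> \<open>The pull-back of the coordinate area form of the base.\<close>
  define J where "J i j = pderiv_at i pr x $ 1 * pderiv_at j pr x $ 2 - pderiv_at i pr x $ 2 * pderiv_at j pr x $ 1" for i j
  note y = pr_maps[OF x]
  have T: "t1 x (axis j 1) = base.p (pr x) * pderiv_at j pr x $ 1 + base.q (pr x) * pderiv_at j pr x $ 2"
    "t2 x (axis j 1) = base.r (pr x) * pderiv_at j pr x $ 2" for x j
    by (simp_all add: t_axis base.th1_def base.th2_def)
  have 1: "ip (g x) (cv i E1 x) (axis j 1) - ip (g x) (cv j E1 x) (axis i 1) = base.om 1 (pr x) * base.r (pr x) * J i j" for i j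
  proof -
    have "pderiv_at i (\<lambda>x. ip (g x) (E1 x) (axis j 1)) x =
        pderiv_at i (\<lambda>x. base.p (pr x) * pderiv_at j pr x $ 1 + base.q (pr x) * pderiv_at j pr x $ 2) x" for i j
      by (rule pderiv_at_cong[OF total.open_U x]) (simp add: ip_E T)
    then show ?thesis
      using exterior_derivative_frame[OF x E_smooth(1), of i j]
        exterior_derivative_pullback[OF x base.p_smooth base.q_smooth, of i j]
      by (simp add: base.structure_equations[OF y] J_def)
  qed
  have 2: "ip (g x) (cv i E2 x) (axis j 1) - ip (g x) (cv j E2 x) (axis i 1) =
      (base.om 2 (pr x) * base.p (pr x) - base.om 1 (pr x) * base.q (pr x)) * J i j" for i j
  proof -
    have "pderiv_at i (\<lambda>x. ip (g x) (E2 x) (axis j 1)) x =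
        pderiv_at i (\<lambda>x. 0 * pderiv_at j pr x $ 1 + base.r (pr x) * pderiv_at j pr x $ 2) x" for i j
      by (rule pderiv_at_cong[OF total.open_U x]) (simp add: ip_E T)
    then show ?thesis
      using exterior_derivative_frame[OF x E_smooth(2), of i j]
        exterior_derivative_pullback[OF x smooth_on_const[of B 0] base.r_smooth, of i j]
      by (simp add: base.structure_equations[OF y] J_def)
  qed
  have l2: "l i * t2 x (axis j 1) = l j * t2 x (axis i 1)" for i j
    using 1[of i j]
    by (simp add: metric_split[OF x] cv_E_components[OF x] l_def b_def J_def)
      (simp add: T algebra_simps)
  have l1: "l i * t1 x (axis j 1) = l j * t1 x (axis i 1)" for i j
    using 2[of i j]
    by (simp add: metric_split[OF x] cv_E_components[OF x] l_def b_def J_def)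
      (simp add: T algebra_simps)
  have E: "(\<Sum>j\<in>UNIV. X $ j * t1 x (axis j 1)) = t1 x X" "(\<Sum>j\<in>UNIV. X $ j * t2 x (axis j 1)) = t2 x X" for X
    using linear_axis_expansion[OF t_linear_functional(1)[OF x], of X]
      linear_axis_expansion[OF t_linear_functional(2)[OF x], of X] by simp_all
  \<comment> \<open>Contractions of l with \<open>E1\<close> and \<open>E2\<close>; they become the
    factors in l = k t1 = m t2, and evaluation on \<open>E2\<close> gives m = 0.\<close>
  define k where "k = (\<Sum>j\<in>UNIV. E1 x $ j * l j)"
  define m where "m = (\<Sum>j\<in>UNIV. E2 x $ j * l j)"
  have li: "l i = m * t2 x (axis i 1)" for i
  proof -
    have "l i = (\<Sum>j\<in>UNIV. E2 x $ j * (l i * t2 x (axis j 1)))"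
      using E(2)[of "E2 x"] by (simp add: t_E[OF x] sum_distrib_left[symmetric] mult.left_commute)
    also have "\<dots> = m * t2 x (axis i 1)" by (simp add: l2[of i] m_def sum_distrib_right mult.assoc)
    finally show ?thesis .
  qed
  have li': "l i = k * t1 x (axis i 1)" for i
  proof -
    have "l i = (\<Sum>j\<in>UNIV. E1 x $ j * (l i * t1 x (axis j 1)))"
      using E(1)[of "E1 x"] by (simp add: t_E[OF x] sum_distrib_left[symmetric] mult.left_commute)
    also have "\<dots> = k * t1 x (axis i 1)" by (simp add: l1[of i] k_def sum_distrib_right mult.assoc)
    finally show ?thesis .
  qed
  have "m = k * (\<Sum>j\<in>UNIV. E2 x $ j * t1 x (axis j 1))"
    unfolding m_def by (simp add: li' sum_distrib_left mult.left_commute)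
  then have "m = 0" by (simp add: E t_E[OF x])
  then have "l i = 0" by (simp add: li)
  then show ?thesis by (simp add: l_def b_def)
qed

end

section \<open>The ambient curvature along an immersed surface\<close>

locale submersion_surface = submersion_chart V g B h pr xi \<kappa> \<tau> + map: riem_along U V g F
  for V g B h pr xi \<kappa> \<tau> and U :: "(real^2) set" and F
begin

abbreviation "FD i u \<equiv> pderiv_at i F u"
abbreviation "D \<equiv> map.D"
abbreviation "dip \<equiv> map.dip"
abbreviation "E1F \<equiv> \<lambda>u. E1 (F u)"
abbreviation "E2F \<equiv> \<lambda>u. E2 (F u)"
abbreviation "xiF \<equiv> \<lambda>u. xi (F u)"

section \<open>The adapted frame and coframe along the immersion\<close>

definition x1 where "x1 i u = dip u (FD i u) (E1 (F u))"
definition x2 where "x2 i u = dip u (FD i u) (E2 (F u))"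
definition x3 where "x3 i u = dip u (FD i u) (xi (F u))"
text \<open>A signed \<tau>: the sign of the frame is smooth with square 1, so \<open>c\<close>
  differentiates like a constant, and only its square survives in the curvature.\<close>

definition c where "c u = \<tau> * sg (F u)"
definition wF where "wF i u = dip u (D i E1F u) (E2 (F u))"

lemma x_eq:
  assumes "u \<in> U"
  shows "x1 i u = t1 (F u) (FD i u)" "x2 i u = t2 (F u) (FD i u)" "x3 i u = eta (F u) (FD i u)"
  using map.F_maps[OF assms] by (simp_all add: x1_def x2_def x3_def ip_E ip_xi')

lemma F_comp_smooth: "smooth_on V W \<Longrightarrow> smooth_on U (\<lambda>u. W (F u))"
  using smooth_on_compose[OF map.open_U map.F_smooth] map.F_maps by blast

lemma EF_smooth: "smooth_on U E1F" "smooth_on U E2F" "smooth_on U xiF"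
  by (intro F_comp_smooth E_smooth xi_smooth)+

lemma FD_smooth: "smooth_on U (pderiv_at i F)"
  by (rule smooth_on_pderiv[OF map.F_smooth])

lemma scalars_smooth: "smooth_on U (x1 i)" "smooth_on U (x2 i)" "smooth_on U (x3 i)" "smooth_on U c"
  "smooth_on U (wF i)"
  unfolding x1_def[abs_def] x2_def[abs_def] x3_def[abs_def] c_def[abs_def] wF_def[abs_def]
  by (intro smooth_on_ip smooth_on_mult smooth_on_const map.gF_smooth FD_smooth EF_smooth map.D_smooth
      map.open_U F_comp_smooth sg_smooth)+

lemma chain:
  assumes "u \<in> U" "smooth_on V W"
  shows "D i (\<lambda>u. W (F u)) u = (\<Sum>l\<in>UNIV. FD i u $ l *\<^sub>R cv l W (F u))"
  using assms map.F_maps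
  by (intro covd_chain) (auto intro: smooth_on_differentiable map.F_smooth)

text \<open>Linearity in the direction and in the value carries an identity from the ambient
  coordinate directions to \<open>FD i u\<close>.\<close>

lemma linear_functional_chain:
  assumes "u \<in> U" "smooth_on V W" "linear f" "\<And>l. f (cv l W (F u)) = L (axis l 1)" "linear L"
  shows "f (D i (\<lambda>u. W (F u)) u) = L (FD i u)"
  using linear_axis_expansion[OF assms(5), of "FD i u"]
  by (simp add: chain[OF assms(1,2)] linear_sum[OF assms(3)] linear_scale[OF assms(3)] assms(4))

lemma eta_functional: "linear (eta x)"
  by (rule linearI) (simp_all add: eta_linear)

lemma D_frame_components:
  assumes u: "u \<in> U"
  shows "t1 (F u) (D i E1F u) = 0" "t2 (F u) (D i E1F u) = wF i u"
    "eta (F u) (D i E1F u) = - c u * x2 i u"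
    "t1 (F u) (D i E2F u) = - wF i u" "t2 (F u) (D i E2F u) = 0"
    "eta (F u) (D i E2F u) = c u * x1 i u"
    "t1 (F u) (D i xiF u) = c u * x2 i u" "t2 (F u) (D i xiF u) = - c u * x1 i u"
    "eta (F u) (D i xiF u) = 0"
proof -
  note x = map.F_maps[OF u]
  note lt = t_linear_functional[OF x] eta_functional[of "F u"]
  show w: "t2 (F u) (D i E1F u) = wF i u" by (simp add: wF_def ip_E[OF x])
  show "t1 (F u) (D i E1F u) = 0"
    using linear_functional_chain[OF u E_smooth(1) lt(1), of "\<lambda>_. 0" i]
    by (simp add: cv_E_components[OF x] linear_zero)
  show "eta (F u) (D i E1F u) = - c u * x2 i u"
    using linear_functional_chain[OF u E_smooth(1) lt(3), of "\<lambda>X. - c u * t2 (F u) X" i]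
    by (simp add: cv_E_components[OF x] c_def x_eq[OF u] linearI t_linear[OF x] algebra_simps)
  show "t2 (F u) (D i E2F u) = 0"
    using linear_functional_chain[OF u E_smooth(2) lt(2), of "\<lambda>_. 0" i]
    by (simp add: cv_E_components[OF x] linear_zero)
  show "eta (F u) (D i E2F u) = c u * x1 i u"
    using linear_functional_chain[OF u E_smooth(2) lt(3), of "\<lambda>X. c u * t1 (F u) X" i]
    by (simp add: cv_E_components[OF x] c_def x_eq[OF u] linearI t_linear[OF x] algebra_simps)
  have z: "t1 (F u) (cv l xi (F u)) = c u * t2 (F u) (axis l 1)"
    "t2 (F u) (cv l xi (F u)) = - c u * t1 (F u) (axis l 1)" "eta (F u) (cv l xi (F u)) = 0" for l
    using cv_xi[OF x, of l "E1 (F u)"] cv_xi[OF x, of l "E2 (F u)"] cv_xi[OF x, of l "xi (F u)"]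
    by (simp_all add: ip_E[OF x] ip_xi'[OF x] t_E[OF x] t_xi[OF x] c_def)
  show "t1 (F u) (D i xiF u) = c u * x2 i u"
    using linear_functional_chain[OF u xi_smooth lt(1), of "\<lambda>X. c u * t2 (F u) X" i]
    by (simp add: z x_eq[OF u] linearI t_linear[OF x] algebra_simps)
  show "t2 (F u) (D i xiF u) = - c u * x1 i u"
    using linear_functional_chain[OF u xi_smooth lt(2), of "\<lambda>X. - c u * t1 (F u) X" i]
    by (simp add: z x_eq[OF u] linearI t_linear[OF x] algebra_simps)
  show "eta (F u) (D i xiF u) = 0"
    using linear_functional_chain[OF u xi_smooth lt(3), of "\<lambda>_. 0" i]
    by (simp add: z linear_zero)
  have "t1 (F u) (D i E2F u) = (\<Sum>l\<in>UNIV. FD i u $ l * - w l (F u))"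
    by (simp add: chain[OF u E_smooth(2)] linear_sum[OF lt(1)] linear_scale[OF lt(1)] cv_E_components[OF x])
  also have "\<dots> = - wF i u"
    unfolding w[symmetric]
    by (simp add: chain[OF u E_smooth(1)] linear_sum[OF lt(2)] linear_scale[OF lt(2)] cv_E_components[OF x]
        sum_negf)
  finally show "t1 (F u) (D i E2F u) = - wF i u" .
qed

lemma D_frame:
  assumes u: "u \<in> U"
  shows "D i E1F u = wF i u *\<^sub>R E2 (F u) + (- (c u * x2 i u)) *\<^sub>R xi (F u)"
    "D i E2F u = (- wF i u) *\<^sub>R E1 (F u) + (c u * x1 i u) *\<^sub>R xi (F u)"
  using frame_expansion3[OF map.F_maps[OF u], of "D i E1F u"]
    frame_expansion3[OF map.F_maps[OF u], of "D i E2F u"]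
  by (simp_all add: D_frame_components[OF u])

lemma c_sq: "u \<in> U \<Longrightarrow> c u * c u = \<tau>\<^sup>2"
  using sg_sq[OF map.F_maps] by (simp add: c_def power2_eq_square mult_ac)

text \<open>Differentiating \<open>c_sq\<close> shows that \<open>c\<close> times its derivative
  vanishes. For \<tau> = 0, where \<open>c\<close> cannot be cancelled, \<open>c\<close> itself is
  zero.\<close>

lemma pderiv_c:
  assumes u: "u \<in> U"
  shows "pderiv_at i c u = 0"
proof (cases "\<tau> = 0")
  case True
  have "pderiv_at i c u = pderiv_at i (\<lambda>u. 0) u"
    by (rule pderiv_at_cong[OF map.open_U u]) (unfold c_def, simp add: True)
  then show ?thesis by simp
next
  case False
  have "pderiv_at i (\<lambda>u. c u * c u) u = pderiv_at i (\<lambda>u. \<tau>\<^sup>2) u"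
    by (rule pderiv_at_cong[OF map.open_U u]) (rule c_sq)
  then have "c u * pderiv_at i c u = 0"
    by (simp add: pderiv_at_mult map.diffU[OF scalars_smooth(4) u])
  moreover have "c u \<noteq> 0" using c_sq[OF u] False by auto
  ultimately show ?thesis by simp
qed

lemma pderiv_c_mult:
  assumes "u \<in> U" "smooth_on U a"
  shows "pderiv_at i (\<lambda>u. c u * a u) u = c u * pderiv_at i a u"
    "pderiv_at i (\<lambda>u. - (c u * a u)) u = - (c u * pderiv_at i a u)"
proof -
  note d = map.diffU[OF scalars_smooth(4) assms(1)] map.diffU[OF assms(2,1)]
  show 1: "pderiv_at i (\<lambda>u. c u * a u) u = c u * pderiv_at i a u"
    by (simp add: pderiv_at_mult[OF d] pderiv_c[OF assms(1)])
  show "pderiv_at i (\<lambda>u. - (c u * a u)) u = - (c u * pderiv_at i a u)"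
    by (subst pderiv_at_minus)
      (auto simp: 1 intro: differentiable_bounded_bilinear[OF bounded_bilinear_mult d])
qed

lemma exterior_derivative_map:
  assumes "u \<in> U" "smooth_on U W"
  shows "pderiv_at i (\<lambda>u. dip u (FD j u) (W u)) u - pderiv_at j (\<lambda>u. dip u (FD i u) (W u)) u =
    dip u (FD j u) (D i W u) - dip u (FD i u) (D j W u)"
  using map.metric_compat[OF FD_smooth assms(2,1), of i j] map.metric_compat[OF FD_smooth assms(2,1), of j i]
    map.torsion_free[OF assms(1), of i j] by simp

lemma ip_FD:
  assumes "u \<in> U"
  shows "dip u (FD i u) X = x1 i u * t1 (F u) X + x2 i u * t2 (F u) X + x3 i u * eta (F u) X"
  using metric_split[OF map.F_maps[OF assms], of "FD i u" X] by (simp add: x_eq assms)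

text \<open>First structure equations of the pulled-back coframe. The last one, d eta = - 2 c t1
  \<and> t2, measures the failure of the horizontal planes to be integrable.\<close>

lemma pderiv_x:
  assumes u: "u \<in> U"
  shows "pderiv_at 1 (x1 2) u - pderiv_at 2 (x1 1) u = wF 1 u * x2 2 u - wF 2 u * x2 1 u
      - c u * (x2 1 u * x3 2 u - x2 2 u * x3 1 u)"
    "pderiv_at 1 (x2 2) u - pderiv_at 2 (x2 1) u = - (wF 1 u * x1 2 u - wF 2 u * x1 1 u)
      + c u * (x1 1 u * x3 2 u - x1 2 u * x3 1 u)"
    "pderiv_at 1 (x3 2) u - pderiv_at 2 (x3 1) u = - 2 * c u * (x1 1 u * x2 2 u - x1 2 u * x2 1 u)"
  using exterior_derivative_map[OF u EF_smooth(1), of 1 2] exterior_derivative_map[OF u EF_smooth(2), of 1 2]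
    exterior_derivative_map[OF u EF_smooth(3), of 1 2]
  unfolding x1_def[symmetric, abs_def] x2_def[symmetric, abs_def] x3_def[symmetric, abs_def]
  by (simp_all add: ip_FD[OF u] D_frame_components[OF u] algebra_simps)

lemma DD_frame:
  assumes u: "u \<in> U"
  shows "t2 (F u) (D i (D j E1F) u) = pderiv_at i (wF j) u + c u * c u * x2 j u * x1 i u"
    "eta (F u) (D i (D j E1F) u) = c u * (wF j u * x1 i u - pderiv_at i (x2 j) u)"
    "eta (F u) (D i (D j E2F) u) = c u * (wF j u * x2 i u + pderiv_at i (x1 j) u)"
proof -
  note x = map.F_maps[OF u]
  note sm = scalars_smooth EF_smooth map.open_U
  have s: "smooth_on U (\<lambda>u. - (c u * x2 j u))" "smooth_on U (\<lambda>u. c u * x1 j u)" "smooth_on U (\<lambda>u. - wF j u)"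
    by (intro smooth_intros sm)+
  have 1: "D i (D j E1F) u = pderiv_at i (wF j) u *\<^sub>R E2 (F u) + wF j u *\<^sub>R D i E2F u
     + (- (c u * pderiv_at i (x2 j) u) *\<^sub>R xi (F u) + (- (c u * x2 j u)) *\<^sub>R D i xiF u)"
  proof -
    have "D i (D j E1F) u = D i (\<lambda>u. wF j u *\<^sub>R E2 (F u) + (- (c u * x2 j u)) *\<^sub>R xi (F u)) u"
      by (rule map.D_cong[OF u]) (rule D_frame(1))
    also have "\<dots> = D i (\<lambda>u. wF j u *\<^sub>R E2 (F u)) u + D i (\<lambda>u. (- (c u * x2 j u)) *\<^sub>R xi (F u)) u"
      by (rule map.D_add[OF _ _ u]) (intro smooth_on_scaleR s sm)+
    finally show ?thesis
      using map.D_scale[OF scalars_smooth(5) EF_smooth(2) u] map.D_scale[OF s(1) EF_smooth(3) u]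
      by (simp add: pderiv_c_mult[OF u scalars_smooth(2)])
  qed
  have 2: "D i (D j E2F) u = pderiv_at i (\<lambda>u. - wF j u) u *\<^sub>R E1 (F u) + (- wF j u) *\<^sub>R D i E1F u
     + ((c u * pderiv_at i (x1 j) u) *\<^sub>R xi (F u) + (c u * x1 j u) *\<^sub>R D i xiF u)"
  proof -
    have "D i (D j E2F) u = D i (\<lambda>u. (- wF j u) *\<^sub>R E1 (F u) + (c u * x1 j u) *\<^sub>R xi (F u)) u"
      by (rule map.D_cong[OF u]) (rule D_frame(2))
    also have "\<dots> = D i (\<lambda>u. (- wF j u) *\<^sub>R E1 (F u)) u + D i (\<lambda>u. (c u * x1 j u) *\<^sub>R xi (F u)) u"
      by (rule map.D_add[OF _ _ u]) (intro smooth_on_scaleR s sm)+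
    finally show ?thesis
      using map.D_scale[OF s(3) EF_smooth(1) u] map.D_scale[OF s(2) EF_smooth(3) u]
      by (simp add: pderiv_c_mult[OF u scalars_smooth(1)])
  qed
  have eta_xi: "eta (F u) (xi (F u)) = 1" by (simp add: eta_def xi_unit[OF x])
  note simps = t_linear[OF x] eta_linear t_E[OF x] t_xi[OF x] eta_xi D_frame_components[OF u]
  show "t2 (F u) (D i (D j E1F) u) = pderiv_at i (wF j) u + c u * c u * x2 j u * x1 i u"
    unfolding 1 by (simp only: simps) simp
  show "eta (F u) (D i (D j E1F) u) = c u * (wF j u * x1 i u - pderiv_at i (x2 j) u)"
    unfolding 1 by (simp only: simps) (simp add: algebra_simps)
  show "eta (F u) (D i (D j E2F) u) = c u * (wF j u * x2 i u + pderiv_at i (x1 j) u)"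
    unfolding 2 by (simp only: simps) (simp add: algebra_simps)
qed

lemma wF_eq:
  assumes u: "u \<in> U"
  shows "wF i u = base.om 1 (pr (F u)) * pderiv_at i (\<lambda>u. pr (F u)) u $ 1
    + base.om 2 (pr (F u)) * pderiv_at i (\<lambda>u. pr (F u)) u $ 2 - c u * x3 i u"
proof -
  note x = map.F_maps[OF u]
  have pF: "pderiv_at i (\<lambda>u. pr (F u)) u = (\<Sum>l\<in>UNIV. FD i u $ l *\<^sub>R pderiv_at l pr (F u))"
    using pderiv_at_compose[OF map.diffU[OF map.F_smooth u] pr_diff[OF x]]
    by (simp add: frechet_derivative_pderiv[OF pr_diff[OF x]])
  have "wF i u = (\<Sum>l\<in>UNIV. FD i u $ l * w l (F u))"
    unfolding wF_def ip_E[OF x] chain[OF u E_smooth(1)]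
    by (simp add: linear_sum[OF t_linear_functional(2)[OF x]] linear_scale[OF t_linear_functional(2)[OF x]]
        cv_E_components[OF x])
  also have "\<dots> = (\<Sum>l\<in>UNIV. base.om 1 (pr (F u)) * (FD i u $ l * pderiv_at l pr (F u) $ 1)
      + base.om 2 (pr (F u)) * (FD i u $ l * pderiv_at l pr (F u) $ 2) - c u * (FD i u $ l * eta (F u) (axis l 1)))"
    by (simp add: connection_form_pullback[OF x] c_def algebra_simps)
  also have "\<dots> = base.om 1 (pr (F u)) * (\<Sum>l\<in>UNIV. FD i u $ l * pderiv_at l pr (F u) $ 1)
      + base.om 2 (pr (F u)) * (\<Sum>l\<in>UNIV. FD i u $ l * pderiv_at l pr (F u) $ 2)
      - c u * (\<Sum>l\<in>UNIV. FD i u $ l * eta (F u) (axis l 1))"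
    by (simp add: sum.distrib sum_subtractf sum_distrib_left)
  also have "(\<Sum>l\<in>UNIV. FD i u $ l * eta (F u) (axis l 1)) = x3 i u"
    using linear_axis_expansion[OF eta_functional, of "F u" "FD i u"] by (simp add: x_eq[OF u])
  finally show ?thesis by (simp add: pF)
qed

text \<open>The base connection form contributes - \<kappa> times the horizontal area, the
  correction - c eta contributes 2 \<tau>^2 through d eta.\<close>

lemma pderiv_wF:
  assumes u: "u \<in> U"
  shows "pderiv_at 1 (wF 2) u - pderiv_at 2 (wF 1) u = - (\<kappa> - 2 * \<tau>\<^sup>2) * (x1 1 u * x2 2 u - x1 2 u * x2 1 u)"
proof -
  note x = map.F_maps[OF u]
  note y = pr_maps[OF x]
  let ?G = "\<lambda>u. pr (F u)"
  have sG: "smooth_on U ?G" by (rule F_comp_smooth[OF pr_smooth])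
  have soG: "smooth_on U (\<lambda>u. base.om k (pr (F u)))" for k
    by (rule F_comp_smooth[OF pr_comp_smooth[OF base.om_smooth]])
  let ?b = "\<lambda>i u. base.om 1 (pr (F u)) * pderiv_at i ?G u $ 1 + base.om 2 (pr (F u)) * pderiv_at i ?G u $ 2"
  have sb: "smooth_on U (?b i)" for i by (intro smooth_intros soG sG map.open_U)
  have pw: "pderiv_at i (wF j) u = pderiv_at i (?b j) u - c u * pderiv_at i (x3 j) u" for i j
  proof -
    have "pderiv_at i (wF j) u = pderiv_at i (\<lambda>u. ?b j u - c u * x3 j u) u"
      by (rule pderiv_at_cong[OF map.open_U u]) (rule wF_eq)
    also have "\<dots> = pderiv_at i (?b j) u - pderiv_at i (\<lambda>u. c u * x3 j u) u"
      by (intro pderiv_at_diff map.diffU[OF _ u] sb smooth_on_mult scalars_smooth map.open_U)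
    finally show ?thesis by (simp add: pderiv_c_mult[OF u scalars_smooth(3)])
  qed
  have po: "pderiv_at i (\<lambda>u. base.om k (pr (F u))) u =
      pderiv_at i ?G u $ 1 * pderiv_at 1 (base.om k) (pr (F u)) + pderiv_at i ?G u $ 2 * pderiv_at 2 (base.om k) (pr (F u))"
    for i k
    using pderiv_at_compose[OF map.diffU[OF sG u] smooth_on_differentiable[OF base.om_smooth y]]
    by (simp add: frechet_derivative_pderiv[OF smooth_on_differentiable[OF base.om_smooth y]] sum_2)
  have pb: "pderiv_at i (?b j) u = base.om 1 (pr (F u)) * pderiv_at i (pderiv_at j ?G) u $ 1
      + pderiv_at i (\<lambda>u. base.om 1 (pr (F u))) u * pderiv_at j ?G u $ 1
      + (base.om 2 (pr (F u)) * pderiv_at i (pderiv_at j ?G) u $ 2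
      + pderiv_at i (\<lambda>u. base.om 2 (pr (F u))) u * pderiv_at j ?G u $ 2)" for i j
  proof -
    have "pderiv_at i (?b j) u = pderiv_at i (\<lambda>u. base.om 1 (pr (F u)) * pderiv_at j ?G u $ 1) u
        + pderiv_at i (\<lambda>u. base.om 2 (pr (F u)) * pderiv_at j ?G u $ 2) u"
      by (intro pderiv_at_add map.diffU[OF _ u] smooth_intros soG sG map.open_U)
    moreover have "pderiv_at i (\<lambda>u. base.om k (pr (F u)) * pderiv_at j ?G u $ k') u =
        base.om k (pr (F u)) * pderiv_at i (\<lambda>u. pderiv_at j ?G u $ k') u
        + pderiv_at i (\<lambda>u. base.om k (pr (F u))) u * pderiv_at j ?G u $ k'" for k k'
      by (intro pderiv_at_mult map.diffU[OF _ u] smooth_intros soG sG map.open_U)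
    moreover have "pderiv_at i (\<lambda>u. pderiv_at j ?G u $ k') u = pderiv_at i (pderiv_at j ?G) u $ k'" for k'
      by (intro pderiv_at_nth map.diffU[OF _ u] smooth_on_pderiv sG)
    ultimately show ?thesis by simp
  qed
  have cG: "pderiv_at 1 (pderiv_at 2 ?G) u = pderiv_at 2 (pderiv_at 1 ?G) u"
    by (rule pderiv_commute[OF sG map.open_U u])
  have K: "pderiv_at 1 (base.om 2) (pr (F u)) = pderiv_at 2 (base.om 1) (pr (F u)) - \<kappa> * base.p (pr (F u)) * base.r (pr (F u))"
    using base.pderiv_om[OF y] base_curvature[OF y] by simp
  have G: "dpr (F u) (FD i u) = pderiv_at i ?G u" for i
    using pderiv_at_compose[OF map.diffU[OF map.F_smooth u] pr_diff[OF x]] by simp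
  have x12: "x1 i u = base.p (pr (F u)) * pderiv_at i ?G u $ 1 + base.q (pr (F u)) * pderiv_at i ?G u $ 2"
    "x2 i u = base.r (pr (F u)) * pderiv_at i ?G u $ 2" for i
    by (simp_all add: x_eq[OF u] t1_def t2_def G base.th1_def base.th2_def)
  have J: "x1 1 u * x2 2 u - x1 2 u * x2 1 u = base.p (pr (F u)) * base.r (pr (F u)) *
      (pderiv_at 1 ?G u $ 1 * pderiv_at 2 ?G u $ 2 - pderiv_at 1 ?G u $ 2 * pderiv_at 2 ?G u $ 1)"
    by (simp add: x12 algebra_simps)
  have "pderiv_at 1 (?b 2) u - pderiv_at 2 (?b 1) u = - \<kappa> * (x1 1 u * x2 2 u - x1 2 u * x2 1 u)"
    unfolding pb po cG J K by (simp add: algebra_simps)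
  moreover have "c u * (pderiv_at 1 (x3 2) u - pderiv_at 2 (x3 1) u) = - 2 * \<tau>\<^sup>2 * (x1 1 u * x2 2 u - x1 2 u * x2 1 u)"
    unfolding pderiv_x(3)[OF u] c_sq[OF u, symmetric] by simp
  ultimately show ?thesis unfolding pw by (simp add: algebra_simps)
qed

text \<open>Sectional curvature \<kappa> - 3 \<tau>^2 on the horizontal plane and \<tau>^2 on planes
  containing \<open>xi\<close>, in the guise of frame components. By skew-symmetry these three
  determine \<open>Rm 1 2\<close>.\<close>

lemma curvature_components:
  assumes u: "u \<in> U"
  shows "t2 (F u) (map.Rm 1 2 u (E1 (F u))) = - (\<kappa> - 3 * \<tau>\<^sup>2) * (x1 1 u * x2 2 u - x1 2 u * x2 1 u)"
    "eta (F u) (map.Rm 1 2 u (E1 (F u))) = - \<tau>\<^sup>2 * (x1 1 u * x3 2 u - x1 2 u * x3 1 u)"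
    "eta (F u) (map.Rm 1 2 u (E2 (F u))) = - \<tau>\<^sup>2 * (x2 1 u * x3 2 u - x2 2 u * x3 1 u)"
proof -
  note x = map.F_maps[OF u]
  have R1: "map.Rm 1 2 u (E1 (F u)) = D 1 (D 2 E1F) u + (-1) *\<^sub>R D 2 (D 1 E1F) u"
    using map.curvature_Rm[OF EF_smooth(1) u, of 1 2] by simp
  have R2: "map.Rm 1 2 u (E2 (F u)) = D 1 (D 2 E2F) u + (-1) *\<^sub>R D 2 (D 1 E2F) u"
    using map.curvature_Rm[OF EF_smooth(2) u, of 1 2] by simp
  show "t2 (F u) (map.Rm 1 2 u (E1 (F u))) = - (\<kappa> - 3 * \<tau>\<^sup>2) * (x1 1 u * x2 2 u - x1 2 u * x2 1 u)"
    using pderiv_wF[OF u] unfolding R1 t_linear[OF x] DD_frame[OF u] c_sq[OF u]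
    by (simp add: algebra_simps)
  have "eta (F u) (map.Rm 1 2 u (E1 (F u))) = c u * (wF 2 u * x1 1 u - wF 1 u * x1 2 u
      - (pderiv_at 1 (x2 2) u - pderiv_at 2 (x2 1) u))"
    unfolding R1 eta_linear DD_frame[OF u] by (simp add: algebra_simps)
  also have "\<dots> = - (c u * c u) * (x1 1 u * x3 2 u - x1 2 u * x3 1 u)"
    unfolding pderiv_x[OF u] by (simp add: algebra_simps)
  finally show "eta (F u) (map.Rm 1 2 u (E1 (F u))) = - \<tau>\<^sup>2 * (x1 1 u * x3 2 u - x1 2 u * x3 1 u)"
    by (simp only: c_sq[OF u])
  have "eta (F u) (map.Rm 1 2 u (E2 (F u))) = c u * (wF 2 u * x2 1 u - wF 1 u * x2 2 u
      + (pderiv_at 1 (x1 2) u - pderiv_at 2 (x1 1) u))"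
    unfolding R2 eta_linear DD_frame[OF u] by (simp add: algebra_simps)
  also have "\<dots> = - (c u * c u) * (x2 1 u * x3 2 u - x2 2 u * x3 1 u)"
    unfolding pderiv_x[OF u] by (simp add: algebra_simps)
  finally show "eta (F u) (map.Rm 1 2 u (E2 (F u))) = - \<tau>\<^sup>2 * (x2 1 u * x3 2 u - x2 2 u * x3 1 u)"
    by (simp only: c_sq[OF u])
qed

text \<open>Frame-free form: a part of constant curvature \<tau>^2 and a part that sees only
  horizontal components. The sign of the adapted frame enters squared.\<close>

lemma ambient_curvature:
  assumes u: "u \<in> U"
  shows "dip u (map.Rm 1 2 u X) Y =
    - \<tau>\<^sup>2 * (dip u (FD 1 u) X * dip u (FD 2 u) Y - dip u (FD 2 u) X * dip u (FD 1 u) Y)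
    - (\<kappa> - 4 * \<tau>\<^sup>2) * dip u (wedge (g (F u)) (FD 1 u) (FD 2 u)) (xi (F u))
      * dip u (wedge (g (F u)) X Y) (xi (F u))"
proof -
  note x = map.F_maps[OF u]
  let ?R = "map.Rm 1 2 u" and ?a = "E1 (F u)" and ?b = "E2 (F u)" and ?x = "xi (F u)"
  have sk: "dip u (?R X) Y = - dip u (?R Y) X" for X Y
    using map.Rm_skew[OF u, of 1 2 X Y] total.g_sym[OF x] by simp
  have zero: "dip u (?R X) X = 0" for X using sk[of X X] by simp
  have ex: "eta (F u) ?x = 1" by (simp add: eta_def xi_unit[OF x])
  have comps: "t1 (F u) (?R ?a) = 0" "t2 (F u) (?R ?b) = 0" "eta (F u) (?R ?x) = 0"
    using zero[of ?a] zero[of ?b] zero[of ?x] by (simp_all add: ip_E[OF x] ip_xi'[OF x])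
  have comps': "t1 (F u) (?R ?b) = - t2 (F u) (?R ?a)" "t1 (F u) (?R ?x) = - eta (F u) (?R ?a)"
    "t2 (F u) (?R ?x) = - eta (F u) (?R ?b)"
    using sk[of ?b ?a] sk[of ?x ?a] sk[of ?x ?b] by (simp_all add: ip_E[OF x] ip_xi'[OF x])
  have RX: "?R X = t1 (F u) X *\<^sub>R ?R ?a + t2 (F u) X *\<^sub>R ?R ?b + eta (F u) X *\<^sub>R ?R ?x"
    by (subst frame_expansion3[OF x, of X]) (simp add: map.Rm_linear)
  have tr: "dip u (wedge (g (F u)) X Y) ?x = sg (F u) * (t1 (F u) X * t2 (F u) Y - t2 (F u) X * t1 (F u) Y)" for X Y
    by (simp add: triple[OF x] t_xi[OF x] ex)
  have "dip u (?R X) Y = t1 (F u) (?R X) * t1 (F u) Y + t2 (F u) (?R X) * t2 (F u) Y + eta (F u) (?R X) * eta (F u) Y"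
    by (rule metric_split[OF x])
  also have "\<dots> = - \<tau>\<^sup>2 * (dip u (FD 1 u) X * dip u (FD 2 u) Y - dip u (FD 2 u) X * dip u (FD 1 u) Y)
     - (\<kappa> - 4 * \<tau>\<^sup>2) * ((x1 1 u * x2 2 u - x2 1 u * x1 2 u) * (t1 (F u) X * t2 (F u) Y - t2 (F u) X * t1 (F u) Y))"
    unfolding ip_FD[OF u] RX t_linear[OF x] eta_linear comps comps' curvature_components[OF u]
    by (simp add: algebra_simps)
  finally show ?thesis unfolding tr x_eq[OF u, symmetric] using sg_sq[OF x] by simp
qed

end

section \<open>Surfaces of constant mean curvature\<close>

lemma wedge_linear:
  "wedge A (X + Y) Z = wedge A X Z + wedge A Y Z" "wedge A X (Y + Z) = wedge A X Y + wedge A X Z"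
  "wedge A (k *\<^sub>R X) Z = k *\<^sub>R wedge A X Z" "wedge A X (k *\<^sub>R Z) = k *\<^sub>R wedge A X Z"
  by (simp_all add: wedge_def cross_add_left cross_add_right cross_mult_left cross_mult_right
      matrix_vector_right_distrib matrix_vector_mult_scaleR scaleR_add_right)

lemma wedge_self: "wedge A X X = 0"
  by (simp add: wedge_def)

locale immersed_surface = submersion_surface +
  assumes immersion: "u \<in> U \<Longrightarrow> inj (frechet_derivative F (at u))"
begin

abbreviation "wdg u \<equiv> wedge (g (F u))"
abbreviation "\<gamma> \<equiv> induced_metric g F"
abbreviation "dF u \<equiv> frechet_derivative F (at u)"

lemma dF_FD: "u \<in> U \<Longrightarrow> dF u X = X $ 1 *\<^sub>R FD 1 u + X $ 2 *\<^sub>R FD 2 u"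
  by (simp add: frechet_derivative_pderiv[OF map.diffU[OF map.F_smooth]] sum_2)

lemma induced_ip:
  assumes "u \<in> U"
  shows "ip (\<gamma> u) X Y = dip u (dF u X) (dF u Y)"
  by (simp add: ip_2 induced_metric_def dF_FD[OF assms] ip_linear algebra_simps)

lemma induced_metric_smooth: "smooth_on U \<gamma>"
  unfolding induced_metric_def[abs_def]
  by (intro smooth_on_vec smooth_on_ip map.gF_smooth FD_smooth map.open_U)

end

sublocale immersed_surface \<subseteq> surf: riem_surface U \<gamma>
proof
  show "open U" by (rule map.open_U)
  show "smooth_on U \<gamma>" by (rule induced_metric_smooth)
  show "transpose (\<gamma> u) = \<gamma> u" if "u \<in> U" for u
    using total.g_sym[OF map.F_maps[OF that]]
    by (simp add: transpose_def induced_metric_def vec_eq_iff)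
  show "ip (\<gamma> u) X X > 0" if "u \<in> U" "X \<noteq> 0" for u X
  proof -
    have "linear (dF u)"
      by (rule linear_frechet_derivative[OF map.diffU[OF map.F_smooth that(1)]])
    then have "dF u X \<noteq> 0" using immersion[OF that(1)] that(2) linear_injective_0 by blast
    then show ?thesis
      unfolding induced_ip[OF that(1)] by (rule map.g_pos[OF map.F_maps[OF that(1)]])
  qed
qed

section \<open>The positive frame of the surface and its normal\<close>

context immersed_surface
begin

abbreviation "p \<equiv> surf.p"
abbreviation "q \<equiv> surf.q"
abbreviation "r \<equiv> surf.r"
abbreviation "om \<equiv> surf.om"

text \<open>\<open>EA\<close> and \<open>EB\<close> are the images of \<open>surf.e1\<close> and
  \<open>surf.e2\<close> under dF, see \<open>dF_frame\<close>; written through partial derivatives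
  of \<open>F\<close> they are visibly smooth.\<close>

definition EA where "EA u = (1 / p u) *\<^sub>R FD 1 u"
definition EB where "EB u = (1 / r u) *\<^sub>R (FD 2 u + (- q u / p u) *\<^sub>R FD 1 u)"
abbreviation "NN \<equiv> unit_normal g F"

lemma dF_frame:
  assumes "u \<in> U"
  shows "dF u (surf.e1 u) = EA u" "dF u (surf.e2 u) = EB u"
  using surf.p_pos[OF assms] surf.r_pos[OF assms]
  by (simp_all add: dF_FD[OF assms] EA_def EB_def surf.frame_components algebra_simps)

lemma FD_frame:
  assumes "u \<in> U"
  shows "FD 1 u = p u *\<^sub>R EA u" "FD 2 u = q u *\<^sub>R EA u + r u *\<^sub>R EB u"
  using surf.p_pos[OF assms] surf.r_pos[OF assms]
  by (simp_all add: EA_def EB_def algebra_simps)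

text \<open>Lagrange's identity: the squared length of a cross product is the Gram determinant of
  its factors.\<close>

lemma wedge_FD_norm:
  fixes u defines "W \<equiv> wdg u (FD 1 u) (FD 2 u)"
  assumes u: "u \<in> U"
  shows "dip u W W = (p u * r u)\<^sup>2"
  unfolding W_def
proof -
  note x = map.F_maps[OF u]
  let ?W = "wdg u (FD 1 u) (FD 2 u)"
  let ?s = "sg (F u)"
  have ex: "eta (F u) (xi (F u)) = 1" by (simp add: eta_def xi_unit[OF x])
  have W: "t1 (F u) ?W = ?s * (x2 1 u * x3 2 u - x3 1 u * x2 2 u)"
    "t2 (F u) ?W = ?s * (x3 1 u * x1 2 u - x1 1 u * x3 2 u)"
    "eta (F u) ?W = ?s * (x1 1 u * x2 2 u - x2 1 u * x1 2 u)"
    using triple[OF x, of "FD 1 u" "FD 2 u" "E1 (F u)"] triple[OF x, of "FD 1 u" "FD 2 u" "E2 (F u)"]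
      triple[OF x, of "FD 1 u" "FD 2 u" "xi (F u)"]
    by (simp_all add: ip_E[OF x] ip_xi'[OF x] t_E[OF x] t_xi[OF x] ex x_eq[OF u])
  have "dip u ?W ?W = (?s * ?s) * ((x2 1 u * x3 2 u - x3 1 u * x2 2 u)\<^sup>2
      + (x1 1 u * x3 2 u - x3 1 u * x1 2 u)\<^sup>2 + (x1 1 u * x2 2 u - x2 1 u * x1 2 u)\<^sup>2)"
    unfolding metric_split[OF x, of ?W ?W] W by (simp add: power2_eq_square algebra_simps)
  also have "\<dots> = det (\<gamma> u)"
    by (simp add: sg_sq[OF x] det_2 induced_metric_def metric_split[OF x] x_eq[OF u, symmetric]
        power2_eq_square algebra_simps)
  finally show "dip u ?W ?W = (p u * r u)\<^sup>2" by (simp only: surf.det_pr[OF u])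
qed

lemma normal_eq:
  assumes u: "u \<in> U"
  shows "NN u = (1 / (p u * r u)) *\<^sub>R wdg u (FD 1 u) (FD 2 u)"
  using surf.p_pos[OF u] surf.r_pos[OF u] by (simp add: unit_normal_def Let_def wedge_FD_norm[OF u])

lemma wedge_FD:
  assumes "u \<in> U"
  shows "wdg u (FD 1 u) (FD 2 u) = (p u * r u) *\<^sub>R NN u"
  using surf.p_pos[OF assms] surf.r_pos[OF assms] by (simp add: normal_eq[OF assms])

lemma wedge_frame:
  assumes u: "u \<in> U"
  shows "wdg u (EA u) (EB u) = NN u"
  unfolding normal_eq[OF u] EA_def EB_def
  by (simp only: wedge_linear wedge_self scaleR_zero_right add_0_right) (simp add: mult.commute)

lemma surface_frame:
  assumes u: "u \<in> U"
  shows "orthonormal3 (g (F u)) (EA u) (EB u) (NN u)"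
proof -
  note x = map.F_maps[OF u]
  note pos = surf.p_pos[OF u] surf.r_pos[OF u]
  have E: "dip u (EA u) (EA u) = 1" "dip u (EB u) (EB u) = 1" "dip u (EA u) (EB u) = 0"
    using induced_ip[OF u, of "surf.e1 u" "surf.e1 u"] induced_ip[OF u, of "surf.e2 u" "surf.e2 u"]
      induced_ip[OF u, of "surf.e1 u" "surf.e2 u"]
    by (simp_all add: dF_frame[OF u] surf.ip_frame[OF u] surf.th_frame[OF u])
  have N: "dip u (EA u) (NN u) = 0" "dip u (EB u) (NN u) = 0"
    unfolding wedge_frame[OF u, symmetric]
    using triple[OF x, of "EA u" "EB u" "EA u"] triple[OF x, of "EA u" "EB u" "EB u"]
    by (simp_all add: total.g_sym[OF x, of _ "wedge _ _ _"] algebra_simps)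
  have "dip u (NN u) (NN u) = 1"
    using pos by (simp add: normal_eq[OF u] ip_linear wedge_FD_norm[OF u] power2_eq_square)
  with E N show ?thesis
    by (simp add: orthonormal3_def total.g_transpose[OF x])
qed

lemmas surface_frame_simps = orthonormal3_simps[OF surface_frame]

text \<open>The frame is positive because the normal is the cross product of \<open>EA\<close> and
  \<open>EB\<close>; the sign in \<open>orthonormal3_triple\<close> is therefore 1.\<close>

lemma surface_triple:
  assumes u: "u \<in> U"
  shows "dip u (wdg u X Y) Z =
     (dip u (EA u) X * (dip u (EB u) Y * dip u (NN u) Z - dip u (NN u) Y * dip u (EB u) Z)
     - dip u (EB u) X * (dip u (EA u) Y * dip u (NN u) Z - dip u (NN u) Y * dip u (EA u) Z)
     + dip u (NN u) X * (dip u (EA u) Y * dip u (EB u) Z - dip u (EB u) Y * dip u (EA u) Z))"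
  using orthonormal3_triple[OF surface_frame[OF u], of X Y Z]
  by (simp add: wedge_frame[OF u] surface_frame_simps[OF u])

lemma frame_smooth: "smooth_on U EA" "smooth_on U EB" "smooth_on U NN"
proof -
  note sm = surf.p_smooth surf.q_smooth surf.r_smooth FD_smooth map.open_U
  show "smooth_on U EA" "smooth_on U EB" unfolding EA_def[abs_def] EB_def[abs_def]
    by (intro smooth_on_divide smooth_intros sm; use surf.p_pos surf.r_pos in force)+
  have "smooth_on U (\<lambda>u. sqrt (det (g (F u))) *\<^sub>R (matrix_inv (g (F u)) *v cross3 (EA u) (EB u)))"
    using map.F_maps
    by (intro smooth_on_scaleR smooth_on_sqrt smooth_on_det smooth_on_matrix_vector_mult
        smooth_on_matrix_inv smooth_on_cross3 map.gF_smooth map.open_U \<open>smooth_on U EA\<close> \<open>smooth_on U EB\<close>)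
      (auto simp: g_det_pos total.g_det)
  then show "smooth_on U NN"
    by (rule smooth_on_cong[OF map.open_U, rotated]) (simp add: wedge_frame[symmetric] wedge_def)
qed

text \<open>The second fundamental form with a coordinate field in the first slot and a frame vector
  in the second, that is, as a pair of 1-forms.\<close>

definition A1 where "A1 i u = dip u (NN u) (D i EA u)"
definition A2 where "A2 i u = dip u (NN u) (D i EB u)"
definition ta where "ta u = dip u (xi (F u)) (EA u)"
definition tb where "tb u = dip u (xi (F u)) (EB u)"
definition nu where "nu u = dip u (xi (F u)) (NN u)"

lemma surface_scalars_smooth: "smooth_on U (A1 i)" "smooth_on U (A2 i)" "smooth_on U ta" "smooth_on U tb"
  unfolding A1_def[abs_def] A2_def[abs_def] ta_def[abs_def] tb_def[abs_def]
  by (intro smooth_on_ip map.gF_smooth frame_smooth map.D_smooth EF_smooth map.open_U)+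

lemma D_orthonormal:
  assumes "u \<in> U" "smooth_on U W" "smooth_on U Z" "\<And>y. y \<in> U \<Longrightarrow> ip (g (F y)) (W y) (Z y) = k"
  shows "dip u (D i W u) (Z u) = - dip u (W u) (D i Z u)"
proof -
  have "pderiv_at i (\<lambda>v. ip (g (F v)) (W v) (Z v)) u = pderiv_at i (\<lambda>v. k) u"
    using assms(4) by (intro pderiv_at_cong[OF map.open_U assms(1)])
  then show ?thesis using map.metric_compat[OF assms(2,3,1), of i] by simp
qed

lemma D_self_zero:
  assumes "u \<in> U" "smooth_on U W" "\<And>y. y \<in> U \<Longrightarrow> ip (g (F y)) (W y) (W y) = k"
  shows "dip u (W u) (D i W u) = 0"
  using D_orthonormal[OF assms(1,2,2,3), of i] total.g_sym[OF map.F_maps[OF assms(1)], of "W u" "D i W u"]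
  by simp

lemma FD_components:
  assumes "u \<in> U"
  shows "dip u (FD 1 u) X = p u * dip u (EA u) X"
    "dip u (FD 2 u) X = q u * dip u (EA u) X + r u * dip u (EB u) X"
  by (simp_all add: FD_frame[OF assms] ip_linear)

text \<open>The tangential part of the ambient connection is the intrinsic one: its form satisfies
  the same two structure equations, which determine it because \<open>p\<close> and \<open>r\<close>
  are nonzero.\<close>

lemma connection_form_surface:
  assumes u: "u \<in> U"
  shows "dip u (EB u) (D i EA u) = om i u"
proof -
  note x = map.F_maps[OF u]
  define o' where "o' i = dip u (EB u) (D i EA u)" for i
  have aa: "dip u (EA u) (D i EA u) = 0" for i
    by (rule D_self_zero[OF u frame_smooth(1)]) (rule surface_frame_simps(1))
  have bb: "dip u (EB u) (D i EB u) = 0" for i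
    by (rule D_self_zero[OF u frame_smooth(2)]) (rule surface_frame_simps(2))
  have ab: "dip u (EA u) (D i EB u) = - o' i" for i
  proof -
    have "dip u (D i EA u) (EB u) = - dip u (EA u) (D i EB u)"
      by (rule D_orthonormal[OF u frame_smooth(1,2)]) (rule surface_frame_simps(4))
    then show ?thesis using total.g_sym[OF x, of "D i EA u" "EB u"] by (simp add: o'_def)
  qed
  have pd: "pderiv_at i (\<lambda>u. dip u (FD 1 u) (EA u)) u = pderiv_at i p u"
    "pderiv_at i (\<lambda>u. dip u (FD 2 u) (EA u)) u = pderiv_at i q u"
    "pderiv_at i (\<lambda>u. dip u (FD 1 u) (EB u)) u = pderiv_at i (\<lambda>u. 0) u"
    "pderiv_at i (\<lambda>u. dip u (FD 2 u) (EB u)) u = pderiv_at i r u" for i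
    by (rule pderiv_at_cong[OF map.open_U u]; simp add: FD_components surface_frame_simps)+
  have 1: "pderiv_at 1 q u - pderiv_at 2 p u = o' 1 * r u"
    using exterior_derivative_map[OF u frame_smooth(1), of 1 2]
    by (simp add: pd FD_components[OF u] aa o'_def)
  have 2: "pderiv_at 1 r u = o' 2 * p u - o' 1 * q u"
    using exterior_derivative_map[OF u frame_smooth(2), of 1 2]
    by (simp add: pd FD_components[OF u] ab bb)
  have o1: "o' 1 = om 1 u"
    using 1 surf.structure_equations(1)[OF u] surf.r_pos[OF u] by simp
  then have "o' 2 = om 2 u"
    using 2 surf.structure_equations(2)[OF u] surf.p_pos[OF u] by simp
  with o1 show ?thesis using exhaust_2[of i] by (auto simp: o'_def)
qed

text \<open>The formulas of Gauss and Weingarten: differentiated orthonormality leaves only the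
  coefficients \<open>om\<close>, \<open>A1\<close> and \<open>A2\<close>.\<close>

lemma D_surface_frame:
  assumes u: "u \<in> U"
  shows "D i EA u = om i u *\<^sub>R EB u + A1 i u *\<^sub>R NN u"
    "D i EB u = (- om i u) *\<^sub>R EA u + A2 i u *\<^sub>R NN u"
    "D i NN u = (- A1 i u) *\<^sub>R EA u + (- A2 i u) *\<^sub>R EB u"
proof -
  note x = map.F_maps[OF u]
  note ex = orthonormal3_expansion[OF surface_frame[OF u]]
  have aa: "dip u (EA u) (D i EA u) = 0"
    by (rule D_self_zero[OF u frame_smooth(1)]) (rule surface_frame_simps(1))
  have bb: "dip u (EB u) (D i EB u) = 0"
    by (rule D_self_zero[OF u frame_smooth(2)]) (rule surface_frame_simps(2))
  have nn: "dip u (NN u) (D i NN u) = 0"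
    by (rule D_self_zero[OF u frame_smooth(3)]) (rule surface_frame_simps(3))
  have "dip u (D i EA u) (EB u) = - dip u (EA u) (D i EB u)"
    by (rule D_orthonormal[OF u frame_smooth(1,2)]) (rule surface_frame_simps(4))
  then have ab: "dip u (EA u) (D i EB u) = - om i u"
    using total.g_sym[OF x, of "D i EA u" "EB u"] by (simp add: connection_form_surface[OF u])
  have "dip u (D i EA u) (NN u) = - dip u (EA u) (D i NN u)"
    by (rule D_orthonormal[OF u frame_smooth(1,3)]) (rule surface_frame_simps(5))
  then have an: "dip u (EA u) (D i NN u) = - A1 i u"
    using total.g_sym[OF x, of "D i EA u" "NN u"] by (simp add: A1_def)
  have "dip u (D i EB u) (NN u) = - dip u (EB u) (D i NN u)"
    by (rule D_orthonormal[OF u frame_smooth(2,3)]) (rule surface_frame_simps(6))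
  then have bn: "dip u (EB u) (D i NN u) = - A2 i u"
    using total.g_sym[OF x, of "D i EB u" "NN u"] by (simp add: A2_def)
  show "D i EA u = om i u *\<^sub>R EB u + A1 i u *\<^sub>R NN u"
    using ex[of "D i EA u"] by (simp add: aa connection_form_surface[OF u] A1_def)
  show "D i EB u = (- om i u) *\<^sub>R EA u + A2 i u *\<^sub>R NN u"
    using ex[of "D i EB u"] by (simp add: ab bb A2_def)
  show "D i NN u = (- A1 i u) *\<^sub>R EA u + (- A2 i u) *\<^sub>R EB u"
    using ex[of "D i NN u"] by (simp add: an bn nn)
qed

text \<open>Restores the frame-free equation for \<nabla>\<xi> along the surface; the sign inside
  \<open>c\<close> is absorbed by the cross product.\<close>

lemma D_xi:
  assumes u: "u \<in> U"
  shows "dip u (D i xiF u) Z = \<tau> * dip u (wdg u (FD i u) (xi (F u))) Z"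
proof -
  note x = map.F_maps[OF u]
  have ex: "eta (F u) (xi (F u)) = 1" by (simp add: eta_def xi_unit[OF x])
  show ?thesis
    unfolding metric_split[OF x, of "D i xiF u"] triple[OF x] D_frame_components[OF u] t_xi[OF x] ex
      x_eq[OF u] c_def
    by (simp add: algebra_simps)
qed

text \<open>The \<tau> terms come from the cross product of dF with \<xi>, to whose tangential part
  only the normal component of \<xi> contributes; the \<open>A1\<close> and \<open>A2\<close> terms
  come from the normal part of the derivatives of the frame.\<close>

lemma pderiv_t:
  assumes u: "u \<in> U"
  shows "pderiv_at 1 ta u = om 1 u * tb u + nu u * A1 1 u"
    "pderiv_at 2 ta u = om 2 u * tb u + nu u * (A1 2 u + \<tau> * r u)"
    "pderiv_at 1 tb u = - om 1 u * ta u + nu u * (A2 1 u - \<tau> * p u)"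
    "pderiv_at 2 tb u = - om 2 u * ta u + nu u * (A2 2 u - \<tau> * q u)"
proof -
  note x = map.F_maps[OF u]
  have xi_c: "dip u (EA u) (xi (F u)) = ta u" "dip u (EB u) (xi (F u)) = tb u"
    "dip u (NN u) (xi (F u)) = nu u"
    by (simp_all add: ta_def tb_def nu_def total.g_sym[OF x, of _ "xi (F u)"])
  have a: "pderiv_at i ta u = \<tau> * dip u (wdg u (FD i u) (xi (F u))) (EA u)
      + (om i u * tb u + A1 i u * nu u)" for i
    unfolding ta_def[abs_def] map.metric_compat[OF EF_smooth(3) frame_smooth(1) u] D_xi[OF u]
      D_surface_frame[OF u] ip_linear by (simp add: tb_def nu_def)
  have b: "pderiv_at i tb u = \<tau> * dip u (wdg u (FD i u) (xi (F u))) (EB u)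
      + (- om i u * ta u + A2 i u * nu u)" for i
    unfolding tb_def[abs_def] map.metric_compat[OF EF_smooth(3) frame_smooth(2) u] D_xi[OF u]
      D_surface_frame[OF u] ip_linear by (simp add: ta_def nu_def)
  show "pderiv_at 1 ta u = om 1 u * tb u + nu u * A1 1 u"
    "pderiv_at 2 ta u = om 2 u * tb u + nu u * (A1 2 u + \<tau> * r u)"
    "pderiv_at 1 tb u = - om 1 u * ta u + nu u * (A2 1 u - \<tau> * p u)"
    "pderiv_at 2 tb u = - om 2 u * ta u + nu u * (A2 2 u - \<tau> * q u)"
    unfolding a b surface_triple[OF u] xi_c FD_frame[OF u] ip_linear surface_frame_simps[OF u]
    by (simp_all add: algebra_simps)
qed

text \<open>The normal component of the torsion equation for dF.\<close>

lemma second_form_symmetric: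
  assumes u: "u \<in> U"
  shows "p u * A1 2 u = q u * A1 1 u + r u * A2 1 u"
proof -
  have 1: "D 2 (pderiv_at 1 F) u = pderiv_at 2 p u *\<^sub>R EA u + p u *\<^sub>R D 2 EA u"
  proof -
    have "D 2 (pderiv_at 1 F) u = D 2 (\<lambda>u. p u *\<^sub>R EA u) u"
      by (rule map.D_cong[OF u]) (rule FD_frame)
    then show ?thesis by (simp add: map.D_scale[OF surf.p_smooth frame_smooth(1) u])
  qed
  have 2: "D 1 (pderiv_at 2 F) u = (pderiv_at 1 q u *\<^sub>R EA u + q u *\<^sub>R D 1 EA u)
      + (pderiv_at 1 r u *\<^sub>R EB u + r u *\<^sub>R D 1 EB u)"
  proof -
    have "D 1 (pderiv_at 2 F) u = D 1 (\<lambda>u. q u *\<^sub>R EA u + r u *\<^sub>R EB u) u"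
      by (rule map.D_cong[OF u]) (rule FD_frame)
    also have "\<dots> = D 1 (\<lambda>u. q u *\<^sub>R EA u) u + D 1 (\<lambda>u. r u *\<^sub>R EB u) u"
      by (intro map.D_add[OF _ _ u] smooth_on_scaleR surf.q_smooth surf.r_smooth frame_smooth map.open_U)
    finally show ?thesis
      by (simp add: map.D_scale[OF surf.q_smooth frame_smooth(1) u] map.D_scale[OF surf.r_smooth frame_smooth(2) u])
  qed
  have "dip u (NN u) (D 1 (pderiv_at 2 F) u) = dip u (NN u) (D 2 (pderiv_at 1 F) u)"
    by (simp add: map.torsion_free[OF u, of 1 2])
  then show ?thesis
    unfolding 1 2 by (simp add: ip_linear surface_frame_simps[OF u] A1_def A2_def)
qed

text \<open>The Codazzi equation as the normal component of the commutator of derivatives of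
  \<open>EA\<close> and \<open>EB\<close>. The constant-curvature part of
  \<open>ambient_curvature\<close> drops out because the normal is orthogonal to dF.\<close>

lemma codazzi_ambient:
  assumes u: "u \<in> U"
  shows "pderiv_at 1 (A1 2) u - pderiv_at 2 (A1 1) u + om 2 u * A2 1 u - om 1 u * A2 2 u =
      (\<kappa> - 4 * \<tau>\<^sup>2) * p u * r u * nu u * tb u"
    "pderiv_at 1 (A2 2) u - pderiv_at 2 (A2 1) u - om 2 u * A1 1 u + om 1 u * A1 2 u =
      - (\<kappa> - 4 * \<tau>\<^sup>2) * p u * r u * nu u * ta u"
proof -
  note x = map.F_maps[OF u]
  note sm = surface_scalars_smooth surf.om_smooth frame_smooth map.open_U
  have xi_c: "dip u (EA u) (xi (F u)) = ta u" "dip u (EB u) (xi (F u)) = tb u"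
    "dip u (NN u) (xi (F u)) = nu u"
    by (simp_all add: ta_def tb_def nu_def total.g_sym[OF x, of _ "xi (F u)"])
  have mo: "smooth_on U (\<lambda>u. - om j u)" for j by (intro smooth_intros sm)
  have 1: "dip u (NN u) (D i (D j EA) u) = om j u * A2 i u + pderiv_at i (A1 j) u" for i j
  proof -
    have "D i (D j EA) u = D i (\<lambda>u. om j u *\<^sub>R EB u + A1 j u *\<^sub>R NN u) u"
      by (rule map.D_cong[OF u]) (rule D_surface_frame(1))
    also have "\<dots> = D i (\<lambda>u. om j u *\<^sub>R EB u) u + D i (\<lambda>u. A1 j u *\<^sub>R NN u) u"
      by (intro map.D_add[OF _ _ u] smooth_on_scaleR sm)
    finally have e: "D i (D j EA) u = D i (\<lambda>u. om j u *\<^sub>R EB u) u + D i (\<lambda>u. A1 j u *\<^sub>R NN u) u" .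
    show ?thesis
      unfolding e map.D_scale[OF surf.om_smooth frame_smooth(2) u] map.D_scale[OF surface_scalars_smooth(1) frame_smooth(3) u]
        D_surface_frame[OF u] ip_linear surface_frame_simps[OF u] by simp
  qed
  have 2: "dip u (NN u) (D i (D j EB) u) = - om j u * A1 i u + pderiv_at i (A2 j) u" for i j
  proof -
    have "D i (D j EB) u = D i (\<lambda>u. (- om j u) *\<^sub>R EA u + A2 j u *\<^sub>R NN u) u"
      by (rule map.D_cong[OF u]) (rule D_surface_frame(2))
    also have "\<dots> = D i (\<lambda>u. (- om j u) *\<^sub>R EA u) u + D i (\<lambda>u. A2 j u *\<^sub>R NN u) u"
      by (intro map.D_add[OF _ _ u] smooth_on_scaleR sm mo)
    finally have e: "D i (D j EB) u = D i (\<lambda>u. (- om j u) *\<^sub>R EA u) u + D i (\<lambda>u. A2 j u *\<^sub>R NN u) u" .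
    show ?thesis
      unfolding e map.D_scale[OF mo frame_smooth(1) u] map.D_scale[OF surface_scalars_smooth(2) frame_smooth(3) u]
        D_surface_frame[OF u] ip_linear surface_frame_simps[OF u] by simp
  qed
  have R1: "dip u (map.Rm 1 2 u (EA u)) (NN u) = (\<kappa> - 4 * \<tau>\<^sup>2) * p u * r u * nu u * tb u"
    unfolding ambient_curvature[OF u] wedge_FD[OF u] FD_components[OF u] surface_triple[OF u, of "EA u"]
      ip_linear surface_frame_simps[OF u] xi_c by simp
  have R2: "dip u (map.Rm 1 2 u (EB u)) (NN u) = - (\<kappa> - 4 * \<tau>\<^sup>2) * p u * r u * nu u * ta u"
    unfolding ambient_curvature[OF u] wedge_FD[OF u] FD_components[OF u] surface_triple[OF u, of "EB u"]
      ip_linear surface_frame_simps[OF u] xi_c by (simp add: algebra_simps)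
  show "pderiv_at 1 (A1 2) u - pderiv_at 2 (A1 1) u + om 2 u * A2 1 u - om 1 u * A2 2 u =
      (\<kappa> - 4 * \<tau>\<^sup>2) * p u * r u * nu u * tb u"
    unfolding R1[symmetric] map.curvature_Rm[OF frame_smooth(1) u, symmetric]
      total.g_sym[OF x, of _ "NN u"] ip_linear 1 by simp
  show "pderiv_at 1 (A2 2) u - pderiv_at 2 (A2 1) u - om 2 u * A1 1 u + om 1 u * A1 2 u =
      - (\<kappa> - 4 * \<tau>\<^sup>2) * p u * r u * nu u * ta u"
    unfolding R2[symmetric] map.curvature_Rm[OF frame_smooth(2) u, symmetric]
      total.g_sym[OF x, of _ "NN u"] ip_linear 2 by simp
qed

section \<open>The operators of the surface in frame components\<close>

lemma tangent_coords_frame: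
  assumes u: "u \<in> U"
  shows "tangent_coords g F u W = dip u W (EA u) *\<^sub>R surf.e1 u + dip u W (EB u) *\<^sub>R surf.e2 u"
  unfolding tangent_coords_def
proof (rule matrix_inv_vector_eqI[OF surf.g_det[OF u]])
  show "\<gamma> u *v (dip u W (EA u) *\<^sub>R surf.e1 u + dip u W (EB u) *\<^sub>R surf.e2 u) =
      (\<chi> i. dip u W (FD i u))"
    using surf.p_pos[OF u] surf.r_pos[OF u]
    by (simp add: vec_eq_iff forall_2 matrix_vector_mult_def sum_2 surf.metric_pqr[OF u]
        surf.frame_components FD_frame[OF u] ip_linear power2_eq_square) (simp add: field_simps)
qed

lemma shape_operator_frame:
  assumes u: "u \<in> U"
  shows "shape_operator g F u X = (X $ 1 * A1 1 u + X $ 2 * A1 2 u) *\<^sub>R surf.e1 u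
    + (X $ 1 * A2 1 u + X $ 2 * A2 2 u) *\<^sub>R surf.e2 u"
  unfolding shape_operator_def tangent_coords_frame[OF u]
    cov_along_covd[OF map.diffU[OF map.F_smooth u] map.diffU[OF frame_smooth(3) u]] sum_2
    D_surface_frame[OF u] ip_linear surface_frame_simps[OF u]
  by (simp add: algebra_simps)

lemma tangent_field_frame:
  assumes u: "u \<in> U"
  shows "tangent_field g xi F u = ta u *\<^sub>R surf.e1 u + tb u *\<^sub>R surf.e2 u"
  unfolding tangent_field_def tangent_coords_frame[OF u] ip_linear surface_frame_simps[OF u]
  by (simp add: ta_def tb_def)

lemma rotation_J_frame:
  assumes u: "u \<in> U"
  shows "rotation_J g F u X = (- surf.th2 u X) *\<^sub>R surf.e1 u + surf.th1 u X *\<^sub>R surf.e2 u"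
proof -
  have "dF u X = surf.th1 u X *\<^sub>R EA u + surf.th2 u X *\<^sub>R EB u"
    by (simp add: dF_FD[OF u] FD_frame[OF u] surf.th1_def surf.th2_def algebra_simps)
  then show ?thesis
    unfolding rotation_J_def tangent_coords_frame[OF u]
    by (simp add: surface_triple[OF u] ip_linear surface_frame_simps[OF u])
qed

lemma rotated_tangent_field_frame:
  assumes u: "u \<in> U"
  shows "rotated_tangent_field \<theta> g xi F u =
    (cos \<theta> * ta u + sin \<theta> * tb u) *\<^sub>R surf.e1 u + (cos \<theta> * tb u - sin \<theta> * ta u) *\<^sub>R surf.e2 u"
  unfolding rotated_tangent_field_def tangent_field_frame[OF u] rotation_J_frame[OF u]
  by (simp add: surf.th_linear surf.th_frame[OF u] algebra_simps)

end

locale cmc_surface = immersed_surface +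
  fixes H \<theta> :: real
  assumes mean_curvature: "u \<in> U \<Longrightarrow> mean_curvature g F u = H"
    and H_tau: "H\<^sup>2 + \<tau>\<^sup>2 \<noteq> 0"
    and angle: "cos (2 * \<theta>) = H / sqrt (H\<^sup>2 + \<tau>\<^sup>2)" "sin (2 * \<theta>) = - \<tau> / sqrt (H\<^sup>2 + \<tau>\<^sup>2)"
begin

text \<open>
  As complex functions in the frame, \<open>b = b1 + i b2\<close> is the traceless part of the shape operator,
  \<open>z = z1 + i z2\<close> is the square of \<open>ta + i tb\<close>, and \<open>s = b - (\<alpha>/2) exp (-2i\<theta>) z\<close>.
\<close>

definition b1 where "b1 u = A1 1 u / p u - H"
definition b2 where "b2 u = A2 1 u / p u"

text \<open>Symmetry eliminates one of the four coefficients and the mean curvature fixes the trace,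
  so \<open>b1\<close> and \<open>b2\<close> carry all that remains.\<close>

lemma second_form_b:
  assumes u: "u \<in> U"
  shows "A1 1 u = p u * (H + b1 u)" "A2 1 u = p u * b2 u" "A1 2 u = q u * (H + b1 u) + r u * b2 u"
    "A2 2 u = q u * b2 u + r u * (H - b1 u)"
proof -
  note pos = surf.p_pos[OF u] surf.r_pos[OF u]
  show 1: "A1 1 u = p u * (H + b1 u)" and 2: "A2 1 u = p u * b2 u"
    using pos by (simp_all add: b1_def b2_def)
  have "p u * A1 2 u = p u * (q u * (H + b1 u) + r u * b2 u)"
    using second_form_symmetric[OF u] by (simp add: 1 2 algebra_simps)
  then show "A1 2 u = q u * (H + b1 u) + r u * b2 u" using pos by simp
  have "2 * H = shape_operator g F u (axis 1 1) $ 1 + shape_operator g F u (axis 2 1) $ 2"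
    using mean_curvature[OF u] by (simp add: mean_curvature_def trace_def sum_2 matrix_def)
  also have "\<dots> = A1 1 u / p u - q u / (p u * r u) * A2 1 u + A2 2 u / r u"
    by (simp add: shape_operator_frame[OF u] surf.frame_components)
  finally have e: "A2 2 u / r u = 2 * H - A1 1 u / p u + q u / (p u * r u) * A2 1 u" by simp
  have "A2 2 u = r u * (A2 2 u / r u)" using pos by simp
  also have "\<dots> = q u * b2 u + r u * (H - b1 u)"
    unfolding e 1 2 using pos by (simp add: field_simps)
  finally show "A2 2 u = q u * b2 u + r u * (H - b1 u)" .
qed

lemma b_smooth: "smooth_on U b1" "smooth_on U b2"
  unfolding b1_def[abs_def] b2_def[abs_def]
  by (intro smooth_on_diff smooth_on_const smooth_on_divide surface_scalars_smooth surf.p_smooth map.open_U;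
      use surf.p_pos in force)+

definition Pb where "Pb i u = pderiv_at i b1 u - 2 * om i u * b2 u"
definition Qb where "Qb i u = pderiv_at i b2 u + 2 * om i u * b1 u"

text \<open>Constancy of H enters here: otherwise its derivatives would stand beside those of
  \<open>b1\<close>. The two lines are the imaginary part and minus the real part of \<partial>b =
  (\<kappa> - 4 \<tau>^2) \<nu> t, times \<open>p u * r u\<close>.\<close>

lemma codazzi_b:
  assumes u: "u \<in> U"
  shows "q u * Pb 1 u + r u * Qb 1 u - p u * Pb 2 u = (\<kappa> - 4 * \<tau>\<^sup>2) * p u * r u * nu u * tb u"
    "q u * Qb 1 u - r u * Pb 1 u - p u * Qb 2 u = - (\<kappa> - 4 * \<tau>\<^sup>2) * p u * r u * nu u * ta u"
proof -
  note sm = b_smooth surf.p_smooth surf.q_smooth surf.r_smooth map.open_U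
  note d = b_smooth[THEN map.diffU, OF u] surf.p_smooth[THEN map.diffU, OF u]
    surf.q_smooth[THEN map.diffU, OF u] surf.r_smooth[THEN map.diffU, OF u]
  have sH: "smooth_on U (\<lambda>u. H + b1 u)" "smooth_on U (\<lambda>u. H - b1 u)"
    by (intro smooth_intros sm)+
  note dH = sH[THEN map.diffU, OF u]
  have pH: "pderiv_at i (\<lambda>u. H + b1 u) u = pderiv_at i b1 u"
    "pderiv_at i (\<lambda>u. H - b1 u) u = - pderiv_at i b1 u" for i
    by (simp_all add: pderiv_at_add pderiv_at_diff d)
  have "pderiv_at 1 (A1 2) u = pderiv_at 1 (\<lambda>u. q u * (H + b1 u) + r u * b2 u) u"
    by (rule pderiv_at_cong[OF map.open_U u]) (rule second_form_b)
  also have "\<dots> = pderiv_at 1 (\<lambda>u. q u * (H + b1 u)) u + pderiv_at 1 (\<lambda>u. r u * b2 u) u"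
    by (intro pderiv_at_add map.diffU[OF _ u] smooth_on_mult sm sH)
  finally have 1: "pderiv_at 1 (A1 2) u = q u * pderiv_at 1 b1 u + pderiv_at 1 q u * (H + b1 u)
      + (r u * pderiv_at 1 b2 u + pderiv_at 1 r u * b2 u)"
    by (simp add: pderiv_at_mult d dH pH)
  have "pderiv_at 1 (A2 2) u = pderiv_at 1 (\<lambda>u. q u * b2 u + r u * (H - b1 u)) u"
    by (rule pderiv_at_cong[OF map.open_U u]) (rule second_form_b)
  also have "\<dots> = pderiv_at 1 (\<lambda>u. q u * b2 u) u + pderiv_at 1 (\<lambda>u. r u * (H - b1 u)) u"
    by (intro pderiv_at_add map.diffU[OF _ u] smooth_on_mult sm sH)
  finally have 2: "pderiv_at 1 (A2 2) u = q u * pderiv_at 1 b2 u + pderiv_at 1 q u * b2 u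
      + (- (r u * pderiv_at 1 b1 u) + pderiv_at 1 r u * (H - b1 u))"
    by (simp add: pderiv_at_mult d dH pH)
  have "pderiv_at 2 (A1 1) u = pderiv_at 2 (\<lambda>u. p u * (H + b1 u)) u"
    by (rule pderiv_at_cong[OF map.open_U u]) (rule second_form_b)
  then have 3: "pderiv_at 2 (A1 1) u = p u * pderiv_at 2 b1 u + pderiv_at 2 p u * (H + b1 u)"
    by (simp add: pderiv_at_mult d dH pH)
  have "pderiv_at 2 (A2 1) u = pderiv_at 2 (\<lambda>u. p u * b2 u) u"
    by (rule pderiv_at_cong[OF map.open_U u]) (rule second_form_b)
  then have 4: "pderiv_at 2 (A2 1) u = p u * pderiv_at 2 b2 u + pderiv_at 2 p u * b2 u"
    by (simp add: pderiv_at_mult d)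
  have 5: "pderiv_at 1 q u = pderiv_at 2 p u + om 1 u * r u"
    using surf.structure_equations(1)[OF u] by simp
  note 6 = surf.structure_equations(2)[OF u]
  show "q u * Pb 1 u + r u * Qb 1 u - p u * Pb 2 u = (\<kappa> - 4 * \<tau>\<^sup>2) * p u * r u * nu u * tb u"
    unfolding codazzi_ambient(1)[OF u, symmetric] 1 3 second_form_b[OF u] 5 6 Pb_def Qb_def
    by (simp add: algebra_simps)
  show "q u * Qb 1 u - r u * Pb 1 u - p u * Qb 2 u = - (\<kappa> - 4 * \<tau>\<^sup>2) * p u * r u * nu u * ta u"
    unfolding codazzi_ambient(2)[OF u, symmetric] 2 4 second_form_b[OF u] 5 6 Pb_def Qb_def
    by (simp add: algebra_simps)
qed

section \<open>The square of the tangential field and the Abresch-Rosenberg combination\<close>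

definition z1 where "z1 u = ta u * ta u - tb u * tb u"
definition z2 where "z2 u = ta u * tb u + ta u * tb u"
definition Pz where "Pz i u = pderiv_at i z1 u - 2 * om i u * z2 u"
definition Qz where "Qz i u = pderiv_at i z2 u + 2 * om i u * z1 u"

lemma z_smooth: "smooth_on U z1" "smooth_on U z2"
  unfolding z1_def[abs_def] z2_def[abs_def]
  by (intro smooth_intros surface_scalars_smooth map.open_U)+

lemma pderiv_z:
  assumes u: "u \<in> U"
  shows "pderiv_at i z1 u = 2 * (ta u * pderiv_at i ta u - tb u * pderiv_at i tb u)"
    "pderiv_at i z2 u = 2 * (ta u * pderiv_at i tb u + tb u * pderiv_at i ta u)"
proof -
  note sm = surface_scalars_smooth(3,4)
  note d = sm[THEN map.diffU, OF u]
  have "pderiv_at i z1 u = pderiv_at i (\<lambda>u. ta u * ta u) u - pderiv_at i (\<lambda>u. tb u * tb u) u"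
    unfolding z1_def[abs_def] by (intro pderiv_at_diff map.diffU[OF _ u] smooth_on_mult sm map.open_U)
  then show "pderiv_at i z1 u = 2 * (ta u * pderiv_at i ta u - tb u * pderiv_at i tb u)"
    by (simp add: pderiv_at_mult d)
  have "pderiv_at i z2 u = pderiv_at i (\<lambda>u. ta u * tb u) u + pderiv_at i (\<lambda>u. ta u * tb u) u"
    unfolding z2_def[abs_def] by (intro pderiv_at_add map.diffU[OF _ u] smooth_on_mult sm map.open_U)
  then show "pderiv_at i z2 u = 2 * (ta u * pderiv_at i tb u + tb u * pderiv_at i ta u)"
    by (simp add: pderiv_at_mult d)
qed

text \<open>The corresponding parts of \<partial>(t^2) = 2 t \<partial>t = 4 \<nu> (H - i \<tau>) t;
  the traceless part of the shape operator cancels.\<close>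

lemma codazzi_z:
  assumes u: "u \<in> U"
  shows "q u * Pz 1 u + r u * Qz 1 u - p u * Pz 2 u = 4 * p u * r u * nu u * (H * tb u - \<tau> * ta u)"
    "q u * Qz 1 u - r u * Pz 1 u - p u * Qz 2 u = - 4 * p u * r u * nu u * (\<tau> * tb u + H * ta u)"
  unfolding Pz_def Qz_def pderiv_z[OF u] pderiv_t[OF u] second_form_b[OF u] z1_def z2_def
  by (simp_all add: algebra_simps)

abbreviation "\<alpha> \<equiv> AR_alpha \<kappa> \<tau> H"

definition s1 where "s1 u = b1 u - \<alpha> / 2 * (cos (2 * \<theta>) * z1 u + sin (2 * \<theta>) * z2 u)"
definition s2 where "s2 u = b2 u - \<alpha> / 2 * (cos (2 * \<theta>) * z2 u - sin (2 * \<theta>) * z1 u)"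

lemma s_smooth: "smooth_on U s1" "smooth_on U s2"
  unfolding s1_def[abs_def] s2_def[abs_def]
  by (intro smooth_intros b_smooth z_smooth map.open_U)+

lemma pderiv_s:
  assumes u: "u \<in> U"
  shows "pderiv_at i s1 u = pderiv_at i b1 u - \<alpha> / 2 * (cos (2 * \<theta>) * pderiv_at i z1 u + sin (2 * \<theta>) * pderiv_at i z2 u)"
    "pderiv_at i s2 u = pderiv_at i b2 u - \<alpha> / 2 * (cos (2 * \<theta>) * pderiv_at i z2 u - sin (2 * \<theta>) * pderiv_at i z1 u)"
proof -
  note d = b_smooth[THEN map.diffU, OF u] z_smooth[THEN map.diffU, OF u]
  note dm = differentiable_bounded_linear[OF bounded_linear_mult_right]
  have m: "pderiv_at i (\<lambda>u. k * f u) u = k * pderiv_at i f u" if "f differentiable (at u)" for f and k :: real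
    by (rule pderiv_at_bounded_linear[OF bounded_linear_mult_right that])
  show "pderiv_at i s1 u = pderiv_at i b1 u - \<alpha> / 2 * (cos (2 * \<theta>) * pderiv_at i z1 u + sin (2 * \<theta>) * pderiv_at i z2 u)"
    unfolding s1_def[abs_def]
    by (subst pderiv_at_diff m pderiv_at_add, (intro d dm differentiable_add)+)+ (rule refl)
  show "pderiv_at i s2 u = pderiv_at i b2 u - \<alpha> / 2 * (cos (2 * \<theta>) * pderiv_at i z2 u - sin (2 * \<theta>) * pderiv_at i z1 u)"
    unfolding s2_def[abs_def]
    by (subst pderiv_at_diff m, (intro d dm differentiable_diff)+)+ (rule refl)
qed

text \<open>The real part and, up to a factor, the imaginary part of 2 \<alpha> exp (-2i\<theta>) (H
  - i \<tau>) = \<kappa> - 4 \<tau>^2: the exponential cancels the argument of H - i \<tau>, the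
  modulus cancels the root in \<alpha>.\<close>

lemma alpha_angle:
  "2 * \<alpha> * (H * cos (2 * \<theta>) - \<tau> * sin (2 * \<theta>)) = \<kappa> - 4 * \<tau>\<^sup>2"
  "\<tau> * cos (2 * \<theta>) + H * sin (2 * \<theta>) = 0"
proof -
  define R where "R = sqrt (H\<^sup>2 + \<tau>\<^sup>2)"
  have "H\<^sup>2 + \<tau>\<^sup>2 > 0" using H_tau by (smt (verit) zero_le_power2)
  then have R: "R > 0" "R * R = H\<^sup>2 + \<tau>\<^sup>2" by (simp_all add: R_def)
  have "H * cos (2 * \<theta>) - \<tau> * sin (2 * \<theta>) = (H\<^sup>2 + \<tau>\<^sup>2) / R"
    by (simp add: angle R_def[symmetric]) (simp add: power2_eq_square add_divide_distrib)
  also have "\<dots> = R" using R by (simp add: R(2)[symmetric])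
  finally show "2 * \<alpha> * (H * cos (2 * \<theta>) - \<tau> * sin (2 * \<theta>)) = \<kappa> - 4 * \<tau>\<^sup>2"
    using R(1) by (simp add: AR_alpha_def R_def[symmetric])
  show "\<tau> * cos (2 * \<theta>) + H * sin (2 * \<theta>) = 0" by (simp add: angle)
qed

text \<open>For v = exp (-i\<theta>) t, the operator sending X to (v . X) v - |v|^2 X / 2 is X
  \<mapsto> (v^2 / 2) cnj X. This is the origin of the factor \<alpha>/2 and of the doubled
  angle.\<close>

lemma AR_operator_frame:
  assumes u: "u \<in> U"
  shows "AR_operator \<kappa> \<tau> H \<theta> g xi F u X = (s1 u * surf.th1 u X + s2 u * surf.th2 u X) *\<^sub>R surf.e1 u
      + (s2 u * surf.th1 u X - s1 u * surf.th2 u X) *\<^sub>R surf.e2 u"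
proof -
  define C S where "C = cos \<theta>" and "S = sin \<theta>"
  have CS: "C * C + S * S = 1" by (simp add: C_def S_def flip: power2_eq_square)
  have A: "shape_operator g F u X = ((H + b1 u) * surf.th1 u X + b2 u * surf.th2 u X) *\<^sub>R surf.e1 u
      + (b2 u * surf.th1 u X + (H - b1 u) * surf.th2 u X) *\<^sub>R surf.e2 u"
    unfolding shape_operator_frame[OF u] second_form_b[OF u]
    by (simp add: surf.th1_def surf.th2_def algebra_simps)
  have dbl: "cos (2 * \<theta>) = C * C - S * S" "sin (2 * \<theta>) = 2 * S * C"
    by (simp_all add: C_def S_def cos_double sin_double power2_eq_square)
  \<comment> \<open>The factor \<open>C * C + S * S\<close> is 1; keeping it makes the claim
    homogeneous in \<open>C\<close> and \<open>S\<close>, hence a polynomial identity.\<close>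
  have TT: "ip (\<gamma> u) (tangent_field g xi F u) (tangent_field g xi F u) =
      (C * C + S * S) * (ta u * ta u + tb u * tb u)"
    unfolding CS by (simp add: tangent_field_frame[OF u] surf.ip_th[OF u] surf.th_linear surf.th_frame[OF u])
  define k where "k = \<alpha> / 2"
  have k: "\<alpha> = 2 * k" by (simp add: k_def)
  have s: "s1 u = b1 u - k * ((C * C - S * S) * z1 u + 2 * S * C * z2 u)"
    "s2 u = b2 u - k * ((C * C - S * S) * z2 u - 2 * S * C * z1 u)"
    by (simp_all add: s1_def s2_def dbl k)
  show ?thesis
    unfolding AR_operator_def Let_def A rotated_tangent_field_frame[OF u] C_def[symmetric] S_def[symmetric] TT k
    by (rule surf.frame_ext[OF u];
        simp only: surf.th_linear surf.th_frame[OF u] surf.ip_th[OF u] s z1_def z2_def;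
        simp add: algebra_simps)
qed

lemma AR_codazzi_operator:
  "codazzi_operator U \<gamma> s1 s2 (AR_operator \<kappa> \<tau> H \<theta> g xi F)"
proof
  show "smooth_on U s1" "smooth_on U s2" by (rule s_smooth)+
  show "AR_operator \<kappa> \<tau> H \<theta> g xi F u X = (s1 u * surf.th1 u X + s2 u * surf.th2 u X) *\<^sub>R surf.e1 u
      + (s2 u * surf.th1 u X - s1 u * surf.th2 u X) *\<^sub>R surf.e2 u" if "u \<in> U" for u X
    by (rule AR_operator_frame[OF that])
  fix u assume u: "u \<in> U"
  define C S where "C = cos (2 * \<theta>)" and "S = sin (2 * \<theta>)"
  \<comment> \<open>\<alpha> and \<theta> are constants, so the covariant derivative of s is that of
    b minus \<alpha>/2 exp (-2i\<theta>) times that of t^2.\<close>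
  have P: "pderiv_at i s1 u - 2 * om i u * s2 u = Pb i u - \<alpha> / 2 * (C * Pz i u + S * Qz i u)" for i
    unfolding pderiv_s[OF u] s2_def Pb_def Pz_def Qz_def C_def S_def by (simp add: field_simps)
  have Q: "pderiv_at i s2 u + 2 * om i u * s1 u = Qb i u - \<alpha> / 2 * (C * Qz i u - S * Pz i u)" for i
    unfolding pderiv_s[OF u] s1_def Qb_def Pz_def Qz_def C_def S_def by (simp add: field_simps)
  define k where "k = p u * r u * nu u"
  have "q u * (Pb 1 u - \<alpha> / 2 * (C * Pz 1 u + S * Qz 1 u)) + r u * (Qb 1 u - \<alpha> / 2 * (C * Qz 1 u - S * Pz 1 u))
      - p u * (Pb 2 u - \<alpha> / 2 * (C * Pz 2 u + S * Qz 2 u)) =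
      (q u * Pb 1 u + r u * Qb 1 u - p u * Pb 2 u) - \<alpha> / 2 * (C * (q u * Pz 1 u + r u * Qz 1 u - p u * Pz 2 u)
      + S * (q u * Qz 1 u - r u * Pz 1 u - p u * Qz 2 u))"
    by (simp add: field_simps)
  \<comment> \<open>With both Codazzi equations inserted, \<open>tb\<close> multiplies the real and
    \<open>ta\<close> the imaginary part of the relation in \<open>alpha_angle\<close>.\<close>
  also have "\<dots> = k * tb u * ((\<kappa> - 4 * \<tau>\<^sup>2) - 2 * \<alpha> * (H * C - \<tau> * S)) + 2 * \<alpha> * k * ta u * (\<tau> * C + H * S)"
    unfolding codazzi_b[OF u] codazzi_z[OF u] k_def by (simp add: field_simps)
  also have "\<dots> = 0" using alpha_angle by (simp add: C_def S_def)
  finally show "p u * (pderiv_at 2 s1 u - 2 * om 2 u * s2 u) =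
      q u * (pderiv_at 1 s1 u - 2 * om 1 u * s2 u) + r u * (pderiv_at 1 s2 u + 2 * om 1 u * s1 u)"
    unfolding P Q by simp
  have "q u * (Qb 1 u - \<alpha> / 2 * (C * Qz 1 u - S * Pz 1 u)) - r u * (Pb 1 u - \<alpha> / 2 * (C * Pz 1 u + S * Qz 1 u))
      - p u * (Qb 2 u - \<alpha> / 2 * (C * Qz 2 u - S * Pz 2 u)) =
      (q u * Qb 1 u - r u * Pb 1 u - p u * Qb 2 u) - \<alpha> / 2 * (C * (q u * Qz 1 u - r u * Pz 1 u - p u * Qz 2 u)
      - S * (q u * Pz 1 u + r u * Qz 1 u - p u * Pz 2 u))"
    by (simp add: field_simps)
  also have "\<dots> = - k * ta u * ((\<kappa> - 4 * \<tau>\<^sup>2) - 2 * \<alpha> * (H * C - \<tau> * S)) + 2 * \<alpha> * k * tb u * (\<tau> * C + H * S)"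
    unfolding codazzi_b[OF u] codazzi_z[OF u] k_def by (simp add: field_simps)
  also have "\<dots> = 0" using alpha_angle by (simp add: C_def S_def)
  finally show "p u * (pderiv_at 2 s2 u + 2 * om 2 u * s1 u) =
      q u * (pderiv_at 1 s2 u + 2 * om 1 u * s1 u) - r u * (pderiv_at 1 s1 u - 2 * om 1 u * s2 u)"
    unfolding P Q by simp
qed

end

section \<open>Passing to charts\<close>

lemma (in smooth_manifold) chart_inv_map:
  assumes "c \<in> \<A>" "p \<in> chart_dom c"
  shows "chart_inv c (chart_map c p) = p" "chart_map c p \<in> chart_img c"
  using homeomorphism_apply1[OF chart_homeomorphism[OF assms(1)] assms(2)] assms(2)
  by (auto simp: chart_img_def)

lemma (in smooth_manifold) local_dom_open:
  assumes "c \<in> \<A>" "smooth_manifold \<B>" "d \<in> \<B>" "continuous_on (points \<A>) f"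
  shows "open (local_dom c d f)"
proof -
  interpret B: smooth_manifold \<B> by (rule assms(2))
  let ?T = "chart_dom c \<inter> f -` chart_dom d"
  have "continuous_on (chart_dom c) f"
    by (rule continuous_on_subset[OF assms(4)]) (use assms(1) in \<open>auto simp: points_def\<close>)
  then have T: "open ?T"
    by (rule continuous_open_preimage[OF _ chart_open(1)[OF assms(1)] B.chart_open(1)[OF assms(3)]])
  have "local_dom c d f = chart_img c \<inter> chart_inv c -` ?T"
    using chart_inv_map[OF assms(1)] by (auto simp: local_dom_def chart_img_def image_iff)
  then show ?thesis
    using continuous_open_preimage[OF homeomorphism_cont2[OF chart_homeomorphism[OF assms(1)]]
        chart_open(2)[OF assms(1)] T] by simp
qed

lemma (in smooth_manifold) local_rep_at:
  assumes "c \<in> \<A>" "p \<in> chart_dom c"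
  shows "local_rep c d f (chart_map c p) = chart_map d (f p)"
  using chart_inv_map[OF assms] by (simp add: local_rep_def)

text \<open>A fibre is a trajectory of \<xi>, so the projection is constant along it and the chain
  rule gives the claim.\<close>

lemma (in E_kappa_tau) projection_vertical:
  assumes e: "e \<in> \<E>" and d: "d \<in> \<M>" and x: "x \<in> local_dom e d \<pi>"
  shows "frechet_derivative (local_rep e d \<pi>) (at x) (\<xi> e x) = 0"
proof -
  obtain a where a: "a \<in> chart_dom e" "\<pi> a \<in> chart_dom d" "x = chart_map e a"
    using x by (auto simp: local_dom_def)
  have aE: "a \<in> points \<E>" using a e by (auto simp: points_def)
  obtain \<beta> where \<beta>: "trajectory \<E> \<xi> \<beta>" "\<beta> 0 = a" "{b \<in> points \<E>. \<pi> b = \<pi> a} = range \<beta>"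
    using xi_fibers[OF aE] by blast
  have "\<beta> 0 \<in> chart_dom e" using a \<beta>(2) by simp
  then have "((\<lambda>s. chart_map e (\<beta> s)) has_vector_derivative \<xi> e (chart_map e (\<beta> 0))) (at 0)"
    using \<beta>(1) e unfolding trajectory_def by blast
  then have vd: "((\<lambda>s. chart_map e (\<beta> s)) has_vector_derivative \<xi> e x) (at 0)"
    by (simp add: \<beta>(2) a(3))
  have "smooth_on (local_dom e d \<pi>) (local_rep e d \<pi>)"
    using submersion e d by (auto simp: riemannian_submersion_def smooth_map_def)
  then have "(local_rep e d \<pi> has_derivative frechet_derivative (local_rep e d \<pi>) (at x)) (at (chart_map e (\<beta> 0)))"
    using has_derivative_frechet[OF smooth_on_differentiable] x by (simp add: \<beta>(2) a(3))
  then have "((\<lambda>s. local_rep e d \<pi> (chart_map e (\<beta> s))) has_vector_derivative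
      frechet_derivative (local_rep e d \<pi>) (at x) (\<xi> e x)) (at 0)"
    using vector_derivative_diff_chain_within[OF vd, of "local_rep e d \<pi>" "frechet_derivative (local_rep e d \<pi>) (at x)"]
    by (simp add: o_def has_derivative_at_withinI)
  moreover have "((\<lambda>s. local_rep e d \<pi> (chart_map e (\<beta> s))) has_vector_derivative 0) (at 0)"
  proof (rule has_vector_derivative_transform_within_open)
    show "((\<lambda>s. chart_map d (\<pi> a)) has_vector_derivative 0) (at 0)" by simp
    \<comment> \<open>The trajectory may leave the chart; continuity keeps it inside for parameters
      near 0, which is enough for the derivative.\<close>
    have "continuous_on UNIV \<beta>" using \<beta>(1) by (simp add: trajectory_def)
    then show "open (\<beta> -` chart_dom e)"
      using total.chart_open(1)[OF e] by (rule open_vimage[rotated])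
    show "0 \<in> \<beta> -` chart_dom e" using a \<beta>(2) by simp
    fix s assume "s \<in> \<beta> -` chart_dom e"
    moreover have "\<pi> (\<beta> s) = \<pi> a" using \<beta>(3) by blast
    ultimately show "chart_map d (\<pi> a) = local_rep e d \<pi> (chart_map e (\<beta> s))"
      by (simp add: total.local_rep_at[OF e])
  qed
  ultimately show ?thesis by (rule vector_derivative_unique_at)
qed

text \<open>Both identities depend only on germs at the point. A base chart around the projection of
  \<open>f p\<close> joins the two given charts, and the immersion is restricted to the open set
  \<open>U\<close> lying over it.\<close>

theorem theorem3:
  fixes \<kappa> \<tau> H \<theta> :: real
    and \<E> :: "('e::{t2_space, second_countable_topology}, 3) chart set"
    and g :: "('e, 3) chart \<Rightarrow> real^3 \<Rightarrow> real^3^3"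
    and \<M> :: "('b::{t2_space, second_countable_topology}, 2) chart set"
    and h :: "('b, 2) chart \<Rightarrow> real^2 \<Rightarrow> real^2^2"
    and \<pi> :: "'e \<Rightarrow> 'b"
    and \<xi> :: "('e, 3) chart \<Rightarrow> real^3 \<Rightarrow> real^3"
    and \<S> :: "('s::{t2_space, second_countable_topology}, 2) chart set"
    and f :: "'s \<Rightarrow> 'e"
  assumes "\<kappa> - 4 * \<tau>\<^sup>2 \<noteq> 0"
    and "E_kappa_tau \<kappa> \<tau> \<E> g \<M> h \<pi> \<xi>"
    and "H_surface H \<S> \<E> g f"
    and "H\<^sup>2 + \<tau>\<^sup>2 \<noteq> 0"
    and "0 \<le> \<theta>" and "\<theta> < 2 * pi"
    and "exp (2 * \<i> * complex_of_real \<theta>) =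
           (complex_of_real H - \<i> * complex_of_real \<tau>) / complex_of_real (sqrt (H\<^sup>2 + \<tau>\<^sup>2))"
  shows "\<forall>p\<in>points \<S>. \<forall>c\<in>\<S>. \<forall>e\<in>\<E>. p \<in> chart_dom c \<longrightarrow> f p \<in> chart_dom e \<longrightarrow>
    (let u = chart_map c p;
         F = local_rep c e f;
         \<gamma> = induced_metric (g e) F;
         S = AR_operator \<kappa> \<tau> H \<theta> (g e) (\<xi> e) F;
         normsq_S = (\<lambda>v. endo_normsq (S v));
         norm_S = (\<lambda>v. sqrt (normsq_S v));
         K = gauss_curvature \<gamma> u;
         grad_norm_S = grad \<gamma> norm_S u
     in 1/2 * laplacian \<gamma> normsq_S u = normsq_cov_endo \<gamma> S u + 2 * K * normsq_S u
        \<and> (norm_S u \<noteq> 0 \<longrightarrow>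
             norm_S u * laplacian \<gamma> norm_S u - 2 * K * normsq_S u
               = ip (\<gamma> u) grad_norm_S grad_norm_S))"
proof (intro ballI impI, goal_cases)
  case (1 p c e)
  then have p: "p \<in> points \<S>" "p \<in> chart_dom c" and c: "c \<in> \<S>" and e: "e \<in> \<E>" and fp: "f p \<in> chart_dom e"
    by auto
  interpret E: E_kappa_tau \<kappa> \<tau> \<E> g \<M> h \<pi> \<xi> by (rule assms(2))
  interpret HS: H_surface H \<S> \<E> g f by (rule assms(3))
  have sub: "smooth_map \<E> \<M> \<pi>" "\<pi> ` points \<E> = points \<M>"
    using E.submersion by (auto simp: riemannian_submersion_def)
  have "f p \<in> points \<E>" using e fp by (auto simp: points_def)
  then have "\<pi> (f p) \<in> points \<M>" using sub(2) by blast
  then obtain d where d: "d \<in> \<M>" "\<pi> (f p) \<in> chart_dom d" by (auto simp: points_def)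
  define V where "V = local_dom e d \<pi>"
  define pr where "pr = local_rep e d \<pi>"
  define F where "F = local_rep c e f"
  define U where "U = local_dom c e f \<inter> F -` V"
  have V: "open V" "V \<subseteq> chart_img e" "\<And>x. x \<in> V \<Longrightarrow> pr x \<in> chart_img d" "smooth_on V pr"
  proof -
    show "open V" unfolding V_def
      using sub(1)
      by (intro E.total.local_dom_open[OF e E.base.smooth_manifold_axioms d(1)]) (simp add: smooth_map_def)
    show "V \<subseteq> chart_img e" by (auto simp: V_def local_dom_def chart_img_def)
    show "pr x \<in> chart_img d" if "x \<in> V" for x
      using that by (auto simp: V_def local_dom_def pr_def E.total.local_rep_at[OF e] chart_img_def)
    show "smooth_on V pr" using sub(1) e d by (simp add: smooth_map_def V_def pr_def)
  qed
  have F: "smooth_on (local_dom c e f) F" using HS.immersion_smooth c e by (simp add: smooth_map_def F_def)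
  have "open (local_dom c e f)"
    using HS.immersion_smooth
    by (intro HS.surface.local_dom_open[OF c E.total.smooth_manifold_axioms e]) (simp add: smooth_map_def)
  then have U: "open U" unfolding U_def
    by (rule continuous_open_preimage[OF smooth_on_continuous[OF F] _ V(1)])
  have u: "chart_map c p \<in> U"
    using p fp d by (auto simp: U_def V_def F_def local_dom_def HS.surface.local_rep_at[OF c])
  interpret cmc_surface V "g e" "chart_img d" "h d" pr "\<xi> e" \<kappa> \<tau> U F H \<theta>
  proof (unfold_locales)
    show "open V" "open U" by (rule V U)+
    show "smooth_on V (g e)" by (rule smooth_on_subset[OF E.total.metric_smooth[OF e] V(2)])
    show "smooth_on V (\<lambda>x. x)" by (rule smooth_on_ident)
    show "smooth_on U F" by (rule smooth_on_subset[OF F]) (simp add: U_def)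
    show "smooth_on V pr" by (rule V)
    show "smooth_on V (\<xi> e)"
      using E.xi_killing e smooth_on_subset[OF _ V(2)] by (auto simp: killing_field_def vector_field_def)
    show "open (chart_img d)" by (rule E.base.chart_open(2)[OF d(1)])
    show "smooth_on (chart_img d) (h d)" by (rule E.base.metric_smooth[OF d(1)])
    \<comment> \<open>Real and imaginary part of the equation that defines \<theta>.\<close>
    show "cos (2 * \<theta>) = H / sqrt (H\<^sup>2 + \<tau>\<^sup>2)" "sin (2 * \<theta>) = - \<tau> / sqrt (H\<^sup>2 + \<tau>\<^sup>2)"
      using arg_cong[OF assms(7), of Re] arg_cong[OF assms(7), of Im]
      by (simp_all add: Re_exp Im_exp)
    show "H\<^sup>2 + \<tau>\<^sup>2 \<noteq> 0" by (rule assms(4))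
  next
    fix x :: "real^2" and X :: "real^2" assume x: "x \<in> chart_img d"
    show "transpose (h d x) = h d x" by (rule E.base.metric_sym[OF d(1) x])
    show "X \<noteq> 0 \<Longrightarrow> ip (h d x) X X > 0" by (rule E.base.metric_pos[OF d(1) x])
    show "gauss_curvature (h d) x = \<kappa>" by (rule E.base_curvature[OF d(1) x])
  next
    fix u assume u: "u \<in> U"
    then have u': "u \<in> local_dom c e f" by (simp add: U_def)
    show "F u \<in> V" using u by (simp add: U_def)
    show "inj (frechet_derivative F (at u))" unfolding F_def by (rule HS.immersion_inj[OF c e u'])
    show "mean_curvature (g e) F u = H" unfolding F_def by (rule HS.constant_mean_curvature[OF c e u'])
  next
    fix x X :: "real^3" assume x: "x \<in> V"
    then have x': "x \<in> chart_img e" using V(2) by blast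
    show "transpose (g e x) = g e x" by (rule E.total.metric_sym[OF e x'])
    show "X \<noteq> 0 \<Longrightarrow> ip (g e x) X X > 0" by (rule E.total.metric_pos[OF e x'])
    show "pr x \<in> chart_img d" by (rule V(3)[OF x])
    show "ip (g e x) (\<xi> e x) (\<xi> e x) = 1" by (rule E.xi_unit[OF e x'])
    show "cov (g e) (\<xi> e) x X = \<tau> *\<^sub>R wedge (g e x) X (\<xi> e x)" by (rule E.xi_cov[OF e x'])
    show "frechet_derivative pr (at x) (\<xi> e x) = 0"
      unfolding pr_def by (rule E.projection_vertical[OF e d(1)]) (use x in \<open>simp add: V_def\<close>)
    show "surj (frechet_derivative pr (at x))"
      using E.submersion e d(1) x by (auto simp: riemannian_submersion_def Let_def V_def pr_def)
    show "ip (h d (pr x)) (frechet_derivative pr (at x) X) (frechet_derivative pr (at x) X) = ip (g e x) X X"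
      if "\<And>W. frechet_derivative pr (at x) W = 0 \<Longrightarrow> ip (g e x) X W = 0"
      using E.submersion e d(1) x that by (auto simp: riemannian_submersion_def Let_def V_def pr_def)
  qed
  interpret AR: codazzi_operator U \<gamma> s1 s2 "AR_operator \<kappa> \<tau> H \<theta> (g e) (\<xi> e) F"
    by (rule AR_codazzi_operator)
  show ?case
    unfolding Let_def F_def[symmetric] using AR.simons_identities[OF u] by blast
qed

end
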